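(* Let $t>1$ be an integer, $b$ an odd prime, and $0\le a_1<b$, $0\le a_2<b$. Then $$\lim_{n\to\infty}\frac{p_t(a_1,b;bn+a_2)}{p(bn+a_2)}=c_t(a_1,b;a_2).$$
   Context: For a partition $\lambda$, each cell of its Young diagram has a hook number: the number of cells directly to its right in its row plus the number of cells directly below it in its column, plus one for the cell itself. $\mathcal H_t(\lambda)$ is the multiset of hook numbers of $\lambda$ divisible by $t$, and $p_t(a,b;n)=\#\{\lambda\vdash n:\#\mathcal H_t(\lambda)\equiv a\pmod b\}$. $p(n)$ is the number of partitions of $n$. The constants are $$c_t(a,b;n)=\frac1b+\begin{cases}0&\text{if } b\mid t,\\ (-1)^{\frac{(1-t)(b-1)}4}\,\mathbb I(a,b,t,n)\,b^{-\frac{t+1}2}\left(\frac tb\right)&\text{if } b\nmid t \text{ and } t\text{ is odd},\\ i^{\frac{(1-t)(b-1)}2}\,\varepsilon_b\,b^{-\frac t2}\left(\frac{\frac1{24}(1-t^2)(1-b^2)+at-n}{b}\right)&\text{if } b\nmid t\text{ and } t\text{ is even},\end{cases}$$ where $\left(\frac{\cdot}{b}\right)$ is the Legendre symbol, $\varepsilon_b=1$ if $b\equiv1\pmod4$ and $\varepsilon_b=i$ if $b\equiv3\pmod4$, and $\mathbb I(a,b,t,n)=b-1$ if $\frac1{24}(1-t^2)(1-b^2)+at-n\equiv0\pmod b$ and $\mathbb I(a,b,t,n)=-1$ otherwise (when $b\nmid t$ the number $\frac1{24}(1-t^2)(1-b^2)$ is an integer). *)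

theory Defs
  imports Complex_Main "HOL-Library.Multiset" "HOL-Number_Theory.Number_Theory"
begin

definition partitions :: "nat \<Rightarrow> nat list set" where
  "partitions n =
     {xs. sorted_wrt (\<ge>) xs \<and> (\<forall>x\<in>set xs. 0 < x) \<and> sum_list xs = n}"

definition num_partitions :: "nat \<Rightarrow> nat" where
  "num_partitions n = card (partitions n)"

(* Cells are pairs (row, column), numbered from 0. *)
definition young_diagram :: "nat list \<Rightarrow> (nat \<times> nat) set" where
  "young_diagram xs = {(i, j). i < length xs \<and> j < xs ! i}"

fun hook_number :: "nat list \<Rightarrow> nat \<times> nat \<Rightarrow> nat" where
  "hook_number xs (i, j) =
     card {j'. j < j' \<and> (i, j') \<in> young_diagram xs}
     + card {i'. i < i' \<and> (i', j) \<in> young_diagram xs} + 1"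

definition t_hooks :: "nat \<Rightarrow> nat list \<Rightarrow> nat multiset" where
  "t_hooks t xs =
     {# h \<in># image_mset (hook_number xs) (mset_set (young_diagram xs)). t dvd h #}"

definition num_partitions_hooks :: "nat \<Rightarrow> nat \<Rightarrow> nat \<Rightarrow> nat \<Rightarrow> nat" where
  "num_partitions_hooks t a b n =
     card {xs \<in> partitions n. [size (t_hooks t xs) = a] (mod b)}"

lemma finite_partitions: "finite (partitions n)"
proof (rule finite_subset)
  have "length xs \<le> sum_list xs" if "\<forall>x\<in>set xs. 0 < x" for xs :: "nat list"
    using that by (induction xs) auto
  then show "partitions n \<subseteq> {xs. set xs \<subseteq> {..n} \<and> length xs \<le> n}"
    using member_le_sum_list by (fastforce simp: partitions_def)
qed (simp add: finite_lists_length_le)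

lemma finite_young_diagram: "finite (young_diagram xs)"
proof -
  have "young_diagram xs = (SIGMA i:{..<length xs}. {..<xs ! i})"
    by (auto simp: young_diagram_def)
  then show ?thesis by simp
qed

(* For an odd prime b not dividing t, 24 divides (1 - t^2)(1 - b^2), so the division
   is exact; the constants below use hook_arg only in that case. *)
definition hook_arg :: "nat \<Rightarrow> nat \<Rightarrow> nat \<Rightarrow> nat \<Rightarrow> int" where
  "hook_arg a b t n =
     ((1 - (int t)\<^sup>2) * (1 - (int b)\<^sup>2)) div 24 + int a * int t - int n"

definition hook_indicator :: "nat \<Rightarrow> nat \<Rightarrow> nat \<Rightarrow> nat \<Rightarrow> int" where
  "hook_indicator a b t n =
     (if [hook_arg a b t n = 0] (mod int b) then int b - 1 else - 1)"

definition eps :: "nat \<Rightarrow> complex" where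
  "eps b = (if [b = 1] (mod 4) then 1 else \<i>)"

(* b is an odd prime. The integer exponents are non-positive, and the divisions in them
   are exact: 4 divides (1 - t)(b - 1) when t is odd, and 2 divides b - 1. *)
definition hook_const :: "nat \<Rightarrow> nat \<Rightarrow> nat \<Rightarrow> nat \<Rightarrow> complex" where
  "hook_const t a b n =
     1 / of_nat b +
     (if b dvd t then 0
      else if odd t then
        (- 1) powi (((1 - int t) * (int b - 1)) div 4)
        * of_int (hook_indicator a b t n)
        * of_real (real b powr (- (real t + 1) / 2))
        * of_int (Legendre (int t) (int b))
      else
        \<i> powi (((1 - int t) * (int b - 1)) div 2)
        * eps b
        * of_real (real b powr (- real t / 2))
        * of_int (Legendre (hook_arg a b t n) (int b)))"

end

theory Submission
  imports Defs "HOL-Real_Asymp.Real_Asymp"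
begin

text \<open>
  By the core-quotient decomposition, the partitions of \<open>n\<close> with \<open>m\<close> hooks divisible by \<open>t\<close>
  are counted by \<open>f(m)\<close> times the number of integer vectors \<open>x\<close> of length \<open>t\<close> with zero sum and
  \<open>Q(x) = n - t m\<close>. Here \<open>f\<close> is the \<open>t\<close>-fold convolution of the partition function and \<open>Q\<close> is a
  quadratic polynomial. So \<open>p(n)\<close> is a sum of weights \<open>f((n - Q(x)) / t)\<close> over lattice points.
  Along a line of the lattice the weight rises and then falls. Hence translating a set of
  lattice points by a fixed vector changes its weight by at most the sum of the maximal weights
  of the lines in that direction. This is \<open>o(p(n))\<close>, because \<open>f(m + 1) / f(m)\<close> tends to \<open>1\<close> and the
  number of lines that matter is polynomial in \<open>n\<close>.

  If \<open>b\<close> divides \<open>t\<close>, a translation changes \<open>m\<close> by \<open>1\<close> modulo \<open>b\<close>, and the limit is \<open>1/b\<close>. Otherwise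
  the translations by multiples of \<open>t\<close> show that the lattice points equidistribute modulo \<open>b\<close>,
  and the limit is the density of the solutions of a quadratic congruence. Completing the square
  reduces this density to the number of zero-sum solutions of \<open>z_1^2 + ... + z_t^2 = c\<close>
  modulo \<open>b\<close>.
\<close>

text \<open>Two soft facts about growth carry the proof: \<open>p(n)\<close> outgrows every
  polynomial, and its consecutive ratios tend to 1, a property that convolution preserves. The line
  maxima are then bounded by packing. Fewer than \<open>K\<close> steps from the maximum of a line
  lower the level by at most a constant \<open>c\<close> that depends on \<open>t\<close> and
  \<open>K\<close> but not on \<open>n\<close>, so each of these \<open>K\<close> points carries at
  least half of the maximal weight once the level is large. The points are distinct and their total
  weight is at most \<open>p(n)\<close>, hence such maxima sum to at most \<open>2 p(n) / K\<close>.
  Maxima at small levels are bounded in size, and there are only polynomially many of them. The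
  translations are by \<open>t\<close> times a root vector, so that \<open>Q\<close> changes by a
  multiple of \<open>t\<close> and \<open>m\<close> remains an integer. If \<open>b\<close> does not
  divide \<open>t\<close>, these steps still connect all zero-sum vectors modulo \<open>b\<close>,
  and by completing the square the residue of \<open>m\<close> modulo \<open>b\<close> depends only
  on the residues of \<open>n\<close> and of the lattice point.\<close>

section \<open>Hooks and beta-sets\<close>

(* For a weakly decreasing list of length l, possibly with zeros at the end, the numbers
   x_i + (l - 1 - i). The hooks are the pairs of an element and a smaller non-element, and
   the length of a hook is the difference. *)
fun beta_set :: "nat list \<Rightarrow> nat set" where
  "beta_set [] = {}"
| "beta_set (x # xs) = insert (x + length xs) (beta_set xs)"

definition inversions :: "nat set \<Rightarrow> (nat \<times> nat) set" where
  "inversions B = {(s, g). s \<in> B \<and> g \<notin> B \<and> g < s}"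

definition t_inversions :: "nat \<Rightarrow> nat set \<Rightarrow> (nat \<times> nat) set" where
  "t_inversions t B = {(s, g) \<in> inversions B. t dvd s - g}"

lemma finite_beta_set [simp]: "finite (beta_set xs)"
  by (induction xs) auto

lemma beta_set_less:
  "sorted_wrt (\<ge>) (x # xs) \<Longrightarrow> s \<in> beta_set xs \<Longrightarrow> s < x + length xs"
proof (induction xs arbitrary: x)
  case (Cons y ys)
  show ?case
  proof (cases "s \<in> beta_set ys")
    case True
    then have "s < y + length ys" using Cons by auto
    then show ?thesis using Cons.prems by simp
  qed (use Cons in auto)
qed auto

lemma card_beta_set: "sorted_wrt (\<ge>) xs \<Longrightarrow> card (beta_set xs) = length xs"
proof (induction xs)
  case (Cons x xs)
  then have "x + length xs \<notin> beta_set xs" using beta_set_less by blast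
  with Cons show ?case by simp
qed auto

text \<open>The binomial coefficient is the sum 0 + 1 + ... + (l - 1) of the offsets that make the
  entries distinct.\<close>

lemma sum_beta_set: "sorted_wrt (\<ge>) xs \<Longrightarrow>
  \<Sum>(beta_set xs) = sum_list xs + (length xs choose 2)"
proof (induction xs)
  case (Cons x xs)
  then have "x + length xs \<notin> beta_set xs" using beta_set_less by blast
  with Cons show ?case by (simp add: numeral_2_eq_2)
qed auto

lemma beta_set_inj:
  assumes "sorted_wrt (\<ge>) xs" "sorted_wrt (\<ge>) ys" "length xs = length ys" "beta_set xs = beta_set ys"
  shows "xs = ys"
  using assms
proof (induction xs arbitrary: ys)
  case (Cons x xs)
  then obtain y zs where ys: "ys = y # zs" by (cases ys) auto
  have nx: "\<And>s. s \<in> beta_set xs \<Longrightarrow> s < x + length xs" using Cons beta_set_less by blast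
  have ny: "\<And>s. s \<in> beta_set zs \<Longrightarrow> s < y + length zs" using Cons beta_set_less ys by blast
  have len: "length xs = length zs" using Cons ys by simp
  have eq: "insert (x + length xs) (beta_set xs) = insert (y + length zs) (beta_set zs)"
    using Cons.prems ys by simp
  have "x + length xs \<le> y + length zs"
    using eq ny by (metis insertI1 insertE less_imp_le order_refl)
  moreover have "y + length zs \<le> x + length xs"
    using eq nx by (metis insertI1 insertE less_imp_le order_refl)
  ultimately have xy: "x = y" using len by simp
  have "x + length xs \<notin> beta_set xs" "y + length zs \<notin> beta_set zs" using nx ny by blast+
  then have "beta_set xs = beta_set zs" using eq xy len by (metis insert_ident)
  then show ?case using Cons ys xy len by auto
qed auto

lemma beta_set_surj:
  assumes "finite B"
  shows "\<exists>xs. sorted_wrt (\<ge>) xs \<and> length xs = card B \<and> beta_set xs = B"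
  using assms
proof (induction B rule: finite_linorder_max_induct)
  case (insert s B)
  then obtain xs where xs: "sorted_wrt (\<ge>) xs" "length xs = card B" "beta_set xs = B" by auto
  have B: "card B \<le> s" using insert by (metis card_lessThan card_mono finite_lessThan lessThan_iff subsetI)
  have "sorted_wrt (\<ge>) ((s - card B) # xs)"
  proof (cases xs)
    case (Cons y ys)
    then have "y + length ys \<in> B" using xs by auto
    then have "y + length ys < s" using insert by blast
    then have "y \<le> s - card B" using xs Cons by simp
    then show ?thesis using xs Cons by auto
  qed auto
  then show ?case using xs B insert by (intro exI[of _ "(s - card B) # xs"]) auto
qed auto

lemma filter_pad:
  "sorted_wrt (\<ge>) (xs :: nat list) \<Longrightarrow>
   filter ((<) 0) xs @ replicate (length xs - length (filter ((<) 0) xs)) 0 = xs"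
proof (induction xs)
  case (Cons x xs)
  show ?case
  proof (cases "x = 0")
    case True
    then have "\<forall>y\<in>set xs. y = 0" using Cons by auto
    then have "filter ((<) 0) xs = []" "replicate (length xs) 0 = xs"
      by (auto simp: filter_empty_conv replicate_length_same)
    then show ?thesis using True by simp
  qed (use Cons in auto)
qed auto

lemma sorted_wrt_pad:
  "sorted_wrt (\<ge>) (xs :: nat list) \<Longrightarrow> sorted_wrt (\<ge>) (xs @ replicate k 0)"
proof -
  have "sorted_wrt (\<ge>) (replicate k (0 :: nat))" by (induction k) auto
  then show "sorted_wrt (\<ge>) xs \<Longrightarrow> ?thesis" by (auto simp: sorted_wrt_append)
qed

text \<open>For \<open>n \<le> l\<close>, these are the beta-sets of the partitions of
  \<open>n\<close> padded with zeros to \<open>l\<close> parts.\<close>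

definition finite_sets_with :: "nat \<Rightarrow> nat \<Rightarrow> nat set set" where
  "finite_sets_with l n = {B. finite B \<and> card B = l \<and> \<Sum>B = n + (l choose 2)}"

lemma length_partition_le: "xs \<in> partitions n \<Longrightarrow> length xs \<le> n"
proof -
  have "length xs \<le> sum_list xs" if "\<forall>x\<in>set xs. 0 < x" for xs :: "nat list"
    using that by (induction xs) auto
  then show "xs \<in> partitions n \<Longrightarrow> length xs \<le> n" by (auto simp: partitions_def)
qed

text \<open>Padding gives all partitions of \<open>n\<close> beta-sets of one common size. The
  abacus argument takes a large multiple of \<open>t\<close> for this size.\<close>

lemma bij_betw_beta_set:
  assumes "n \<le> l"
  shows "bij_betw (\<lambda>xs. beta_set (xs @ replicate (l - length xs) 0)) (partitions n) (finite_sets_with l n)"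
proof (rule bij_betw_imageI)
  let ?p = "\<lambda>xs :: nat list. xs @ replicate (l - length xs) 0"
  have p: "sorted_wrt (\<ge>) (?p xs)" "length (?p xs) = l" "sum_list (?p xs) = n" "filter ((<) 0) (?p xs) = xs"
    if "xs \<in> partitions n" for xs
    using that length_partition_le[OF that] assms
    by (auto simp: partitions_def sum_list_replicate filter_id_conv intro: sorted_wrt_pad)
  show "inj_on (\<lambda>xs. beta_set (?p xs)) (partitions n)"
    by (rule inj_onI) (metis p beta_set_inj)
  show "(\<lambda>xs. beta_set (?p xs)) ` partitions n = finite_sets_with l n"
  proof (intro equalityI subsetI)
    fix B assume "B \<in> (\<lambda>xs. beta_set (?p xs)) ` partitions n"
    then show "B \<in> finite_sets_with l n"
      using p by (auto simp: finite_sets_with_def card_beta_set sum_beta_set)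
  next
    fix B assume B: "B \<in> finite_sets_with l n"
    then obtain ys where ys: "sorted_wrt (\<ge>) ys" "length ys = l" "beta_set ys = B"
      using beta_set_surj[of B] by (auto simp: finite_sets_with_def)
    have sum: "sum_list ys = n" using B ys sum_beta_set[of ys] by (simp add: finite_sets_with_def)
    let ?xs = "filter ((<) 0) ys"
    have "sum_list ?xs = n" using sum by (induction ys arbitrary: n) auto
    then have "?xs \<in> partitions n"
      using ys by (auto simp: partitions_def sorted_wrt_filter)
    moreover have "?p ?xs = ys" using filter_pad[of ys] ys by simp
    ultimately show "B \<in> (\<lambda>xs. beta_set (?p xs)) ` partitions n" using ys by (intro image_eqI[of _ _ ?xs]) auto
  qed
qed

lemma finite_inversions [simp]: "finite B \<Longrightarrow> finite (inversions B)"
proof -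
  assume "finite B"
  moreover have "inversions B \<subseteq> (SIGMA s:B. {..<s})" by (auto simp: inversions_def)
  ultimately show ?thesis by (meson finite_SigmaI finite_lessThan finite_subset)
qed

lemma finite_t_inversions [simp]: "finite B \<Longrightarrow> finite (t_inversions t B)"
  by (rule finite_subset[of _ "inversions B"]) (auto simp: t_inversions_def)

lemma inversions_insert:
  assumes "\<And>x. x \<in> B \<Longrightarrow> x < s"
  shows "inversions (insert s B) = inversions B \<union> Pair s ` ({..<s} - B)"
  using assms by (fastforce simp: inversions_def)

text \<open>An element \<open>s\<close> with \<open>k\<close> smaller elements in \<open>B\<close>
  has \<open>s - k\<close> gaps below it, and the numbers \<open>k\<close> are 0, 1, ...,
  \<open>card B - 1\<close>. In terms of partitions, the size is the number of hooks.\<close>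

lemma card_inversions:
  assumes "finite B"
  shows "card (inversions B) + (card B choose 2) = \<Sum>B"
  using assms
proof (induction B rule: finite_linorder_max_induct)
  case empty
  show ?case by (simp add: inversions_def)
next
  case (insert s B)
  have ni: "s \<notin> B" using insert by blast
  have sub: "B \<subseteq> {..<s}" using insert by auto
  then have le: "card B \<le> s" using card_mono[of "{..<s}" B] by simp
  have "card (inversions (insert s B)) = card (inversions B) + card (Pair s ` ({..<s} - B))"
    using insert ni by (subst inversions_insert, blast, subst card_Un_disjoint)
      (auto simp: inversions_def intro: finite_inversions[unfolded inversions_def])
  also have "card (Pair s ` ({..<s} - B)) = s - card B"
    using sub insert by (simp add: card_image inj_on_def card_Diff_subset)
  finally show ?case using insert le ni by (simp add: numeral_2_eq_2)
qed

section \<open>Hook lengths as differences of beta-set elements and gaps\<close>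

definition column :: "nat list \<Rightarrow> nat \<Rightarrow> nat" where
  "column xs j = card {i. i < length xs \<and> j < xs ! i}"

lemma column_Nil [simp]: "column [] j = 0"
  by (simp add: column_def)

lemma column_Cons: "column (x # xs) j = (if j < x then 1 else 0) + column xs j"
proof -
  have "{i. i < length (x # xs) \<and> j < (x # xs) ! i}
        = (if j < x then {0} else {}) \<union> Suc ` {i. i < length xs \<and> j < xs ! i}"
    (is "?l = ?r")
  proof (rule Set.set_eqI)
    show "i \<in> ?l \<longleftrightarrow> i \<in> ?r" for i by (cases i) auto
  qed
  then show ?thesis
    unfolding column_def
    by (simp only:, subst card_Un_disjoint) (auto simp: card_image)
qed

lemma column_le: "column xs j \<le> length xs"
  by (induction xs) (auto simp: column_Cons)

lemma column_antimono: "i \<le> j \<Longrightarrow> column xs j \<le> column xs i"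
  by (induction xs) (auto simp: column_Cons)

text \<open>Along the boundary path of the diagram, read from the lower left, the elements of the
  beta-set are the positions of the vertical steps. The number here is the position of the
  horizontal step that ends column \<open>j\<close>.\<close>

lemma gap_notin_beta_set:
  "sorted_wrt (\<ge>) xs \<Longrightarrow> j + length xs - column xs j \<notin> beta_set xs"
proof (induction xs)
  case (Cons x xs)
  show ?case
  proof (cases "j < x")
    case True
    have "j + length xs - column xs j < x + length xs" using True by linarith
    then show ?thesis using Cons True by (simp add: column_Cons)
  next
    case False
    have z: "column xs j = 0" using Cons.prems False
      by (induction xs) (auto simp: column_Cons)
    then have "j + length (x # xs) - column (x # xs) j > x + length xs"
      using False by (simp add: column_Cons)
    moreover have "s \<le> x + length xs" if "s \<in> beta_set (x # xs)" for s
      using that beta_set_less[OF Cons.prems] by (auto simp: less_imp_le)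
    ultimately show ?thesis by (meson leD)
  qed
qed auto

lemma young_diagram_Cons:
  "young_diagram (x # xs) = Pair 0 ` {..<x} \<union> (\<lambda>(i, j). (Suc i, j)) ` young_diagram xs"
  by (auto simp: young_diagram_def image_iff less_Suc_eq_0_disj nth_Cons split: nat.splits)

lemma hook_number_Suc: "hook_number (x # xs) (Suc i, j) = hook_number xs (i, j)"
proof -
  have "{j'. j < j' \<and> (Suc i, j') \<in> young_diagram (x # xs)} = {j'. j < j' \<and> (i, j') \<in> young_diagram xs}"
    by (auto simp: young_diagram_def)
  moreover have "{i'. Suc i < i' \<and> (i', j) \<in> young_diagram (x # xs)} = Suc ` {i'. i < i' \<and> (i', j) \<in> young_diagram xs}"
    (is "?l = ?r")
  proof (rule Set.set_eqI)
    show "i' \<in> ?l \<longleftrightarrow> i' \<in> ?r" for i' by (cases i') (auto simp: young_diagram_def)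
  qed
  ultimately show ?thesis by (simp add: card_image)
qed

lemma hook_number_0:
  assumes "j < x"
  shows "hook_number (x # xs) (0, j) = x - j + column xs j"
proof -
  have "{j'. j < j' \<and> (0, j') \<in> young_diagram (x # xs)} = {j<..<x}"
    by (auto simp: young_diagram_def)
  moreover have "{i'. 0 < i' \<and> (i', j) \<in> young_diagram (x # xs)} = Suc ` {i. i < length xs \<and> j < xs ! i}"
    (is "?l = ?r")
  proof (rule Set.set_eqI)
    show "i' \<in> ?l \<longleftrightarrow> i' \<in> ?r" for i' by (cases i') (auto simp: young_diagram_def)
  qed
  ultimately show ?thesis using assms by (simp add: card_image column_def)
qed

text \<open>The map is strictly increasing and hits only gaps, and there are exactly
  \<open>x\<close> gaps below \<open>x + length xs\<close>, so every gap arises. With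
  \<open>hook_number_0\<close>, the hook lengths of the first row are the differences between the
  top element and the gaps below it.\<close>

lemma bij_betw_gaps:
  assumes "sorted_wrt (\<ge>) (x # xs)"
  shows "bij_betw (\<lambda>j. j + length xs - column xs j) {..<x} ({..<x + length xs} - beta_set xs)"
proof -
  let ?g = "\<lambda>j. j + length xs - column xs j"
  have mono: "?g i < ?g j" if "i < j" for i j
    using that column_le[of xs i] column_le[of xs j] column_antimono[of i j xs] by linarith
  have inj: "inj_on ?g {..<x}" by (rule linorder_inj_onI) (use mono in \<open>auto dest: less_imp_neq\<close>)
  have sub: "?g ` {..<x} \<subseteq> {..<x + length xs} - beta_set xs"
    using gap_notin_beta_set[of xs] assms by auto
  have "card ({..<x + length xs} - beta_set xs) = x"
    using card_beta_set[of xs] assms beta_set_less[OF assms]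
    by (subst card_Diff_subset) auto
  then have "?g ` {..<x} = {..<x + length xs} - beta_set xs"
    using sub inj by (intro card_subset_eq) (auto simp: card_image)
  then show ?thesis using inj by (simp add: bij_betw_def)
qed

lemma size_t_hooks: "size (t_hooks t xs) = card {c \<in> young_diagram xs. t dvd hook_number xs c}"
proof -
  have "size (filter_mset P (image_mset f (mset_set A))) = card {c \<in> A. P (f c)}" if "finite A" for P :: "nat \<Rightarrow> bool" and f and A :: "(nat \<times> nat) set"
    by (simp add: filter_mset_image_mset that)
  then show ?thesis unfolding t_hooks_def using finite_young_diagram by blast
qed

text \<open>Induction on the rows: the new largest element adds exactly its pairs with the gaps
  below it, and these match the cells of the new first row.\<close>

lemma size_t_hooks_eq_inversions:
  "sorted_wrt (\<ge>) xs \<Longrightarrow> size (t_hooks t xs) = card (t_inversions t (beta_set xs))"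
proof (induction xs)
  case Nil
  then show ?case by (simp add: size_t_hooks young_diagram_def t_inversions_def inversions_def)
next
  case (Cons x xs)
  let ?s = "x + length xs" and ?g = "\<lambda>j. j + length xs - column xs j"
  have young: "{c \<in> young_diagram (x # xs). t dvd hook_number (x # xs) c}
     = Pair 0 ` {j \<in> {..<x}. t dvd x - j + column xs j} \<union>
       (\<lambda>(i, j). (Suc i, j)) ` {c \<in> young_diagram xs. t dvd hook_number xs c}"
    unfolding young_diagram_Cons by (auto simp: hook_number_0 hook_number_Suc simp del: hook_number.simps)
  then have "size (t_hooks t (x # xs)) = card {j \<in> {..<x}. t dvd x - j + column xs j} + size (t_hooks t xs)"
    unfolding size_t_hooks
    using finite_young_diagram by (subst young, subst card_Un_disjoint) (auto simp: card_image inj_on_def simp del: hook_number.simps)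
  moreover have disj: "t_inversions t (beta_set xs) \<inter> Pair ?s ` {g \<in> {..<?s} - beta_set xs. t dvd ?s - g} = {}"
    using beta_set_less[OF Cons.prems] by (auto simp: t_inversions_def inversions_def)
  have inv: "t_inversions t (beta_set (x # xs)) =
      t_inversions t (beta_set xs) \<union> Pair ?s ` {g \<in> {..<?s} - beta_set xs. t dvd ?s - g}"
    using inversions_insert[of "beta_set xs" ?s] beta_set_less[OF Cons.prems]
    by (auto simp: t_inversions_def)
  then have "card (t_inversions t (beta_set (x # xs))) = card (t_inversions t (beta_set xs)) +
      card {g \<in> {..<?s} - beta_set xs. t dvd ?s - g}"
    using disj by (subst inv, subst card_Un_disjoint) (auto simp: card_image inj_on_def)
  moreover have "card {j \<in> {..<x}. t dvd x - j + column xs j} = card {g \<in> {..<?s} - beta_set xs. t dvd ?s - g}"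
  proof (rule bij_betw_same_card[of ?g], rule bij_betw_Collect[OF bij_betw_gaps[OF Cons.prems]])
    show "t dvd ?s - ?g j \<longleftrightarrow> t dvd x - j + column xs j" if "j \<in> {..<x}" for j
    proof -
      have "?s - ?g j = x - j + column xs j"
        using that column_le[of xs j] by simp
      then show ?thesis by simp
    qed
  qed
  ultimately show ?case using Cons by simp
qed

lemma t_hooks_pad: "t_hooks t (xs @ replicate k 0) = t_hooks t xs"
proof -
  have y: "young_diagram (xs @ replicate k 0) = young_diagram xs"
    by (auto simp: young_diagram_def nth_append split: if_splits)
  then have "hook_number (xs @ replicate k 0) = hook_number xs"
    by (intro ext) (auto simp: y)
  then show ?thesis by (simp add: t_hooks_def y)
qed

lemma card_partitions_hooks:
  assumes "n \<le> l"
  shows "card {xs \<in> partitions n. size (t_hooks t xs) = m} =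
         card {B \<in> finite_sets_with l n. card (t_inversions t B) = m}"
proof -
  let ?f = "\<lambda>xs. beta_set (xs @ replicate (l - length xs) 0)"
  have bij: "bij_betw ?f (partitions n) (finite_sets_with l n)" using bij_betw_beta_set[OF assms] .
  have "size (t_hooks t xs) = card (t_inversions t (?f xs))" if "xs \<in> partitions n" for xs
  proof -
    have "sorted_wrt (\<ge>) (xs @ replicate (l - length xs) 0)"
      using that sorted_wrt_pad by (auto simp: partitions_def)
    then show ?thesis using size_t_hooks_eq_inversions t_hooks_pad by metis
  qed
  then have "bij_betw ?f {xs \<in> partitions n. size (t_hooks t xs) = m}
      {B \<in> finite_sets_with l n. card (t_inversions t B) = m}"
    by (intro bij_betw_Collect[OF bij]) simp
  then show ?thesis by (rule bij_betw_same_card)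
qed

section \<open>Cores and quotients\<close>

text \<open>Counts the \<open>t\<close>-tuples of partitions of total size \<open>m\<close>, which
  are the possible t-quotients.\<close>

primrec multipartitions :: "nat \<Rightarrow> nat \<Rightarrow> nat" where
  "multipartitions 0 m = (if m = 0 then 1 else 0)"
| "multipartitions (Suc t) m = (\<Sum>j\<le>m. num_partitions j * multipartitions t (m - j))"

text \<open>Charge vectors of t-cores. Functions in \<open>PiE\<close> are \<open>undefined\<close>
  outside \<open>{..<t}\<close>, so a vector is determined by its \<open>t\<close> entries.\<close>

definition core_lattice :: "nat \<Rightarrow> (nat \<Rightarrow> int) set" where
  "core_lattice t = {x \<in> PiE {..<t} (\<lambda>_. UNIV). (\<Sum>i<t. x i) = 0}"

(* Twice the size of the t-core with charge vector x. *)
definition core_form :: "nat \<Rightarrow> (nat \<Rightarrow> int) \<Rightarrow> int" where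
  "core_form t x = int t * (\<Sum>i<t. (x i)\<^sup>2) + 2 * (\<Sum>i<t. int i * x i)"

text \<open>Runner \<open>i\<close> of the t-abacus of \<open>B\<close>.\<close>

definition residue_part :: "nat \<Rightarrow> nat set \<Rightarrow> nat \<Rightarrow> nat set" where
  "residue_part t B i = {q. t * q + i \<in> B}"

lemma finite_residue_part [simp]:
  assumes "finite B" "0 < t"
  shows "finite (residue_part t B i)"
proof -
  have "inj_on (\<lambda>q. t * q + i) UNIV" using assms by (auto simp: inj_on_def)
  then show ?thesis
    using finite_vimage_IntI[OF assms(1), of "\<lambda>q. t * q + i" UNIV]
    by (simp add: residue_part_def vimage_def)
qed

lemma mult_add_less_eq_iff:
  fixes t :: nat
  assumes "i < t" "j < t"
  shows "t * q + i = t * r + j \<longleftrightarrow> q = r \<and> i = j"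
proof
  assume eq: "t * q + i = t * r + j"
  have "(t * q + i) div t = q" "(t * r + j) div t = r" using assms by auto
  with eq show "q = r \<and> i = j" by simp
qed simp

lemma bij_betw_residue_Sigma:
  assumes "0 < t"
  shows "bij_betw (\<lambda>(i, q). t * q + i) (SIGMA i:{..<t}. residue_part t B i) B"
proof (rule bij_betw_imageI)
  show "inj_on (\<lambda>(i, q). t * q + i) (SIGMA i:{..<t}. residue_part t B i)"
    by (auto simp: inj_on_def mult_add_less_eq_iff)
  have "s \<in> (\<lambda>(i, q). t * q + i) ` (SIGMA i:{..<t}. residue_part t B i)" if "s \<in> B" for s
    by (rule image_eqI[of _ _ "(s mod t, s div t)"]) (use that assms in \<open>auto simp: residue_part_def\<close>)
  then show "(\<lambda>(i, q). t * q + i) ` (SIGMA i:{..<t}. residue_part t B i) = B"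
    by (auto simp: residue_part_def)
qed

lemma sum_residue_part:
  assumes "finite B" "0 < t"
  shows "sum f B = (\<Sum>i<t. \<Sum>q\<in>residue_part t B i. f (t * q + i))"
proof -
  have "(\<Sum>i<t. \<Sum>q\<in>residue_part t B i. f (t * q + i))
    = (\<Sum>(i, q)\<in>(SIGMA i:{..<t}. residue_part t B i). f (t * q + i))"
    using assms by (subst sum.Sigma) auto
  also have "\<dots> = sum f B"
    using sum.reindex_bij_betw[OF bij_betw_residue_Sigma[OF assms(2)], of f B]
    by (simp add: case_prod_unfold)
  finally show ?thesis by simp
qed

text \<open>\<open>t dvd s - g\<close> says that \<open>s\<close> and \<open>g\<close> lie on the
  same runner; division by \<open>t\<close> then turns the pair into an ordinary inversion of that
  runner. So the number of hooks divisible by \<open>t\<close> is the size of the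
  t-quotient.\<close>

lemma card_t_inversions:
  assumes "finite B" "0 < t"
  shows "card (t_inversions t B) = (\<Sum>i<t. card (inversions (residue_part t B i)))"
proof -
  let ?S = "SIGMA i:{..<t}. inversions (residue_part t B i)"
  have "bij_betw (\<lambda>(i, s, g). (t * s + i, t * g + i)) ?S (t_inversions t B)"
  proof (rule bij_betw_imageI)
    show "inj_on (\<lambda>(i, s, g). (t * s + i, t * g + i)) ?S"
      by (auto simp: inj_on_def mult_add_less_eq_iff)
    show "(\<lambda>(i, s, g). (t * s + i, t * g + i)) ` ?S = t_inversions t B"
    proof (intro equalityI subsetI)
      fix y assume "y \<in> (\<lambda>(i, s, g). (t * s + i, t * g + i)) ` ?S"
      then show "y \<in> t_inversions t B"
        using assms by (auto simp: t_inversions_def inversions_def residue_part_def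
            diff_mult_distrib2[symmetric])
    next
      fix y assume y: "y \<in> t_inversions t B"
      obtain s g where sg: "y = (s, g)" by (cases y)
      then have "s \<in> B" "g \<notin> B" "g < s" "t dvd s - g"
        using y by (auto simp: t_inversions_def inversions_def)
      then have m: "s mod t = g mod t" by (simp add: mod_eq_dvd_iff_nat)
      have eqs: "t * (g div t) + s mod t = g" "t * (s div t) + s mod t = s"
        by (simp add: m) (rule mult_div_mod_eq)
      then have "t * (g div t) < t * (s div t)" using \<open>g < s\<close> by linarith
      then have "g div t < s div t" by simp
      then have "(s div t, g div t) \<in> inversions (residue_part t B (s mod t))"
        using \<open>s \<in> B\<close> \<open>g \<notin> B\<close> by (simp add: inversions_def residue_part_def eqs)
      then show "y \<in> (\<lambda>(i, s, g). (t * s + i, t * g + i)) ` ?S"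
        using assms by (intro image_eqI[of _ _ "(s mod t, s div t, g div t)"]) (simp_all only: sg eqs prod.case mem_Sigma_iff lessThan_iff mod_less_divisor)
    qed
  qed
  then have "card (t_inversions t B) = card ?S" by (rule bij_betw_same_card[symmetric])
  also have "\<dots> = (\<Sum>i<t. card (inversions (residue_part t B i)))"
    using assms by (subst card_SigmaI) auto
  finally show ?thesis .
qed

lemma bij_betw_residue_parts:
  assumes "0 < t"
  shows "bij_betw (\<lambda>B. \<lambda>i\<in>{..<t}. residue_part t B i) (Collect finite) (PiE {..<t} (\<lambda>_. Collect finite))"
proof (rule bij_betwI)
  show "(\<lambda>B. \<lambda>i\<in>{..<t}. residue_part t B i) \<in> Collect finite \<rightarrow> (PiE {..<t} (\<lambda>_. Collect finite))"
    using assms by auto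
  let ?g = "\<lambda>h. \<Union>i<t. (\<lambda>q. t * q + i) ` h i"
  show "?g \<in> (PiE {..<t} (\<lambda>_. Collect finite)) \<rightarrow> Collect finite" by (auto simp: PiE_iff)
  show "?g (\<lambda>i\<in>{..<t}. residue_part t B i) = B" for B
    using bij_betw_residue_Sigma[OF assms, of B] by (force simp: bij_betw_def)
  show "(\<lambda>i\<in>{..<t}. residue_part t (?g h) i) = h" if "h \<in> PiE {..<t} (\<lambda>_. Collect finite)" for h
  proof (rule PiE_ext[OF _ that])
    have eq: "residue_part t (?g h) i = h i" if "i < t" for i
      using that by (auto simp: residue_part_def mult_add_less_eq_iff)
    then show "(\<lambda>i\<in>{..<t}. residue_part t (?g h) i) i = h i" if "i \<in> {..<t}" for i
      using that by simp
    show "(\<lambda>i\<in>{..<t}. residue_part t (?g h) i) \<in> PiE {..<t} (\<lambda>_. Collect finite)"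
      using that eq by (auto simp: PiE_iff)
  qed
qed

lemma finite_finite_sets_with [simp]: "finite (finite_sets_with l n)"
proof (rule finite_subset)
  show "finite_sets_with l n \<subseteq> Pow {..n + (l choose 2)}"
  proof clarify
    fix B s assume "B \<in> finite_sets_with l n" "s \<in> B"
    then show "s \<le> n + (l choose 2)"
      using member_le_sum[of s B "\<lambda>x. x"] by (simp add: finite_sets_with_def)
  qed
qed simp

lemma card_finite_sets_with: "n \<le> l \<Longrightarrow> card (finite_sets_with l n) = num_partitions n"
  using bij_betw_beta_set bij_betw_same_card unfolding num_partitions_def by metis

lemma finite_sets_with_altdef:
  "finite_sets_with l n = {B. finite B \<and> card B = l \<and> card (inversions B) = n}"
  using card_inversions by (fastforce simp: finite_sets_with_def)

text \<open>Later \<open>A i\<close> consists of the sets of a prescribed size and \<open>w\<close>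
  counts inversions. Sets of size \<open>l\<close> represent all partitions of \<open>k\<close> only
  if \<open>k \<le> l\<close>, which is why the hypotheses stop at a bound \<open>M\<close>.\<close>

lemma card_PiE_sum_eq_multipartitions:
  fixes A :: "'i \<Rightarrow> 'a set" and w :: "'a \<Rightarrow> nat"
  assumes "finite I"
    and "\<And>i k. i \<in> I \<Longrightarrow> k \<le> M \<Longrightarrow> finite {B \<in> A i. w B = k}"
    and "\<And>i k. i \<in> I \<Longrightarrow> k \<le> M \<Longrightarrow> card {B \<in> A i. w B = k} = num_partitions k"
    and "m \<le> M"
  shows "finite {h \<in> PiE I A. (\<Sum>i\<in>I. w (h i)) = m} \<and>
         card {h \<in> PiE I A. (\<Sum>i\<in>I. w (h i)) = m} = multipartitions (card I) m"
  using assms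
proof (induction I arbitrary: m rule: finite_induct)
  case empty
  show ?case by auto
next
  case (insert i I)
  let ?H = "\<lambda>m. {h \<in> PiE I A. (\<Sum>i\<in>I. w (h i)) = m}"
  let ?S = "SIGMA k:{..m}. {B \<in> A i. w B = k} \<times> ?H (m - k)"
  have IH: "finite (?H k) \<and> card (?H k) = multipartitions (card I) k" if "k \<le> M" for k
    using insert that by auto
  have upd: "(\<Sum>j\<in>insert i I. w ((g(i := y)) j)) = w y + (\<Sum>j\<in>I. w (g j))" for g y
  proof -
    have "(\<Sum>j\<in>I. w ((g(i := y)) j)) = (\<Sum>j\<in>I. w (g j))"
      using insert.hyps by (intro sum.cong) auto
    then show ?thesis using insert.hyps by simp
  qed
  have bij: "bij_betw (\<lambda>(k, B, g). g(i := B)) ?S {h \<in> PiE (insert i I) A. (\<Sum>i\<in>insert i I. w (h i)) = m}"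
  proof (rule bij_betw_imageI)
    show "inj_on (\<lambda>(k, B, g). g(i := B)) ?S"
    proof (rule inj_onI)
      fix u v assume uv: "u \<in> ?S" "v \<in> ?S" "(\<lambda>(k, B, g). g(i := B)) u = (\<lambda>(k, B, g). g(i := B)) v"
      obtain k B g k' B' g' where u: "u = (k, B, g)" and v: "v = (k', B', g')"
        by (metis surj_pair)
      then have g: "g \<in> PiE I A" "g' \<in> PiE I A" and eq: "g(i := B) = g'(i := B')"
        using uv by auto
      have B: "B = B'" using eq by (metis fun_upd_same)
      have "g j = g' j" for j
        using eq g insert.hyps by (metis PiE_arb fun_upd_other)
      then show "u = v" using uv u v B by auto
    qed
    show "(\<lambda>(k, B, g). g(i := B)) ` ?S = {h \<in> PiE (insert i I) A. (\<Sum>i\<in>insert i I. w (h i)) = m}"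
    proof (intro equalityI subsetI)
      fix h assume "h \<in> (\<lambda>(k, B, g). g(i := B)) ` ?S"
      then show "h \<in> {h \<in> PiE (insert i I) A. (\<Sum>i\<in>insert i I. w (h i)) = m}"
        using upd by (auto simp: PiE_insert_eq)
    next
      fix h assume h: "h \<in> {h \<in> PiE (insert i I) A. (\<Sum>i\<in>insert i I. w (h i)) = m}"
      then obtain y g where "h = g(i := y)" "y \<in> A i" "g \<in> PiE I A"
        by (auto simp: PiE_insert_eq)
      moreover then have "w y + (\<Sum>j\<in>I. w (g j)) = m" using h upd[of g y] by simp
      ultimately show "h \<in> (\<lambda>(k, B, g). g(i := B)) ` ?S"
        by (intro image_eqI[of _ _ "(w y, y, g)"]) auto
    qed
  qed
  have fin: "finite ?S" using insert.prems IH by auto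
  have "card ?S = (\<Sum>k\<le>m. num_partitions k * multipartitions (card I) (m - k))"
    using insert.prems IH by (subst card_SigmaI) (auto simp: card_cartesian_product intro!: sum.cong)
  then show ?case
    using bij_betw_same_card[OF bij] bij_betw_finite[OF bij] fin insert.hyps by simp
qed

text \<open>Completing the square. It makes \<open>core_form\<close> bounded below and its sublevel
  sets finite, of polynomial size.\<close>

lemma mult_core_form:
  "int t * core_form t x + (\<Sum>i<t. (int i)\<^sup>2) = (\<Sum>i<t. (int t * x i + int i)\<^sup>2)"
  by (simp add: core_form_def sum_distrib_left sum_distrib_right algebra_simps power2_eq_square
      sum.distrib[symmetric])

lemma sum_squares_le_cube: "(\<Sum>i<t. (int i)\<^sup>2) \<le> int t ^ 3"
proof -
  have "(\<Sum>i<t. (int i)\<^sup>2) \<le> (\<Sum>i<t. (int t)\<^sup>2)"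
    by (intro sum_mono power_mono) auto
  then show ?thesis by (simp add: power2_eq_square power3_eq_cube)
qed

lemma core_form_ge: "- (int t ^ 3) \<le> int t * core_form t x"
proof -
  have "0 \<le> (\<Sum>i<t. (int t * x i + int i)\<^sup>2)" by (intro sum_nonneg) auto
  then show ?thesis using mult_core_form[of t x] sum_squares_le_cube[of t] by linarith
qed

lemma core_form_bound:
  assumes "core_form t x \<le> 2 * int n" "i < t"
  shows "\<bar>x i\<bar> \<le> int (2 * t * n + t ^ 3 + t)"
proof -
  have "int t * core_form t x \<le> int t * (2 * int n)"
    using assms by (intro mult_left_mono) auto
  moreover have "(int t * x i + int i)\<^sup>2 \<le> (\<Sum>i<t. (int t * x i + int i)\<^sup>2)"
    using assms by (intro member_le_sum) auto
  moreover have "\<bar>int t * x i + int i\<bar> \<le> (int t * x i + int i)\<^sup>2"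
    using mult_left_mono[of 1 "\<bar>int t * x i + int i\<bar>" "\<bar>int t * x i + int i\<bar>"]
    by (cases "int t * x i + int i = 0") (auto simp: power2_eq_square)
  moreover have "\<bar>x i\<bar> \<le> \<bar>int t * x i\<bar>"
    using assms by (simp add: abs_mult mult_le_cancel_right1)
  moreover have "int i \<le> int t" using assms by simp
  ultimately have "\<bar>x i\<bar> \<le> int t * (2 * int n) + int t ^ 3 + int t"
    using mult_core_form[of t x] sum_squares_le_cube[of t] by linarith
  then show ?thesis by simp
qed

lemma core_lattice_bounded:
  "{x \<in> core_lattice t. core_form t x \<le> 2 * int n} \<subseteq>
     PiE {..<t} (\<lambda>_. {- int (2 * t * n + t ^ 3 + t) .. int (2 * t * n + t ^ 3 + t)})"
proof
  fix x assume x: "x \<in> {x \<in> core_lattice t. core_form t x \<le> 2 * int n}"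
  then have "- int (2 * t * n + t ^ 3 + t) \<le> x i \<and> x i \<le> int (2 * t * n + t ^ 3 + t)" if "i < t" for i
    using core_form_bound[of t x n i] that by auto
  then show "x \<in> PiE {..<t} (\<lambda>_. {- int (2 * t * n + t ^ 3 + t) .. int (2 * t * n + t ^ 3 + t)})"
    using x by (simp add: core_lattice_def PiE_iff)
qed

lemma finite_core_lattice_bounded:
  "finite {x \<in> core_lattice t. core_form t x \<le> 2 * int n}"
  by (rule finite_subset[OF core_lattice_bounded]) (auto intro: finite_PiE)

lemma card_core_lattice_bounded:
  "card {x \<in> core_lattice t. core_form t x \<le> 2 * int n} \<le> (2 * (2 * t * n + t ^ 3 + t) + 1) ^ t"
proof -
  let ?R = "2 * t * n + t ^ 3 + t"
  have "card {x \<in> core_lattice t. core_form t x \<le> 2 * int n} \<le> card (PiE {..<t} (\<lambda>_. {- int ?R .. int ?R}))"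
    by (rule card_mono[OF _ core_lattice_bounded]) (auto intro: finite_PiE)
  also have "card {- int R .. int R} = 2 * R + 1" for R by simp
  then have "card (PiE {..<t} (\<lambda>_. {- int ?R .. int ?R})) = (2 * ?R + 1) ^ t"
    by (simp only: card_PiE finite_lessThan prod_constant card_lessThan)
  finally show ?thesis .
qed

lemma int_choose_2: "2 * int (n choose 2) = int n * (int n - 1)"
proof -
  have "2 * (n choose 2) = n * (n - 1)" using dvd_mult_div_cancel[of 2 "n * (n - 1)"]
    by (cases n) (simp_all add: choose_two)
  then have "int (2 * (n choose 2)) = int (n * (n - 1))" by simp
  then show ?thesis by (cases n) (simp_all add: algebra_simps)
qed

lemma sum_int_lessThan: "2 * (\<Sum>i<t. int i) = int t * (int t - 1)"
  by (induction t) (auto simp: algebra_simps)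

text \<open>The size of a partition is the size of its core plus \<open>t\<close> times the size of
  its quotient. The sum of the beta-set is computed runner by runner with
  \<open>card (h i) = L + x i\<close>; the terms linear in \<open>x\<close> with constant
  coefficient cancel, because the charges sum to zero.\<close>

lemma core_form_eq_iff:
  fixes h :: "nat \<Rightarrow> nat set"
  assumes "\<And>i. i < t \<Longrightarrow> finite (h i)" "(\<Sum>i<t. card (h i)) = t * L"
    and "(\<Sum>i<t. card (inversions (h i))) = m"
    and x: "\<And>i. i < t \<Longrightarrow> x i = int (card (h i)) - int L"
  shows "(\<Sum>i<t. t * \<Sum>(h i) + i * card (h i)) = n + (t * L choose 2) \<longleftrightarrow>
         core_form t x = 2 * int n - 2 * int t * int m" (is "?l = ?r \<longleftrightarrow> _")
proof -
  let ?c = "\<lambda>i. int (card (h i))"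
  have c: "?c i = int L + x i" if "i < t" for i using x[OF that] by simp
  have "(\<Sum>i<t. ?c i) = int t * int L" using assms(2) by (metis of_nat_mult of_nat_sum)
  then have sx: "(\<Sum>i<t. x i) = 0" using x by (simp add: sum_subtractf)
  have sm: "(\<Sum>i<t. int (card (inversions (h i)))) = int m" using assms(3) by auto
  have "2 * int (\<Sum>(h i)) = 2 * int (card (inversions (h i))) + ?c i * (?c i - 1)" if "i < t" for i
    using card_inversions[OF assms(1)[OF that]] int_choose_2[of "card (h i)"] by linarith
  moreover have "2 * int (t * S + i * c) = int t * (2 * int S) + 2 * int i * int c" for S i c
    by (simp add: algebra_simps)
  ultimately have "2 * int (t * \<Sum>(h i) + i * card (h i))
      = int t * (2 * int (card (inversions (h i))) + ?c i * (?c i - 1)) + 2 * int i * ?c i" if "i < t" for i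
    using that by (simp only:)
  then have "2 * int ?l = (\<Sum>i<t. int t * (2 * int (card (inversions (h i))) + ?c i * (?c i - 1)) + 2 * int i * ?c i)"
    by (simp only: of_nat_sum sum_distrib_left) (intro sum.cong, auto)
  also have "\<dots> = (\<Sum>i<t. int t * (2 * int (card (inversions (h i))) + (int L + x i) * (int L + x i - 1)) + 2 * int i * (int L + x i))"
    by (intro sum.cong) (auto simp: c)
  also have "\<dots> = (\<Sum>i<t. 2 * int t * int (card (inversions (h i))) + int t * int L * (int L - 1) +
      int t * (2 * int L - 1) * x i + int t * (x i)\<^sup>2 + int L * (2 * int i) + 2 * (int i * x i))"
    by (intro sum.cong) (auto simp: algebra_simps power2_eq_square)
  also have "\<dots> = 2 * int t * int m + int t * (int t * int L * (int L - 1)) + core_form t x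
      + int L * (2 * (\<Sum>i<t. int i))"
    by (simp add: sum.distrib sum_distrib_left[symmetric] sx sm core_form_def)
  also have "\<dots> = 2 * int t * int m + core_form t x + int (t * L) * (int (t * L) - 1)"
    by (simp add: sum_int_lessThan algebra_simps)
  finally have "2 * int ?l = 2 * int t * int m + core_form t x + 2 * int (t * L choose 2)"
    by (simp add: int_choose_2)
  moreover have "?l = ?r \<longleftrightarrow> 2 * int ?l = 2 * int ?r" by (simp only: mult_cancel_left of_nat_eq_iff) simp
  ultimately show ?thesis by auto
qed

text \<open>The sizes of the runners, measured against their mean \<open>L\<close>, form the charge
  vector of the core; the runners themselves, read as beta-sets, form the quotient. Every quotient
  of total size \<open>m\<close> occurs with every admissible vector.\<close>

lemma card_partitions_hooks_eq_core_lattice: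
  assumes "0 < t"
  shows "card {xs \<in> partitions n. size (t_hooks t xs) = m} =
    card {x \<in> core_lattice t. core_form t x = 2 * int n - 2 * int t * int m} * multipartitions t m"
proof -
  let ?X = "{x \<in> core_lattice t. core_form t x = 2 * int n - 2 * int t * int m}"
  \<comment> \<open>The first bracket is the bound on the entries from
    \<open>core_form_bound\<close>, so every runner has at least \<open>n + t\<^sup>2\<close>
    elements. By \<open>mle\<close> this leaves room for every component of the quotient.\<close>
  define L where "L = (2 * t * n + t ^ 3 + t) + (n + t\<^sup>2)"
  let ?A = "\<lambda>x i. {B. finite B \<and> card B = nat (int L + x i)}"
  let ?H = "\<lambda>x. {h \<in> PiE {..<t} (?A x). (\<Sum>i<t. card (inversions (h i))) = m}"
  let ?G = "{h \<in> PiE {..<t} (\<lambda>_. Collect finite). (\<Sum>i<t. card (h i)) = t * L \<and>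
      (\<Sum>i<t. t * \<Sum>(h i) + i * card (h i)) = n + (t * L choose 2) \<and> (\<Sum>i<t. card (inversions (h i))) = m}"
  have finX: "finite ?X"
    by (rule finite_subset[OF _ finite_core_lattice_bounded[of t n]]) auto
  have bound: "int (n + t\<^sup>2) \<le> int L + x i" if "x \<in> ?X" "i < t" for x i
    using core_form_bound[of t x n i] that unfolding L_def by auto
  have bound0: "0 \<le> int L + x i" if "x \<in> ?X" "i < t" for x i
    using bound[OF that] of_nat_0_le_iff[of "n + t\<^sup>2"] by linarith
  have nle: "n \<le> t * L"
  proof -
    have "n \<le> 1 * L" unfolding L_def by simp
    also have "\<dots> \<le> t * L" using assms by (intro mult_right_mono) auto
    finally show ?thesis .
  qed
  \<comment> \<open>The slack \<open>t\<^sup>2\<close> comes from the crude lower bound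
    \<open>core_form_ge\<close>.\<close>
  have mle: "m \<le> n + t\<^sup>2" if "x \<in> ?X" for x
  proof -
    have eq: "2 * int t * int m = 2 * int n - core_form t x" using that by simp
    have "int t * (2 * int t * int m) \<le> int t * (2 * int n) + int t ^ 3"
      using core_form_ge[of t x] unfolding eq right_diff_distrib by linarith
    then have "int t * (2 * int t * int m) \<le> int t * (2 * int n + (int t)\<^sup>2)"
      by (simp add: algebra_simps power2_eq_square power3_eq_cube)
    then have "2 * int t * int m \<le> 2 * int n + (int t)\<^sup>2"
      using assms by (simp add: mult_le_cancel_left)
    moreover have "1 * int m \<le> int t * int m" using assms by (intro mult_right_mono) auto
    ultimately have "int m \<le> int n + (int t)\<^sup>2"
      using zero_le_power2[of "int t"] by linarith
    then show ?thesis by (metis of_nat_add of_nat_le_iff of_nat_power)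
  qed
  have fibre: "finite (?H x) \<and> card (?H x) = multipartitions t m" if x: "x \<in> ?X" for x
  proof -
    have eq: "{B \<in> ?A x i. card (inversions B) = k} = finite_sets_with (nat (int L + x i)) k" for i k
      by (auto simp: finite_sets_with_altdef)
    have "k \<le> nat (int L + x i)" if "i < t" "k \<le> n + t\<^sup>2" for i k
    proof -
      have "int k \<le> int (n + t\<^sup>2)" using that by (simp only: of_nat_le_iff)
      then have "int k \<le> int L + x i" using bound[OF x, of i] that by linarith
      then show ?thesis by linarith
    qed
    then show ?thesis
      using card_PiE_sum_eq_multipartitions[of "{..<t}" "n + t\<^sup>2" "?A x" "\<lambda>B. card (inversions B)" m] mle[OF x]
      unfolding eq by (simp add: card_finite_sets_with)
  qed
  have "card {xs \<in> partitions n. size (t_hooks t xs) = m} =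
         card {B \<in> finite_sets_with (t * L) n. card (t_inversions t B) = m}"
    by (rule card_partitions_hooks[OF nle])
  also have "\<dots> = card ?G"
  proof (rule bij_betw_same_card[of "\<lambda>B. \<lambda>i\<in>{..<t}. residue_part t B i"])
    have "bij_betw (\<lambda>B. \<lambda>i\<in>{..<t}. residue_part t B i)
      {B \<in> Collect finite. card B = t * L \<and> \<Sum>B = n + (t * L choose 2) \<and> card (t_inversions t B) = m} ?G"
    proof (rule bij_betw_Collect[OF bij_betw_residue_parts[OF assms]])
      fix B :: "nat set" assume "B \<in> Collect finite"
      then have B: "finite B" by simp
      have "card B = (\<Sum>i<t. card (residue_part t B i))"
        using sum_residue_part[OF B assms, of "\<lambda>_. 1 :: nat"] by simp
      moreover have "\<Sum>B = (\<Sum>i<t. t * \<Sum>(residue_part t B i) + i * card (residue_part t B i))"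
        using sum_residue_part[OF B assms, of "\<lambda>s. s"] by (simp add: sum.distrib sum_distrib_left mult.commute)
      moreover note card_t_inversions[OF B assms]
      ultimately show "((\<Sum>i<t. card ((\<lambda>i\<in>{..<t}. residue_part t B i) i)) = t * L \<and>
          (\<Sum>i<t. t * \<Sum>((\<lambda>i\<in>{..<t}. residue_part t B i) i) + i * card ((\<lambda>i\<in>{..<t}. residue_part t B i) i)) = n + (t * L choose 2) \<and>
          (\<Sum>i<t. card (inversions ((\<lambda>i\<in>{..<t}. residue_part t B i) i))) = m) =
        (card B = t * L \<and> \<Sum>B = n + (t * L choose 2) \<and> card (t_inversions t B) = m)"
        by simp
    qed
    then show "bij_betw (\<lambda>B. \<lambda>i\<in>{..<t}. residue_part t B i)
      {B \<in> finite_sets_with (t * L) n. card (t_inversions t B) = m} ?G"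
      by (simp add: finite_sets_with_def conj_assoc)
  qed
  also have "?G = (\<Union>x\<in>?X. ?H x)"
  proof (intro equalityI subsetI)
    fix h assume h: "h \<in> ?G"
    let ?x = "\<lambda>i\<in>{..<t}. int (card (h i)) - int L"
    have fin: "finite (h i)" if "i < t" for i using h that by auto
    have "(\<Sum>i<t. card (h i)) = t * L" using h by simp
    then have "(\<Sum>i<t. int (card (h i))) = int t * int L" by (metis of_nat_mult of_nat_sum)
    then have "?x \<in> core_lattice t" by (simp add: core_lattice_def sum_subtractf)
    moreover have "core_form t ?x = 2 * int n - 2 * int t * int m"
      using core_form_eq_iff[of t h L m ?x n] h fin by simp
    moreover have "h \<in> ?H ?x" using h by (auto simp: PiE_iff)
    ultimately show "h \<in> (\<Union>x\<in>?X. ?H x)" by blast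
  next
    fix h assume "h \<in> (\<Union>x\<in>?X. ?H x)"
    then obtain x where x: "x \<in> ?X" and h: "h \<in> ?H x" by blast
    have fin: "finite (h i)" if "i < t" for i using h that by auto
    have xi: "x i = int (card (h i)) - int L" if "i < t" for i
    proof -
      have "card (h i) = nat (int L + x i)" using h that by auto
      then show ?thesis using bound0[OF x that] by simp
    qed
    have "(\<Sum>i<t. x i) = 0" using x by (simp add: core_lattice_def)
    then have "(\<Sum>i<t. int (card (h i))) = int t * int L" by (simp add: xi sum_subtractf)
    then have c: "(\<Sum>i<t. card (h i)) = t * L" by (metis of_nat_eq_iff of_nat_mult of_nat_sum)
    moreover have "(\<Sum>i<t. t * \<Sum>(h i) + i * card (h i)) = n + (t * L choose 2)"
      using core_form_eq_iff[of t h L m x n] x h c xi fin by simp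
    ultimately show "h \<in> ?G" using h by (auto simp: PiE_iff)
  qed
  also have "card \<dots> = (\<Sum>x\<in>?X. card (?H x))"
  proof (rule card_UN_disjoint[OF finX])
    show "\<forall>x\<in>?X. finite (?H x)" using fibre by blast
    have "x = y" if x: "x \<in> ?X" and y: "y \<in> ?X" and h: "h \<in> ?H x" "h \<in> ?H y" for x y h
    proof -
      have "x i = y i" if "i < t" for i
      proof -
        have hx: "h \<in> PiE {..<t} (?A x)" and hy: "h \<in> PiE {..<t} (?A y)" using h by simp_all
        have "h i \<in> ?A x i" using that by (intro PiE_mem[OF hx]) simp
        moreover have "h i \<in> ?A y i" using that by (intro PiE_mem[OF hy]) simp
        ultimately have "nat (int L + x i) = card (h i)" "nat (int L + y i) = card (h i)" by simp_all
        then show ?thesis using bound0[OF x that] bound0[OF y that] by simp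
      qed
      then show ?thesis using x y by (intro PiE_ext[of x "{..<t}" "\<lambda>_. UNIV" y]) (auto simp: core_lattice_def)
    qed
    then show "\<forall>x\<in>?X. \<forall>y\<in>?X. x \<noteq> y \<longrightarrow> ?H x \<inter> ?H y = {}" by blast
  qed
  also have "\<dots> = card ?X * multipartitions t m" using fibre by simp
  finally show ?thesis .
qed

section \<open>Growth of the partition function\<close>

text \<open>As multisets, partitions allow single parts to be removed or replaced without
  sorting.\<close>

definition mpartitions :: "nat \<Rightarrow> nat multiset set" where
  "mpartitions n = {M. 0 \<notin># M \<and> \<Sum>\<^sub># M = n}"

lemma bij_betw_mset_partitions: "bij_betw mset (partitions n) (mpartitions n)"
proof (rule bij_betw_imageI)
  have sorted: "sorted (rev xs)" if "xs \<in> partitions n" for xs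
    using that by (simp add: partitions_def sorted_wrt_rev)
  show "inj_on mset (partitions n)"
  proof (rule inj_onI)
    fix xs ys assume "xs \<in> partitions n" "ys \<in> partitions n" "mset xs = mset ys"
    then have "rev xs = rev ys" using sorted by (metis mset_rev properties_for_sort)
    then show "xs = ys" by simp
  qed
  show "mset ` partitions n = mpartitions n"
  proof (intro equalityI subsetI)
    fix M assume M: "M \<in> mpartitions n"
    let ?xs = "rev (sorted_list_of_multiset M)"
    have "sorted (sorted_list_of_multiset M)" by simp
    then have "sorted_wrt (\<ge>) ?xs" by (simp add: sorted_wrt_rev)
    moreover have "sum_list ?xs = n"
      using M by (metis (mono_tags, lifting) mem_Collect_eq mpartitions_def mset_rev mset_sorted_list_of_multiset sum_mset_sum_list)
    ultimately have "?xs \<in> partitions n" using M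
      by (auto simp: partitions_def mpartitions_def intro!: gr0I)
    then show "M \<in> mset ` partitions n" by (intro image_eqI[of _ _ ?xs]) auto
  qed (auto simp: mpartitions_def partitions_def sum_mset_sum_list)
qed

lemma finite_mpartitions [simp]: "finite (mpartitions n)"
  using bij_betw_finite[OF bij_betw_mset_partitions] finite_partitions by blast

lemma num_partitions_eq: "num_partitions n = card (mpartitions n)"
  unfolding num_partitions_def by (rule bij_betw_same_card[OF bij_betw_mset_partitions])

definition no_ones :: "nat \<Rightarrow> nat multiset set" where
  "no_ones n = {M \<in> mpartitions n. 1 \<notin># M}"

text \<open>Deleting a part 1 maps the partitions of \<open>Suc n\<close> that have such a part onto
  the partitions of \<open>n\<close>. So \<open>no_ones\<close> governs the ratio of consecutive
  values.\<close>

lemma num_partitions_Suc: "num_partitions (Suc n) = num_partitions n + card (no_ones (Suc n))"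
proof -
  have "mpartitions (Suc n) = add_mset 1 ` mpartitions n \<union> no_ones (Suc n)"
  proof (intro equalityI subsetI)
    fix M assume M: "M \<in> mpartitions (Suc n)"
    show "M \<in> add_mset 1 ` mpartitions n \<union> no_ones (Suc n)"
    proof (cases "1 \<in># M")
      case True
      then obtain N where "M = add_mset 1 N" by (metis mset_add)
      then show ?thesis using M by (auto simp: mpartitions_def)
    qed (use M in \<open>simp add: no_ones_def\<close>)
  qed (auto simp: mpartitions_def no_ones_def)
  moreover have "card (add_mset 1 ` mpartitions n) = card (mpartitions n)"
    by (intro card_image) (auto simp: inj_on_def)
  moreover have "add_mset 1 ` mpartitions n \<inter> no_ones (Suc n) = {}"
    by (auto simp: no_ones_def)
  moreover have "finite (no_ones (Suc n))" by (simp add: no_ones_def)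
  ultimately show ?thesis by (simp add: num_partitions_eq card_Un_disjoint)
qed

lemma mono_num_partitions: "mono num_partitions"
  by (rule incseq_SucI) (simp add: num_partitions_Suc)

lemma num_partitions_0 [simp]: "num_partitions 0 = 1"
proof -
  have "mpartitions 0 = {{#}}"
    by (auto simp: mpartitions_def) (metis multiset_nonemptyE)
  then show ?thesis by (simp add: num_partitions_eq)
qed

lemma num_partitions_pos: "0 < num_partitions n"
  using monoD[OF mono_num_partitions, of 0 n] by simp

(* Breaking up one part s into ones turns a partition without ones into one from which
   s can be read off as the number of ones. *)
lemma sum_distinct_parts_no_ones:
  "(\<Sum>M\<in>no_ones n. card (set_mset M)) \<le> num_partitions n"
proof -
  let ?S = "SIGMA M:no_ones n. set_mset M"
  let ?f = "\<lambda>(M, s). (M - {#s#}) + replicate_mset s 1"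
  have "inj_on ?f ?S"
  proof (rule inj_onI, clarify)
    fix M s N r
    assume M: "M \<in> no_ones n" "s \<in># M" and N: "N \<in> no_ones n" "r \<in># N"
      and eq: "M - {#s#} + replicate_mset s 1 = N - {#r#} + replicate_mset r 1"
    have "count (M - {#s#} + replicate_mset s 1) 1 = s" "count (N - {#r#} + replicate_mset r 1) 1 = r"
      using M N by (auto simp: no_ones_def) (auto simp: not_in_iff)
    then have sr: "s = r" by (metis eq)
    then have "M - {#s#} = N - {#r#}" using eq by simp
    then show "M = N \<and> s = r" using sr M N by (metis insert_DiffM)
  qed
  moreover have "?f ` ?S \<subseteq> mpartitions n"
  proof clarify
    fix M s assume M: "M \<in> no_ones n" and s: "s \<in># M"
    obtain N where "M = add_mset s N" using s by (metis mset_add)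
    then show "M - {#s#} + replicate_mset s 1 \<in> mpartitions n"
      using M by (auto simp: no_ones_def mpartitions_def sum_mset_replicate_mset in_replicate_mset)
  qed
  ultimately have "card ?S \<le> card (mpartitions n)" by (intro card_inj_on_le[of ?f]) auto
  then show ?thesis by (simp add: num_partitions_eq no_ones_def card_SigmaI)
qed

text \<open>Such a partition is encoded by \<open>K\<close> pairs of a part and its multiplicity,
  filled up with pairs \<open>(0, 0)\<close>, which contribute nothing. So these partitions are
  polynomially few.\<close>

lemma card_few_distinct_parts:
  "card {M \<in> mpartitions n. card (set_mset M) < K} \<le> (Suc n * Suc n) ^ K"
proof -
  let ?P = "{0..n} \<times> {0..n}"
  let ?L = "{xs. set xs \<subseteq> ?P \<and> length xs = K}"
  let ?f = "\<lambda>xs. \<Sum>(s, c)\<leftarrow>xs. replicate_mset c (s :: nat)"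
  have "{M \<in> mpartitions n. card (set_mset M) < K} \<subseteq> ?f ` ?L"
  proof clarify
    fix M assume M: "M \<in> mpartitions n" and card: "card (set_mset M) < K"
    obtain ss where ss: "set ss = set_mset M" "distinct ss"
      using finite_distinct_list[of "set_mset M"] by auto
    let ?xs = "map (\<lambda>s. (s, count M s)) ss @ replicate (K - length ss) (0, 0)"
    have len: "length ss < K" using ss card by (metis distinct_card)
    have "s \<le> n \<and> count M s \<le> n" if "s \<in># M" for s
    proof -
      have "0 < s" using that M by (auto simp: mpartitions_def intro!: gr0I)
      obtain N where N: "M = replicate_mset (count M s) s + N"
        by (metis count_le_replicate_mset_subset_eq le_refl subset_mset.le_iff_add)
      have "\<Sum>\<^sub># M = count M s * s + \<Sum>\<^sub># N"
        using arg_cong[OF N, of sum_mset] by simp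
      then have le: "count M s * s \<le> n" using M by (simp add: mpartitions_def)
      have "0 < count M s" using that by simp
      then have a: "1 * s \<le> count M s * s" by (intro mult_le_mono) auto
      have b: "count M s * 1 \<le> count M s * s" using \<open>0 < s\<close> by (intro mult_le_mono) auto
      show ?thesis using le a b by linarith
    qed
    then have xs: "?xs \<in> ?L" using len ss by (auto simp: in_set_replicate)
    have fxs: "?f ?xs = M"
    proof -
      have "sum_list (replicate k {#}) = ({#} :: nat multiset)" for k by (induction k) auto
      then have "?f ?xs = (\<Sum>s\<leftarrow>ss. replicate_mset (count M s) s)"
        by (simp add: comp_def)
      also have "\<dots> = (\<Sum>s\<in>set_mset M. replicate_mset (count M s) s)"
        using ss by (metis sum_list_distinct_conv_sum_set)
      also have "\<dots> = M" by (rule multiset_eqI) (auto simp: count_sum count_eq_zero_iff)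
      finally show ?thesis .
    qed
    show "M \<in> ?f ` ?L" using xs fxs[symmetric] by (rule rev_image_eqI[of ?xs ?L M ?f])
  qed
  then have "card {M \<in> mpartitions n. card (set_mset M) < K} \<le> card (?f ` ?L)"
    by (intro card_mono finite_imageI finite_lists_length_eq) auto
  also have "\<dots> \<le> card ?L" by (intro card_image_le finite_lists_length_eq) auto
  also have "\<dots> = (Suc n * Suc n) ^ K"
    by (subst card_lists_length_eq) (auto simp: card_cartesian_product)
  finally show ?thesis .
qed

text \<open>Each subset of \<open>{2..K}\<close>, taken as a set of distinct parts, has sum at most
  \<open>K * K\<close> and is completed to a partition of \<open>n\<close> by ones.\<close>

lemma num_partitions_ge_power2:
  assumes "K * K \<le> n"
  shows "2 ^ (K - 1) \<le> num_partitions n"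
proof -
  let ?f = "\<lambda>A. mset_set A + replicate_mset (n - \<Sum>A) (1 :: nat)"
  have "inj_on ?f (Pow {2..K})"
  proof (rule inj_onI)
    fix A B assume AB: "A \<in> Pow {2..K}" "B \<in> Pow {2..K}" and eq: "?f A = ?f B"
    have fin: "finite A" "finite B" using AB by (auto intro: finite_subset)
    have "x \<in> A \<longleftrightarrow> x \<in> B" for x
    proof (cases "x = 1")
      case False
      then have "count (?f A) x = count (mset_set A) x" "count (?f B) x = count (mset_set B) x" by auto
      then show ?thesis using eq fin by (metis count_mset_set(1) count_mset_set(3) zero_neq_one)
    qed (use AB in auto)
    then show "A = B" by blast
  qed
  moreover have "?f ` Pow {2..K} \<subseteq> mpartitions n"
  proof clarify
    fix A assume A: "A \<subseteq> {2..K}"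
    then have fin: "finite A" by (auto intro: finite_subset)
    have "\<Sum>A \<le> \<Sum>{2..K}" using A by (intro sum_mono2) auto
    also have "\<dots> \<le> (\<Sum>i\<in>{2..K}. K)" by (intro sum_mono) auto
    also have "\<dots> \<le> n" using assms by (simp add: diff_mult_distrib)
    finally have "\<Sum>A \<le> n" .
    moreover have "\<Sum>\<^sub># (mset_set A) = \<Sum>A" by (simp add: sum_unfold_sum_mset)
    ultimately show "?f A \<in> mpartitions n"
      using A fin by (auto simp: mpartitions_def in_replicate_mset)
  qed
  ultimately have "card (Pow {2..K}) \<le> card (mpartitions n)"
    by (intro card_inj_on_le[of ?f]) auto
  then show ?thesis by (simp add: num_partitions_eq card_Pow)
qed

lemma polynomial_over_num_partitions:
  "(\<lambda>n. real n ^ d / real (num_partitions n)) \<longlonglongrightarrow> 0"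
proof (rule tendsto_sandwich[of "\<lambda>_. 0"])
  show "\<forall>\<^sub>F n in sequentially. real n ^ d / real (num_partitions n) \<le> real n ^ d / 2 powr (sqrt (real n) - 2)"
  proof (rule always_eventually, rule allI)
    fix n
    let ?K = "nat \<lfloor>sqrt (real n)\<rfloor>"
    have "real ?K \<le> sqrt (real n)" by simp
    then have "real ?K ^ 2 \<le> sqrt (real n) ^ 2" by (intro power_mono) auto
    then have "real (?K * ?K) \<le> real n" by (simp add: power2_eq_square)
    then have "?K * ?K \<le> n" by (simp only: of_nat_le_iff)
    then have "real (2 ^ (?K - 1)) \<le> real (num_partitions n)"
      using num_partitions_ge_power2 of_nat_le_iff by blast
    \<comment> \<open>One unit is lost to the floor, the other to the exponent
      \<open>?K - 1\<close>.\<close>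
    moreover have "2 powr (sqrt (real n) - 2) \<le> 2 powr real (?K - 1)"
      by (intro powr_mono) linarith+
    moreover have "2 powr real (?K - 1) = real (2 ^ (?K - 1))" by (simp add: powr_realpow)
    ultimately have "2 powr (sqrt (real n) - 2) \<le> real (num_partitions n)" by linarith
    then show "real n ^ d / real (num_partitions n) \<le> real n ^ d / 2 powr (sqrt (real n) - 2)"
      by (intro divide_left_mono) (auto intro!: mult_pos_pos simp: num_partitions_pos)
  qed
  show "(\<lambda>n. real n ^ d / 2 powr (sqrt (real n) - 2)) \<longlonglongrightarrow> 0"
    by real_asymp
qed auto

text \<open>By \<open>sum_distinct_parts_no_ones\<close>, at most
  \<open>num_partitions n / K\<close> partitions without ones have \<open>K\<close> or more distinct
  parts, and those with fewer distinct parts are negligible. So almost all partitions contain a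
  one.\<close>

lemma num_partitions_ratio: "(\<lambda>n. real (num_partitions (Suc n)) / real (num_partitions n)) \<longlonglongrightarrow> 1"
proof -
  have bound: "real K * (real (card (no_ones n)) - real ((Suc n * Suc n) ^ K)) \<le> real (num_partitions n)" for K n
  proof -
    let ?few = "{M \<in> mpartitions n. card (set_mset M) < K}"
    have fin: "finite (no_ones n)" by (simp add: no_ones_def)
    have "card (no_ones n) \<le> card (?few \<union> {M \<in> no_ones n. K \<le> card (set_mset M)})"
      by (intro card_mono) (auto simp: no_ones_def)
    also have "\<dots> \<le> card ?few + card {M \<in> no_ones n. K \<le> card (set_mset M)}" by (rule card_Un_le)
    finally have "card (no_ones n) \<le> (Suc n * Suc n) ^ K + card {M \<in> no_ones n. K \<le> card (set_mset M)}"
      using card_few_distinct_parts[of n K] by linarith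
    then have "real (card (no_ones n)) - real ((Suc n * Suc n) ^ K) \<le> real (card {M \<in> no_ones n. K \<le> card (set_mset M)})"
      by linarith
    then have "real K * (real (card (no_ones n)) - real ((Suc n * Suc n) ^ K)) \<le> real K * real (card {M \<in> no_ones n. K \<le> card (set_mset M)})"
      by (intro mult_left_mono) auto
    also have "\<dots> = real (\<Sum>M\<in>{M \<in> no_ones n. K \<le> card (set_mset M)}. K)" by simp
    also have "\<dots> \<le> real (\<Sum>M\<in>{M \<in> no_ones n. K \<le> card (set_mset M)}. card (set_mset M))"
      by (intro of_nat_mono sum_mono) auto
    also have "\<dots> \<le> real (\<Sum>M\<in>no_ones n. card (set_mset M))"
      using fin by (intro of_nat_mono sum_mono2) auto
    also have "\<dots> \<le> real (num_partitions n)"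
      using sum_distinct_parts_no_ones of_nat_mono by blast
    finally show ?thesis .
  qed
  have "(\<lambda>n. real (card (no_ones n)) / real (num_partitions n)) \<longlonglongrightarrow> 0"
  proof (rule LIMSEQ_I)
    fix e :: real assume e: "e > 0"
    obtain K :: nat where K: "2 / e < real K" using reals_Archimedean2 by blast
    then have K0: "0 < real K" using e by (meson divide_pos_pos less_trans zero_less_numeral)
    have poly: "(\<lambda>n. real ((Suc n * Suc n) ^ K) / real (num_partitions n)) \<longlonglongrightarrow> 0"
    proof (rule tendsto_sandwich[of "\<lambda>_. 0"])
      show "(\<lambda>n. 4 ^ K * (real n ^ (2 * K) / real (num_partitions n))) \<longlonglongrightarrow> 0"
        using tendsto_mult_right_zero[OF polynomial_over_num_partitions] .
      show "\<forall>\<^sub>F n in sequentially. real ((Suc n * Suc n) ^ K) / real (num_partitions n) \<le> 4 ^ K * (real n ^ (2 * K) / real (num_partitions n))"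
      proof (rule eventually_mono[OF eventually_ge_at_top[of 1]])
        fix n :: nat assume "1 \<le> n"
        then have "Suc n * Suc n \<le> (2 * n) * (2 * n)" by (intro mult_le_mono) auto
        then have "(Suc n * Suc n) ^ K \<le> (4 * n ^ 2) ^ K" by (intro power_mono) (auto simp: power2_eq_square)
        then have "real ((Suc n * Suc n) ^ K) \<le> real ((4 * n ^ 2) ^ K)" by (simp only: of_nat_le_iff)
        also have "\<dots> = 4 ^ K * real n ^ (2 * K)" by (simp add: power_mult_distrib power_mult)
        finally show "real ((Suc n * Suc n) ^ K) / real (num_partitions n) \<le> 4 ^ K * (real n ^ (2 * K) / real (num_partitions n))"
          by (simp add: divide_right_mono)
      qed
    qed auto
    have "\<forall>\<^sub>F n in sequentially. real ((Suc n * Suc n) ^ K) / real (num_partitions n) < e / 2"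
      using order_tendstoD(2)[OF poly, of "e / 2"] e by auto
    then obtain N where N: "\<And>n. n \<ge> N \<Longrightarrow> real ((Suc n * Suc n) ^ K) / real (num_partitions n) < e / 2"
      by (auto simp: eventually_sequentially)
    have "norm (real (card (no_ones n)) / real (num_partitions n) - 0) < e" if "n \<ge> N" for n
    proof -
      have p: "0 < real (num_partitions n)" using num_partitions_pos by simp
      have "real (card (no_ones n)) - real ((Suc n * Suc n) ^ K) \<le> real (num_partitions n) / real K"
        using bound[of K n] K0 by (simp add: pos_le_divide_eq mult.commute)
      then have "real (card (no_ones n)) / real (num_partitions n) \<le> 1 / real K + real ((Suc n * Suc n) ^ K) / real (num_partitions n)"
        using p by (simp add: field_simps)
      moreover have "1 / real K < e / 2" using K K0 e by (simp add: field_simps)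
      moreover have "norm (real (card (no_ones n)) / real (num_partitions n) - 0) = real (card (no_ones n)) / real (num_partitions n)"
        by simp
      ultimately show ?thesis using N[OF that] by linarith
    qed
    then show "\<exists>no. \<forall>n\<ge>no. norm (real (card (no_ones n)) / real (num_partitions n) - 0) < e" by blast
  qed
  then have "(\<lambda>n. real (card (no_ones (Suc n))) / real (num_partitions (Suc n))) \<longlonglongrightarrow> 0"
    by (rule LIMSEQ_Suc)
  then have "(\<lambda>n. 1 / (1 - real (card (no_ones (Suc n))) / real (num_partitions (Suc n)))) \<longlonglongrightarrow> 1 / (1 - 0)"
    by (intro tendsto_intros) auto
  moreover have "1 / (1 - real (card (no_ones (Suc n))) / real (num_partitions (Suc n))) =
      real (num_partitions (Suc n)) / real (num_partitions n)" for n
    using num_partitions_pos[of n] num_partitions_pos[of "Suc n"]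
    by (simp add: num_partitions_Suc field_simps)
  ultimately show ?thesis by simp
qed

section \<open>Sequences whose consecutive ratios tend to 1\<close>

definition subexponential :: "(nat \<Rightarrow> real) \<Rightarrow> bool" where
  "subexponential u \<longleftrightarrow> mono u \<and> 0 < u 0 \<and> (\<lambda>m. u (Suc m) / u m) \<longlonglongrightarrow> 1"

lemma subexponential_pos: "subexponential u \<Longrightarrow> 0 < u m"
  unfolding subexponential_def by (metis le0 less_le_trans monoD)

lemma subexponential_le_twice:
  assumes "subexponential u"
  shows "\<forall>\<^sub>F m in sequentially. u (m + C) \<le> 2 * u m"
proof -
  have "(\<lambda>m. u (m + C) / u m) \<longlonglongrightarrow> 1"
  proof (induction C)
    case (Suc C)
    have "(\<lambda>m. u (Suc (m + C)) / u (m + C)) \<longlonglongrightarrow> 1"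
      using LIMSEQ_ignore_initial_segment[of "\<lambda>m. u (Suc m) / u m" 1 C] assms
      by (simp add: subexponential_def)
    from tendsto_mult[OF this Suc] show ?case
      using subexponential_pos[OF assms, THEN less_imp_neq] by (simp add: field_simps)
  qed (use subexponential_pos[OF assms, THEN less_imp_neq] in simp)
  then have "\<forall>\<^sub>F m in sequentially. u (m + C) / u m < 2"
    by (rule order_tendstoD) simp
  then show ?thesis
    by eventually_elim (use subexponential_pos[OF assms] in \<open>simp add: field_simps less_imp_le\<close>)
qed

text \<open>An increment of the convolution consists of terms in which \<open>u\<close> has a large
  argument and hence grows slowly, and of boundedly many others. The latter are of the order of
  \<open>p m\<close>, which is negligible because the convolution contains arbitrarily many terms
  comparable to \<open>p m\<close>.\<close>

lemma subexponential_convolution: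
  assumes p: "subexponential p" and u: "subexponential u"
  shows "subexponential (\<lambda>m. \<Sum>j\<le>m. p j * u (m - j))"
proof -
  define c where "c = (\<lambda>m. \<Sum>j\<le>m. p j * u (m - j))"
  note ppos = subexponential_pos[OF p] and upos = subexponential_pos[OF u]
  have pm: "mono p" and um: "mono u" using p u by (auto simp: subexponential_def)
  have diff: "c (Suc m) - c m = (\<Sum>j\<le>m. p j * (u (Suc m - j) - u (m - j))) + p (Suc m) * u 0" for m
    by (simp add: c_def sum_subtractf right_diff_distrib)
  have term_nonneg: "0 \<le> p j * (u (Suc m - j) - u (m - j))" for j m
    using ppos[of j] monoD[OF um, of "m - j" "Suc m - j"] by (intro mult_nonneg_nonneg) auto
  have inc: "c m \<le> c (Suc m)" for m
    using diff[of m] term_nonneg ppos[of "Suc m"] upos[of 0]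
    by (smt (verit) mult_nonneg_nonneg sum_nonneg)
  have cpos: "0 < c m" for m
    unfolding c_def using ppos upos by (intro sum_pos) auto
  have small: "\<forall>\<^sub>F m in sequentially. p m \<le> e * c m" if "e > 0" for e
  proof -
    obtain K :: nat where K: "2 / (e * u 0) < real K" using reals_Archimedean2 by blast
    then have K2: "1 \<le> e * (real (Suc K) * (u 0 / 2))"
      using that upos[of 0] by (simp add: field_simps) (smt (verit) mult_pos_pos)
    obtain M where M: "\<And>m. m \<ge> M \<Longrightarrow> p (m + K) \<le> 2 * p m"
      using subexponential_le_twice[OF p, of K] by (auto simp: eventually_sequentially)
    have "p m \<le> e * c m" if m: "m \<ge> M + K" for m
    proof -
      \<comment> \<open>Each of the last \<open>K + 1\<close> terms of the convolution is at least
        \<open>(p m / 2) * u 0\<close>.\<close>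
      have "real (Suc K) * (u 0 / 2) * p m = (\<Sum>j\<in>{m - K..m}. (p m / 2) * u 0)"
        using m by simp
      also have "\<dots> \<le> (\<Sum>j\<in>{m - K..m}. p j * u (m - j))"
      proof (intro sum_mono mult_mono)
        fix j assume j: "j \<in> {m - K..m}"
        have "p m \<le> 2 * p (m - K)" using M[of "m - K"] m by simp
        moreover have "p (m - K) \<le> p j" using j monoD[OF pm] by auto
        ultimately show "p m / 2 \<le> p j" by simp
        show "u 0 \<le> u (m - j)" using monoD[OF um] by simp
      qed (use ppos upos less_imp_le in auto)
      also have "\<dots> \<le> c m"
        unfolding c_def using ppos[THEN less_imp_le] upos[THEN less_imp_le] by (intro sum_mono2) auto
      finally have "e * (real (Suc K) * (u 0 / 2) * p m) \<le> e * c m"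
        using \<open>e > 0\<close> by (intro mult_left_mono) auto
      moreover have "1 * p m \<le> e * (real (Suc K) * (u 0 / 2)) * p m"
        using K2 ppos[of m] by (intro mult_right_mono) auto
      ultimately show ?thesis by (simp add: mult.assoc)
    qed
    then show ?thesis unfolding eventually_sequentially by blast
  qed
  have "(\<lambda>m. (c (Suc m) - c m) / c m) \<longlonglongrightarrow> 0"
  proof (rule LIMSEQ_I)
    fix e :: real assume e: "e > 0"
    have "(\<lambda>m. u (Suc m) / u m) \<longlonglongrightarrow> 1" using u by (simp add: subexponential_def)
    from order_tendstoD(2)[OF this, of "1 + e / 4"] e
    obtain N where N: "\<And>i. i \<ge> N \<Longrightarrow> u (Suc i) / u i < 1 + e / 4"
      by (auto simp: eventually_sequentially)
    have uN: "u (Suc i) - u i \<le> (e / 4) * u i" if "i \<ge> N" for i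
      using N[OF that] upos[of i] by (simp add: field_simps)
    \<comment> \<open>Dominates the coefficients of \<open>p m\<close>: \<open>N\<close> terms of at
      most \<open>p m * u N\<close>, and the boundary term \<open>p (Suc m) * u 0\<close> with
      \<open>p (Suc m) \<le> 2 * p m\<close>.\<close>
    define D where "D = real N * u N + 2 * u 0 + 1"
    have D: "D > 0" unfolding D_def using upos[of N] upos[of 0] by (simp add: add_nonneg_pos)
    obtain M where M: "\<And>m. m \<ge> M \<Longrightarrow> p m \<le> (e / (4 * D)) * c m"
      using small[of "e / (4 * D)"] e D by (auto simp: eventually_sequentially)
    obtain M' where M': "\<And>m. m \<ge> M' \<Longrightarrow> p (Suc m) \<le> 2 * p m"
      using subexponential_le_twice[OF p, of 1] by (auto simp: eventually_sequentially)
    have "norm ((c (Suc m) - c m) / c m - 0) < e" if m: "m \<ge> M + M'" for m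
    proof -
      have "(\<Sum>j\<le>m. p j * (u (Suc m - j) - u (m - j)))
          \<le> (\<Sum>j\<le>m. (e / 4) * (p j * u (m - j)) + (if j \<in> {Suc m - N..m} then p m * u N else 0))"
      proof (rule sum_mono)
        fix j assume "j \<in> {..m}"
        then have j: "j \<le> m" by simp
        show "p j * (u (Suc m - j) - u (m - j)) \<le> (e / 4) * (p j * u (m - j)) + (if j \<in> {Suc m - N..m} then p m * u N else 0)"
        proof (cases "j \<in> {Suc m - N..m}")
          case True
          have "p j * (u (Suc m - j) - u (m - j)) \<le> p m * u N"
          proof (rule mult_mono)
            have "u (Suc m - j) \<le> u N" using True by (intro monoD[OF um]) auto
            then show "u (Suc m - j) - u (m - j) \<le> u N" using upos[of "m - j"] by simp
            show "0 \<le> u (Suc m - j) - u (m - j)" using monoD[OF um, of "m - j" "Suc m - j"] by simp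
          qed (use j monoD[OF pm] ppos[THEN less_imp_le] in auto)
          moreover have "0 \<le> (e / 4) * (p j * u (m - j))"
            using e ppos[of j] upos[of "m - j"] by simp
          ultimately show ?thesis using True by simp
        next
          case False
          then have "u (Suc (m - j)) - u (m - j) \<le> (e / 4) * u (m - j)" using j by (intro uN) auto
          then have "p j * (u (Suc (m - j)) - u (m - j)) \<le> p j * ((e / 4) * u (m - j))"
            using ppos[of j] by (intro mult_left_mono) auto
          moreover have "Suc m - j = Suc (m - j)" using j by simp
          ultimately show ?thesis
            using False by (simp only: if_False add_0_right mult.left_commute[of "p j" "e / 4"])
        qed
      qed
      also have "\<dots> = (e / 4) * c m + real (card ({..m} \<inter> {Suc m - N..m})) * (p m * u N)"
        by (simp only: sum.distrib sum_distrib_left[symmetric] c_def sum.inter_restrict[OF finite_atMost, symmetric] sum_constant) simp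
      also have "\<dots> \<le> (e / 4) * c m + real N * (p m * u N)"
      proof -
        have "card ({..m} \<inter> {Suc m - N..m}) \<le> card {Suc m - N..m}" by (intro card_mono) auto
        then have "card ({..m} \<inter> {Suc m - N..m}) \<le> N" by simp
        then show ?thesis using ppos[of m] upos[of N] by (intro add_left_mono mult_right_mono) auto
      qed
      finally have "c (Suc m) - c m \<le> (e / 4) * c m + real N * (p m * u N) + p (Suc m) * u 0"
        using diff[of m] by simp
      also have "p (Suc m) * u 0 \<le> (2 * p m) * u 0"
        using M'[of m] m upos[of 0] by (intro mult_right_mono) auto
      finally have "c (Suc m) - c m \<le> (e / 4) * c m + (real N * u N + 2 * u 0) * p m"
        by (simp add: algebra_simps)
      also have "(real N * u N + 2 * u 0) * p m \<le> D * p m"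
        using ppos[of m] by (intro mult_right_mono) (auto simp: D_def)
      also have "D * p m \<le> D * ((e / (4 * D)) * c m)"
        using M[of m] m D by (intro mult_left_mono) auto
      also have "\<dots> = (e / 4) * c m" using D by simp
      finally have "c (Suc m) - c m \<le> (e / 2) * c m" by simp
      then have "(c (Suc m) - c m) / c m \<le> e / 2" using cpos[of m] by (simp add: pos_divide_le_eq)
      moreover have "0 \<le> (c (Suc m) - c m) / c m" using inc[of m] cpos[of m] by simp
      ultimately show ?thesis using e unfolding diff_0_right real_norm_def by linarith
    qed
    then show "\<exists>no. \<forall>n\<ge>no. norm ((c (Suc n) - c n) / c n - 0) < e" by blast
  qed
  then have "(\<lambda>m. (c (Suc m) - c m) / c m + 1) \<longlonglongrightarrow> 0 + 1" by (intro tendsto_intros)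
  moreover have "(c (Suc m) - c m) / c m + 1 = c (Suc m) / c m" for m
    using cpos[of m] by (simp add: field_simps)
  ultimately have "(\<lambda>m. c (Suc m) / c m) \<longlonglongrightarrow> 1" by simp
  then show ?thesis
    using inc cpos[of 0] unfolding subexponential_def c_def[symmetric] by (auto intro: incseq_SucI)
qed

lemma subexponential_num_partitions: "subexponential (\<lambda>m. real (num_partitions m))"
  using num_partitions_ratio mono_num_partitions by (auto simp: subexponential_def mono_def)

text \<open>The induction starts at 1, since \<open>multipartitions 0\<close> vanishes beyond 0 and
  so is not monotone.\<close>

lemma subexponential_multipartitions:
  assumes "0 < t"
  shows "subexponential (\<lambda>m. real (multipartitions t m))"
  using assms
proof (induction t rule: nat_induct_non_zero)
  case 1
  have "multipartitions (Suc 0) m = (\<Sum>j\<le>m. if j = m then num_partitions j else 0)" for m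
    unfolding multipartitions.simps by (intro sum.cong) auto
  then have "multipartitions (Suc 0) m = num_partitions m" for m by simp
  then show ?case unfolding One_nat_def using subexponential_num_partitions by presburger
next
  case (Suc t)
  then show ?case using subexponential_convolution[OF subexponential_num_partitions Suc.IH] by simp
qed

section \<open>Weights along lattice lines\<close>

text \<open>One direction of the lattice: the orbits of \<open>\<sigma>\<close> are the lines.
  Concavity is recorded in the form in which it acts: once the level fails to rise along an orbit,
  it never rises again.\<close>

locale level_shift =
  fixes X :: "'a set" and \<sigma> :: "'a \<Rightarrow> 'a" and level :: "'a \<Rightarrow> int" and f :: "nat \<Rightarrow> real"
  assumes bij: "bij_betw \<sigma> X X"
    and finite_levels: "finite {x \<in> X. 0 \<le> level x}"
    and mono_f: "mono f" and f_nonneg: "0 \<le> f i"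
    and concave: "x \<in> X \<Longrightarrow> level (\<sigma> x) \<le> level x \<Longrightarrow> level (\<sigma> (\<sigma> x)) \<le> level (\<sigma> x)"
begin

definition weight :: "'a set \<Rightarrow> real" where
  "weight C = (\<Sum>x\<in>{x \<in> C. 0 \<le> level x}. f (nat (level x)))"

definition descent :: "'a set" where
  "descent = {x \<in> X. level (\<sigma> x) \<le> level x}"

text \<open>At most one point on each orbit, the first from which the level does not rise. The level
  is maximal on the orbit there.\<close>

definition vertices :: "'a set" where
  "vertices = descent - \<sigma> ` descent"

lemma inj: "inj_on \<sigma> X" and image: "\<sigma> ` X = X"
  using bij by (auto simp: bij_betw_def)

lemma finite_levels_subset: "C \<subseteq> X \<Longrightarrow> finite {x \<in> C. 0 \<le> level x}"
  by (rule finite_subset[OF _ finite_levels]) auto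

lemma weight_mono: "C \<subseteq> D \<Longrightarrow> D \<subseteq> X \<Longrightarrow> weight C \<le> weight D"
  unfolding weight_def using finite_levels_subset[of D] f_nonneg by (intro sum_mono2) auto

lemma weight_Un: "C \<subseteq> X \<Longrightarrow> D \<subseteq> X \<Longrightarrow> C \<inter> D = {} \<Longrightarrow> weight (C \<union> D) = weight C + weight D"
  unfolding weight_def
  by (subst sum.union_disjoint[symmetric]) (auto intro!: sum.cong finite_levels_subset)

lemma weight_split: "C \<subseteq> X \<Longrightarrow> weight C = weight (C \<inter> E) + weight (C - E)"
  using weight_Un[of "C \<inter> E" "C - E"] by (auto simp: Int_Diff_Un)

lemma weight_Diff: "C \<subseteq> D \<Longrightarrow> D \<subseteq> X \<Longrightarrow> weight (D - C) = weight D - weight C"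
  using weight_split[of D C] by (simp add: Int_absorb1)

lemma weight_image_split:
  assumes "C \<subseteq> X"
  shows "weight (\<sigma> ` C) = weight (\<sigma> ` (C \<inter> E)) + weight (\<sigma> ` (C - E))"
proof -
  have "weight (\<sigma> ` (C \<inter> E) \<union> \<sigma> ` (C - E)) = weight (\<sigma> ` (C \<inter> E)) + weight (\<sigma> ` (C - E))"
  proof (rule weight_Un)
    show "\<sigma> ` (C \<inter> E) \<inter> \<sigma> ` (C - E) = {}"
      using assms inj_on_image_Int[OF inj, of "C \<inter> E" "C - E"] by auto
  qed (use assms image in auto)
  then show ?thesis by (simp add: image_Un[symmetric] Int_Diff_Un)
qed

lemma weight_image:
  assumes "E \<subseteq> X"
  shows "weight (\<sigma> ` E) = (\<Sum>x\<in>{x \<in> E. 0 \<le> level (\<sigma> x)}. f (nat (level (\<sigma> x))))"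
proof -
  have "{y \<in> \<sigma> ` E. 0 \<le> level y} = \<sigma> ` {x \<in> E. 0 \<le> level (\<sigma> x)}" by auto
  moreover have "inj_on \<sigma> {x \<in> E. 0 \<le> level (\<sigma> x)}"
    using assms by (intro inj_on_subset[OF inj]) auto
  ultimately show ?thesis by (simp add: weight_def sum.reindex)
qed

lemma finite_image_levels: "E \<subseteq> X \<Longrightarrow> finite {x \<in> E. 0 \<le> level (\<sigma> x)}"
proof -
  assume E: "E \<subseteq> X"
  have "\<sigma> ` {x \<in> E. 0 \<le> level (\<sigma> x)} \<subseteq> {x \<in> X. 0 \<le> level x}" using E image by auto
  then have "finite (\<sigma> ` {x \<in> E. 0 \<le> level (\<sigma> x)})" using finite_levels finite_subset by blast
  then show ?thesis by (rule finite_imageD) (use E in \<open>auto intro: inj_on_subset[OF inj]\<close>)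
qed

lemma weight_le_image:
  assumes "E \<subseteq> X" "\<And>x. x \<in> E \<Longrightarrow> level x \<le> level (\<sigma> x)"
  shows "weight E \<le> weight (\<sigma> ` E)"
proof -
  have "weight E \<le> (\<Sum>x\<in>{x \<in> E. 0 \<le> level x}. f (nat (level (\<sigma> x))))"
    unfolding weight_def using assms by (intro sum_mono monoD[OF mono_f] nat_mono) auto
  also have "\<dots> \<le> (\<Sum>x\<in>{x \<in> E. 0 \<le> level (\<sigma> x)}. f (nat (level (\<sigma> x))))"
    using assms finite_image_levels[of E] f_nonneg by (intro sum_mono2) (auto intro: order_trans)
  finally show ?thesis using weight_image[OF assms(1)] by simp
qed

lemma image_weight_le:
  assumes "E \<subseteq> X" "\<And>x. x \<in> E \<Longrightarrow> level (\<sigma> x) \<le> level x"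
  shows "weight (\<sigma> ` E) \<le> weight E"
proof -
  have "weight (\<sigma> ` E) \<le> (\<Sum>x\<in>{x \<in> E. 0 \<le> level (\<sigma> x)}. f (nat (level x)))"
    unfolding weight_image[OF assms(1)] using assms by (intro sum_mono monoD[OF mono_f] nat_mono) auto
  also have "\<dots> \<le> weight E"
    unfolding weight_def
    using assms finite_levels_subset[of E] f_nonneg by (intro sum_mono2) (auto intro: order_trans)
  finally show ?thesis .
qed

lemma descent_subset: "descent \<subseteq> X" and image_descent: "\<sigma> ` descent \<subseteq> descent"
  using concave image by (auto simp: descent_def)

lemma weight_vertices: "weight vertices = weight descent - weight (\<sigma> ` descent)"
  unfolding vertices_def using image_descent descent_subset by (rule weight_Diff)

(* Along each orbit the level first rises and then falls, so the total variation of the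
   weight along the orbit is twice its maximal value. *)
lemma weight_shift_diff:
  assumes C: "C \<subseteq> X"
  shows "\<bar>weight C - weight (\<sigma> ` C)\<bar> \<le> weight vertices"
proof -
  let ?A = descent
  \<comment> \<open>\<open>\<sigma>\<close> loses weight on every part of \<open>descent\<close>,
    gains weight on every part of the complement, and preserves the weight of \<open>X\<close>. So
    the total loss and the total gain both equal \<open>weight vertices\<close>, and the change on
    \<open>C\<close> is a partial gain minus a partial loss.\<close>
  have le: "weight (\<sigma> ` E) \<le> weight E" if "E \<subseteq> ?A" for E
    using that by (intro image_weight_le) (auto simp: descent_def)
  have ge: "weight E \<le> weight (\<sigma> ` E)" if "E \<subseteq> X - ?A" for E
    using that by (intro weight_le_image) (auto simp: descent_def)
  have "weight C = weight (C \<inter> ?A) + weight (C - ?A)"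
    "weight (\<sigma> ` C) = weight (\<sigma> ` (C \<inter> ?A)) + weight (\<sigma> ` (C - ?A))"
    using weight_split weight_image_split C by blast+
  moreover have "weight ?A = weight (?A \<inter> C) + weight (?A - C)"
    "weight (\<sigma> ` ?A) = weight (\<sigma> ` (?A \<inter> C)) + weight (\<sigma> ` (?A - C))"
    using weight_split weight_image_split descent_subset by blast+
  moreover have "weight (X - ?A) = weight ((X - ?A) \<inter> C) + weight ((X - ?A) - C)"
    "weight (\<sigma> ` (X - ?A)) = weight (\<sigma> ` ((X - ?A) \<inter> C)) + weight (\<sigma> ` ((X - ?A) - C))"
    using weight_split weight_image_split Diff_subset by blast+
  moreover have "weight X = weight (X \<inter> ?A) + weight (X - ?A)"
    "weight (\<sigma> ` X) = weight (\<sigma> ` (X \<inter> ?A)) + weight (\<sigma> ` (X - ?A))"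
    using weight_split weight_image_split order_refl by blast+
  moreover have "C \<inter> ?A = ?A \<inter> C" "(X - ?A) \<inter> C = C - ?A" "X \<inter> ?A = ?A" "\<sigma> ` X = X"
    using C descent_subset image by auto
  moreover have "weight (\<sigma> ` (?A \<inter> C)) \<le> weight (?A \<inter> C)" "weight (\<sigma> ` (?A - C)) \<le> weight (?A - C)"
    by (intro le; blast)+
  moreover have "weight (C - ?A) \<le> weight (\<sigma> ` (C - ?A))" "weight ((X - ?A) - C) \<le> weight (\<sigma> ` ((X - ?A) - C))"
    using C by (intro ge; blast)+
  ultimately show ?thesis using weight_vertices by simp
qed

lemma funpow_image_descent: "(\<sigma> ^^ Suc k) ` descent \<subseteq> (\<sigma> ^^ k) ` descent"
proof -
  have "(\<sigma> ^^ Suc k) ` descent = (\<sigma> ^^ k) ` (\<sigma> ` descent)"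
    by (simp add: funpow_swap1 image_comp)
  then show ?thesis using image_descent by auto
qed

lemma bij_funpow: "bij_betw (\<sigma> ^^ k) X X"
  using bij by (induction k) (auto simp: bij_betw_trans intro: bij_betw_id)

text \<open>The images of \<open>vertices\<close> under the first \<open>K\<close> powers of
  \<open>\<sigma>\<close> are disjoint, and by \<open>near\<close> and \<open>slow\<close> each of
  them weighs at least half as much as the vertices of level \<open>M + c\<close> or more. Together
  they weigh at most as much as \<open>X\<close>. The lower vertices weigh at most
  \<open>f (M + c)\<close> each.\<close>

lemma weight_vertices_le:
  assumes near: "\<And>x k. x \<in> vertices \<Longrightarrow> k < K \<Longrightarrow> level x - int c \<le> level ((\<sigma> ^^ k) x)"
    and slow: "\<And>i. i \<ge> M \<Longrightarrow> f (i + c) \<le> 2 * f i"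
  shows "real K * (weight vertices - f (M + c) * real (card {x \<in> X. 0 \<le> level x})) \<le> 2 * weight X"
proof -
  have VX: "vertices \<subseteq> X" using descent_subset by (auto simp: vertices_def)
  let ?V = "{x \<in> vertices. int (M + c) \<le> level x}"
  have inj_pow: "inj_on (\<sigma> ^^ k) X" and image_pow: "(\<sigma> ^^ k) ` X = X" for k
    using bij_funpow[of k] by (auto simp: bij_betw_def)
  have finV: "finite ?V" using finite_levels by (rule rev_finite_subset) (use VX in auto)
  have 1: "weight vertices \<le> (\<Sum>x\<in>?V. f (nat (level x))) + f (M + c) * real (card {x \<in> X. 0 \<le> level x})"
  proof -
    have "weight vertices = (\<Sum>x\<in>?V. f (nat (level x))) + (\<Sum>x\<in>{x \<in> vertices. 0 \<le> level x \<and> level x < int (M + c)}. f (nat (level x)))"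
      unfolding weight_def using finV VX finite_levels_subset[OF VX]
      by (subst sum.union_disjoint[symmetric])
        (auto intro!: sum.cong elim: rev_finite_subset)
    also have "(\<Sum>x\<in>{x \<in> vertices. 0 \<le> level x \<and> level x < int (M + c)}. f (nat (level x)))
        \<le> (\<Sum>x\<in>{x \<in> vertices. 0 \<le> level x \<and> level x < int (M + c)}. f (M + c))"
      by (intro sum_mono monoD[OF mono_f]) auto
    also have "\<dots> = f (M + c) * real (card {x \<in> vertices. 0 \<le> level x \<and> level x < int (M + c)})" by simp
    also have "\<dots> \<le> f (M + c) * real (card {x \<in> X. 0 \<le> level x})"
      using finite_levels VX f_nonneg by (intro mult_left_mono of_nat_mono card_mono) auto
    finally show ?thesis by simp
  qed
  have 2: "(\<Sum>x\<in>?V. f (nat (level x))) \<le> 2 * weight ((\<sigma> ^^ k) ` vertices)" if k: "k < K" for k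
  proof -
    have "(\<Sum>x\<in>?V. f (nat (level x))) \<le> (\<Sum>x\<in>?V. 2 * f (nat (level ((\<sigma> ^^ k) x))))"
    proof (rule sum_mono)
      fix x assume x: "x \<in> ?V"
      then have "int M \<le> level x - int c" by auto
      then have "f (nat (level x - int c) + c) \<le> 2 * f (nat (level x - int c))"
        by (intro slow) auto
      moreover have "nat (level x - int c) + c = nat (level x)" using x by auto
      moreover have "f (nat (level x - int c)) \<le> f (nat (level ((\<sigma> ^^ k) x)))"
        using near[of x k] x k by (intro monoD[OF mono_f] nat_mono) auto
      ultimately show "f (nat (level x)) \<le> 2 * f (nat (level ((\<sigma> ^^ k) x)))" by simp
    qed
    also have "\<dots> = 2 * (\<Sum>y\<in>(\<sigma> ^^ k) ` ?V. f (nat (level y)))"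
      using inj_on_subset[OF inj_pow, of ?V k] VX by (subst sum.reindex) (auto simp: sum_distrib_left)
    also have "(\<Sum>y\<in>(\<sigma> ^^ k) ` ?V. f (nat (level y))) \<le> weight ((\<sigma> ^^ k) ` vertices)"
      unfolding weight_def
    proof (rule sum_mono2)
      show "finite {x \<in> (\<sigma> ^^ k) ` vertices. 0 \<le> level x}"
        using image_pow[of k] VX by (intro finite_levels_subset) auto
      show "(\<sigma> ^^ k) ` ?V \<subseteq> {x \<in> (\<sigma> ^^ k) ` vertices. 0 \<le> level x}"
        using near k by fastforce
    qed (rule f_nonneg)
    finally show ?thesis by simp
  qed
  \<comment> \<open>The images of \<open>descent\<close> are nested, so these differences telescope;
    this is the disjointness of the images of \<open>vertices\<close> in terms of weights.\<close>
  have 3: "weight ((\<sigma> ^^ k) ` vertices) = weight ((\<sigma> ^^ k) ` descent) - weight ((\<sigma> ^^ Suc k) ` descent)" for k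
  proof -
    have "(\<sigma> ^^ k) ` vertices = (\<sigma> ^^ k) ` descent - (\<sigma> ^^ k) ` (\<sigma> ` descent)"
      unfolding vertices_def using descent_subset image_descent
      by (intro inj_on_image_set_diff[OF inj_pow[of k]]) auto
    also have "(\<sigma> ^^ k) ` (\<sigma> ` descent) = (\<sigma> ^^ Suc k) ` descent"
      by (simp add: funpow_swap1 image_comp)
    finally show ?thesis
      using weight_Diff[OF funpow_image_descent[of k]] image_mono[OF descent_subset, of "\<sigma> ^^ k"] image_pow[of k]
      by metis
  qed
  have "real K * (\<Sum>x\<in>?V. f (nat (level x))) = (\<Sum>k<K. (\<Sum>x\<in>?V. f (nat (level x))))" by simp
  also have "\<dots> \<le> (\<Sum>k<K. 2 * weight ((\<sigma> ^^ k) ` vertices))" using 2 by (intro sum_mono) auto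
  also have "\<dots> = 2 * (weight descent - weight ((\<sigma> ^^ K) ` descent))"
    unfolding 3 sum_distrib_left[symmetric]
    using sum_lessThan_telescope'[of "\<lambda>k. weight ((\<sigma> ^^ k) ` descent)" K] by simp
  also have "\<dots> \<le> 2 * weight X"
  proof -
    have "0 \<le> weight ((\<sigma> ^^ K) ` descent)" unfolding weight_def using f_nonneg by (intro sum_nonneg) auto
    then show ?thesis using weight_mono[OF descent_subset] by simp
  qed
  finally have "real K * (\<Sum>x\<in>?V. f (nat (level x))) \<le> 2 * weight X" .
  moreover have "real K * (weight vertices - f (M + c) * real (card {x \<in> X. 0 \<le> level x}))
      \<le> real K * (\<Sum>x\<in>?V. f (nat (level x)))"
    using 1 by (intro mult_left_mono) auto
  ultimately show ?thesis by linarith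
qed

end

(* The size of the t-quotient of a partition of n with core x. It makes sense on core_set,
   where the division is exact; it is negative if the core is larger than n. *)
definition core_level :: "nat \<Rightarrow> nat \<Rightarrow> (nat \<Rightarrow> int) \<Rightarrow> int" where
  "core_level t n x = (2 * int n - core_form t x) div (2 * int t)"

definition core_set :: "nat \<Rightarrow> nat \<Rightarrow> (nat \<Rightarrow> int) set" where
  "core_set t n = {x \<in> core_lattice t. 2 * int t dvd 2 * int n - core_form t x}"

text \<open>The step is \<open>t\<close> in both coordinates, so that \<open>core_form\<close>
  changes by a multiple of \<open>2 * t\<close> and \<open>core_set\<close> is preserved.\<close>

definition core_shift :: "nat \<Rightarrow> nat \<Rightarrow> (nat \<Rightarrow> int) \<Rightarrow> nat \<Rightarrow> int" where
  "core_shift t j x = x(j := x j + int t, 0 := x 0 - int t)"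

text \<open>Agrees with \<open>level_shift.weight\<close>, but does not refer to a direction
  \<open>j\<close>, so that shifts in different directions can be combined.\<close>

definition core_weight :: "nat \<Rightarrow> nat \<Rightarrow> (nat \<Rightarrow> int) set \<Rightarrow> real" where
  "core_weight t n C = (\<Sum>x\<in>{x \<in> C. 0 \<le> core_level t n x}. real (multipartitions t (nat (core_level t n x))))"

text \<open>The drop of the level under \<open>core_shift t j\<close>.\<close>

definition slope :: "nat \<Rightarrow> nat \<Rightarrow> (nat \<Rightarrow> int) \<Rightarrow> int" where
  "slope t j x = int t * (x j - x 0) + (int t)\<^sup>2 + int j"

lemma sum_fun_upd2:
  fixes F :: "'i \<Rightarrow> 'b \<Rightarrow> 'c :: ab_group_add"
  assumes "finite A" "i \<in> A" "j \<in> A" "i \<noteq> j"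
  shows "(\<Sum>k\<in>A. F k ((x(j := a, i := b)) k)) = (\<Sum>k\<in>A. F k (x k)) + (F j a - F j (x j)) + (F i b - F i (x i))"
proof -
  have "(\<Sum>k\<in>A - {i} - {j}. F k ((x(j := a, i := b)) k)) = (\<Sum>k\<in>A - {i} - {j}. F k (x k))"
    by (intro sum.cong) auto
  then show ?thesis
    using assms by (simp add: sum.remove[of A i] sum.remove[of "A - {i}" j])
qed

lemma core_form_shift:
  assumes "0 < j" "j < t"
  shows "core_form t (core_shift t j x) = core_form t x + 2 * int t * slope t j x"
proof -
  have s1: "(\<Sum>i<t. (core_shift t j x i)\<^sup>2) =
      (\<Sum>i<t. (x i)\<^sup>2) + ((x j + int t)\<^sup>2 - (x j)\<^sup>2) + ((x 0 - int t)\<^sup>2 - (x 0)\<^sup>2)"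
    unfolding core_shift_def by (rule sum_fun_upd2[where F = "\<lambda>_ y. y\<^sup>2"]) (use assms in auto)
  have s2: "(\<Sum>i<t. int i * core_shift t j x i) =
      (\<Sum>i<t. int i * x i) + (int j * (x j + int t) - int j * x j) + (int 0 * (x 0 - int t) - int 0 * x 0)"
    unfolding core_shift_def by (rule sum_fun_upd2[where F = "\<lambda>i y. int i * y"]) (use assms in auto)
  show ?thesis
    unfolding core_form_def s1 s2 slope_def by (simp add: algebra_simps power2_eq_square)
qed

lemma core_level_shift:
  assumes "0 < j" "j < t"
  shows "core_level t n (core_shift t j x) = core_level t n x - slope t j x"
proof -
  have "2 * int n - core_form t (core_shift t j x) = (2 * int n - core_form t x) + (- slope t j x) * (2 * int t)"
    using core_form_shift[OF assms, of x] by simp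
  then have "core_level t n (core_shift t j x) = - slope t j x + core_level t n x"
    unfolding core_level_def using assms by (simp only: div_mult_self1)
  then show ?thesis by simp
qed

text \<open>The constant second difference. Its sign gives the concavity, and its size bounds the
  loss of level over a number of steps.\<close>

lemma slope_shift:
  assumes "0 < j" "j < t"
  shows "slope t j (core_shift t j x) = slope t j x + 2 * (int t)\<^sup>2"
  using assms by (simp add: slope_def core_shift_def algebra_simps power2_eq_square)

lemma core_shift_in_core_lattice:
  assumes "0 < j" "j < t"
  shows "core_shift t j x \<in> core_lattice t \<longleftrightarrow> x \<in> core_lattice t"
proof -
  have "(\<Sum>i<t. core_shift t j x i) = (\<Sum>i<t. x i)"
    using assms sum_fun_upd2[of "{..<t}" 0 j "\<lambda>_ y. y" x "x j + int t" "x 0 - int t"]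
    by (simp add: core_shift_def)
  moreover have "core_shift t j x \<in> extensional {..<t} \<longleftrightarrow> x \<in> extensional {..<t}"
    using assms by (auto simp: core_shift_def extensional_def)
  ultimately show ?thesis by (simp add: core_lattice_def PiE_iff)
qed

lemma core_shift_in_core_set:
  assumes "0 < j" "j < t"
  shows "core_shift t j x \<in> core_set t n \<longleftrightarrow> x \<in> core_set t n"
proof -
  have "2 * int n - core_form t (core_shift t j x) = 2 * int n - core_form t x - 2 * int t * slope t j x"
    using core_form_shift[OF assms, of x] by simp
  then show ?thesis
    using core_shift_in_core_lattice[OF assms, of x]
    by (simp only: core_set_def mem_Collect_eq dvd_diff_left_iff[OF dvd_triv_left])
qed

lemma core_shift_inverse:
  assumes "0 < j"
  shows "core_shift t j (x(j := x j - int t, 0 := x 0 + int t)) = x"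
    "(core_shift t j x)(j := core_shift t j x j - int t, 0 := core_shift t j x 0 + int t) = x"
  using assms by (auto simp: core_shift_def fun_eq_iff)

lemma bij_core_shift:
  assumes "0 < j" "j < t"
  shows "bij_betw (core_shift t j) (core_set t n) (core_set t n)"
proof (rule bij_betw_byWitness[where f' = "\<lambda>x. x(j := x j - int t, 0 := x 0 + int t)"])
  show "(\<lambda>x. x(j := x j - int t, 0 := x 0 + int t)) ` core_set t n \<subseteq> core_set t n"
    using core_shift_in_core_set[OF assms] core_shift_inverse(1)[OF assms(1), of t]
    by (metis (no_types, lifting) image_subsetI)
qed (use core_shift_in_core_set[OF assms] core_shift_inverse[OF assms(1)] in auto)

lemma core_set_nonneg_level:
  assumes "0 < t"
  shows "{x \<in> core_set t n. 0 \<le> core_level t n x} \<subseteq> {x \<in> core_lattice t. core_form t x \<le> 2 * int n}"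
proof clarify
  fix x assume x: "x \<in> core_set t n" "0 \<le> core_level t n x"
  then have "0 \<le> 2 * int n - core_form t x"
    using assms by (simp add: core_level_def pos_imp_zdiv_nonneg_iff)
  then show "x \<in> core_lattice t \<and> core_form t x \<le> 2 * int n" using x by (simp add: core_set_def)
qed

lemma level_shift_core:
  assumes "0 < j" "j < t"
  shows "level_shift (core_set t n) (core_shift t j) (core_level t n) (\<lambda>m. real (multipartitions t m))"
proof
  have t: "0 < t" using assms by simp
  show "bij_betw (core_shift t j) (core_set t n) (core_set t n)" by (rule bij_core_shift[OF assms])
  show "finite {x \<in> core_set t n. 0 \<le> core_level t n x}"
    using finite_subset[OF core_set_nonneg_level[OF t] finite_core_lattice_bounded] .
  show "mono (\<lambda>m. real (multipartitions t m))"
    using subexponential_multipartitions[OF t] by (simp add: subexponential_def)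
  show "core_level t n (core_shift t j (core_shift t j x)) \<le> core_level t n (core_shift t j x)"
    if "core_level t n (core_shift t j x) \<le> core_level t n x" for x
    using that zero_le_power2[of "int t"]
    unfolding core_level_shift[OF assms] slope_shift[OF assms] by linarith
qed simp

text \<open>Both sides are grouped by the value \<open>m\<close> of the level, and each group is an
  instance of the core-quotient decomposition. Later \<open>P\<close> is a congruence modulo
  \<open>b\<close>, or constantly true for the total weight.\<close>

lemma core_weight_level:
  assumes t: "0 < t"
  shows "core_weight t n {x \<in> core_set t n. P (core_level t n x)} =
    real (card {xs \<in> partitions n. P (int (size (t_hooks t xs)))})"
proof -
  let ?S1 = "{xs \<in> partitions n. P (int (size (t_hooks t xs)))}"
  let ?S2 = "{x \<in> core_set t n. 0 \<le> core_level t n x \<and> P (core_level t n x)}"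
  let ?T = "(\<lambda>xs. size (t_hooks t xs)) ` ?S1 \<union> (\<lambda>x. nat (core_level t n x)) ` ?S2"
  have fin1: "finite ?S1" using finite_partitions by simp
  have "finite {x \<in> core_set t n. 0 \<le> core_level t n x}"
    using finite_subset[OF core_set_nonneg_level[OF t] finite_core_lattice_bounded] .
  then have fin2: "finite ?S2" by (rule rev_finite_subset) auto
  have eq: "(\<Sum>xs\<in>{xs \<in> ?S1. size (t_hooks t xs) = m}. 1 :: real) =
      (\<Sum>x\<in>{x \<in> ?S2. nat (core_level t n x) = m}. real (multipartitions t (nat (core_level t n x))))" for m
  proof (cases "P (int m)")
    case True
    have s1: "{xs \<in> ?S1. size (t_hooks t xs) = m} = {xs \<in> partitions n. size (t_hooks t xs) = m}"
      using True by auto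
    have s2: "{x \<in> ?S2. nat (core_level t n x) = m} = {x \<in> core_lattice t. core_form t x = 2 * int n - 2 * int t * int m}"
    proof (intro equalityI subsetI)
      fix x assume "x \<in> {x \<in> ?S2. nat (core_level t n x) = m}"
      then have x: "x \<in> core_set t n" "core_level t n x = int m" by auto
      then have "2 * int n - core_form t x = 2 * int t * int m"
        using dvd_mult_div_cancel[of "2 * int t" "2 * int n - core_form t x"]
        by (simp only: core_set_def core_level_def mem_Collect_eq)
      then show "x \<in> {x \<in> core_lattice t. core_form t x = 2 * int n - 2 * int t * int m}"
        using x by (simp add: core_set_def)
    next
      fix x assume x: "x \<in> {x \<in> core_lattice t. core_form t x = 2 * int n - 2 * int t * int m}"
      then have e: "2 * int n - core_form t x = 2 * int t * int m" by simp
      then have "core_level t n x = int m" unfolding core_level_def e using t by simp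
      moreover have "x \<in> core_set t n" using x unfolding core_set_def by (simp add: e)
      ultimately show "x \<in> {x \<in> ?S2. nat (core_level t n x) = m}" using True by simp
    qed
    have "(\<Sum>x\<in>{x \<in> ?S2. nat (core_level t n x) = m}. real (multipartitions t (nat (core_level t n x)))) =
        (\<Sum>x\<in>{x \<in> ?S2. nat (core_level t n x) = m}. real (multipartitions t m))"
      by (intro sum.cong) auto
    then show ?thesis
      unfolding s1 s2 using card_partitions_hooks_eq_core_lattice[OF t, of n m] by simp
  next
    case False
    then have "{xs \<in> ?S1. size (t_hooks t xs) = m} = {}" "{x \<in> ?S2. nat (core_level t n x) = m} = {}" by auto
    then show ?thesis by (simp only: sum.empty)
  qed
  have "real (card ?S1) = (\<Sum>xs\<in>?S1. 1)" by simp
  also have "\<dots> = (\<Sum>m\<in>?T. \<Sum>xs\<in>{xs \<in> ?S1. size (t_hooks t xs) = m}. 1)"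
    using fin1 fin2 by (intro sum.group[symmetric]) auto
  also have "\<dots> = (\<Sum>m\<in>?T. \<Sum>x\<in>{x \<in> ?S2. nat (core_level t n x) = m}. real (multipartitions t (nat (core_level t n x))))"
    by (intro sum.cong refl eq)
  also have "\<dots> = (\<Sum>x\<in>?S2. real (multipartitions t (nat (core_level t n x))))"
    using fin1 fin2 by (intro sum.group) auto
  also have "\<dots> = core_weight t n {x \<in> core_set t n. P (core_level t n x)}"
    unfolding core_weight_def by (intro sum.cong) auto
  finally show ?thesis by simp
qed

lemma core_weight_core_set: "0 < t \<Longrightarrow> core_weight t n (core_set t n) = real (num_partitions n)"
  using core_weight_level[of t n "\<lambda>_. True"] by (simp add: num_partitions_def)

text \<open>The set \<open>C\<close> is quantified inside the eventuality, because it will vary with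
  \<open>n\<close>.\<close>

lemma core_weight_shift_small:
  assumes e: "0 < e"
  shows "\<forall>\<^sub>F n in sequentially. \<forall>j C. 0 < j \<longrightarrow> j < t \<longrightarrow> C \<subseteq> core_set t n \<longrightarrow>
    \<bar>core_weight t n C - core_weight t n (core_shift t j ` C)\<bar> \<le> e * real (num_partitions n)"
proof (cases "0 < t")
  case t: True
  define f where "f = (\<lambda>m. real (multipartitions t m))"
  obtain K :: nat where "4 / e < real K" using reals_Archimedean2 by blast
  moreover have "0 < 4 / e" using e by simp
  ultimately have K: "4 < e * real K" and K0: "0 < real K"
    using e by (simp add: pos_divide_less_eq mult.commute, linarith)
  \<comment> \<open>From a vertex the slope stays below \<open>2 * t\<^sup>2 * K\<close> during the
    first \<open>K\<close> steps, so fewer than \<open>K\<close> steps lower the level by at most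
    \<open>c\<close>.\<close>
  define c where "c = K * (2 * t\<^sup>2 * K)"
  obtain M where M: "\<And>m. m \<ge> M \<Longrightarrow> f (m + c) \<le> 2 * f m"
    using subexponential_le_twice[OF subexponential_multipartitions[OF t], of c]
    by (auto simp: eventually_sequentially f_def)
  \<comment> \<open>For \<open>n \<ge> 1\<close>, the side length
    \<open>2 * (2 * t * n + t ^ 3 + t) + 1\<close> of the box that contains the lattice points is at
    most \<open>(6 * t + 2 * t ^ 3 + 1) * n\<close>.\<close>
  define D where "D = f (M + c) * real (6 * t + 2 * t ^ 3 + 1) ^ t"
  have "(\<lambda>n. D * (real n ^ t / real (num_partitions n))) \<longlonglongrightarrow> 0"
    using tendsto_mult_right_zero[OF polynomial_over_num_partitions] .
  from order_tendstoD(2)[OF this, of "e / 2"] e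
  have "\<forall>\<^sub>F n in sequentially. D * (real n ^ t / real (num_partitions n)) < e / 2" by simp
  moreover have "\<forall>\<^sub>F n :: nat in sequentially. 1 \<le> n" by (rule eventually_ge_at_top)
  ultimately show ?thesis
  proof (eventually_elim, intro allI impI)
    fix n j C
    assume n: "D * (real n ^ t / real (num_partitions n)) < e / 2" "1 \<le> n"
      and j: "0 < j" "j < t" and C: "C \<subseteq> core_set t n"
    interpret level_shift "core_set t n" "core_shift t j" "core_level t n" f
      unfolding f_def by (rule level_shift_core[OF j])
    have weight: "weight = core_weight t n"
      by (intro ext) (simp only: weight_def core_weight_def, simp only: f_def)
    have pow: "core_level t n x - int (k * (2 * t\<^sup>2 * K)) \<le> core_level t n ((core_shift t j ^^ k) x) \<and>
        slope t j ((core_shift t j ^^ k) x) = slope t j x + int k * (2 * (int t)\<^sup>2)"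
      if "slope t j x < 2 * (int t)\<^sup>2" "k \<le> K" for x k
      using that(2)
    proof (induction k)
      case (Suc k)
      then have "int (Suc k) * (2 * (int t)\<^sup>2) \<le> int K * (2 * (int t)\<^sup>2)"
        by (intro mult_right_mono) (auto simp: of_nat_le_iff[symmetric] simp del: of_nat_le_iff)
      then show ?case using Suc that(1)
        by (simp add: core_level_shift[OF j] slope_shift[OF j] algebra_simps)
    qed simp
    \<comment> \<open>At the predecessor of a vertex the level still rises, so the slope there is
      negative.\<close>
    have slope: "slope t j x < 2 * (int t)\<^sup>2" if x: "x \<in> vertices" for x
    proof -
      have "x \<in> core_set t n" using x descent_subset by (auto simp: vertices_def)
      then obtain y where y: "y \<in> core_set t n" "x = core_shift t j y" using image by auto
      then have "y \<notin> descent" using x by (auto simp: vertices_def)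
      then have "slope t j y < 0" using y by (auto simp: descent_def core_level_shift[OF j])
      then show ?thesis using y slope_shift[OF j, of y] by simp
    qed
    have near: "core_level t n x - int c \<le> core_level t n ((core_shift t j ^^ k) x)"
      if "x \<in> vertices" "k < K" for x k
    proof -
      have "k * (2 * t\<^sup>2 * K) \<le> c" unfolding c_def using that by (intro mult_right_mono) auto
      then have "int (k * (2 * t\<^sup>2 * K)) \<le> int c" by (simp only: of_nat_le_iff)
      then show ?thesis using pow[OF slope[OF that(1)], of k] that by linarith
    qed
    let ?card = "card {x \<in> core_set t n. 0 \<le> core_level t n x}"
    have le: "real K * (weight vertices - f (M + c) * real ?card) \<le> 2 * real (num_partitions n)"
      using weight_vertices_le[OF near M] core_weight_core_set[OF t, of n] by (simp add: weight)
    have p: "0 < real (num_partitions n)" using num_partitions_pos by simp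
    have "weight vertices - f (M + c) * real ?card \<le> (e / 2) * real (num_partitions n)"
    proof -
      have "2 * real (num_partitions n) \<le> real K * ((e / 2) * real (num_partitions n))"
        using mult_right_mono[OF less_imp_le[OF K], of "real (num_partitions n)"] by (simp add: mult_ac)
      then have "real K * (weight vertices - f (M + c) * real ?card) \<le> real K * ((e / 2) * real (num_partitions n))"
        using le by linarith
      then show ?thesis using K0 by (simp only: mult_le_cancel_left_pos)
    qed
    moreover have "f (M + c) * real ?card \<le> (e / 2) * real (num_partitions n)"
    proof -
      have "?card \<le> card {x \<in> core_lattice t. core_form t x \<le> 2 * int n}"
        by (intro card_mono finite_core_lattice_bounded core_set_nonneg_level[OF t])
      also have "\<dots> \<le> (2 * (2 * t * n + t ^ 3 + t) + 1) ^ t" by (rule card_core_lattice_bounded)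
      also have "\<dots> \<le> ((6 * t + 2 * t ^ 3 + 1) * n) ^ t"
      proof (rule power_mono)
        have "(2 * t ^ 3 + 2 * t + 1) * 1 \<le> (2 * t ^ 3 + 2 * t + 1) * n" using n by (intro mult_left_mono) auto
        then show "2 * (2 * t * n + t ^ 3 + t) + 1 \<le> (6 * t + 2 * t ^ 3 + 1) * n" by (simp add: algebra_simps)
      qed simp
      finally have "real ?card \<le> real (((6 * t + 2 * t ^ 3 + 1) * n) ^ t)" by (simp only: of_nat_le_iff)
      also have "\<dots> = real (6 * t + 2 * t ^ 3 + 1) ^ t * real n ^ t" by (simp only: of_nat_power of_nat_mult power_mult_distrib)
      finally have "f (M + c) * real ?card \<le> f (M + c) * (real (6 * t + 2 * t ^ 3 + 1) ^ t * real n ^ t)"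
        by (intro mult_left_mono f_nonneg)
      also have "\<dots> = D * real n ^ t" by (simp only: D_def mult.assoc)
      also have "\<dots> \<le> (e / 2) * real (num_partitions n)"
        using n(1) p by (simp add: pos_divide_less_eq)
      finally show ?thesis .
    qed
    ultimately have "weight vertices \<le> e * real (num_partitions n)" by simp
    then show "\<bar>core_weight t n C - core_weight t n (core_shift t j ` C)\<bar> \<le> e * real (num_partitions n)"
      using weight_shift_diff[OF C] by (simp add: weight)
  qed
qed simp

section \<open>Quadratic congruences\<close>

text \<open>Second supplementary law by Gauss's lemma. The doubles of 1, ...,
  \<open>(b - 1) / 2\<close> are already reduced modulo \<open>b\<close>, so it suffices to count
  those that exceed \<open>(b - 1) / 2\<close>.\<close>

lemma Legendre_two:
  assumes "prime b" "odd b"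
  shows "Legendre 2 (int b) = (-1) ^ ((b + 1) div 4)"
proof -
  have "2 < b" using assms prime_ge_2_nat[of b] by (cases "b = 2") auto
  then have "\<not> int b dvd 2" using zdvd_imp_le[of "int b" 2] by auto
  with assms \<open>2 < b\<close> interpret GAUSS b 2
    by unfold_locales (auto simp: cong_0_iff)
  have "C = (\<lambda>x. x * 2) ` A"
    unfolding C_def B_def image_image by (intro image_cong) (auto simp: A_def)
  then have "E = (\<lambda>x. x * 2) ` {x \<in> A. (int b - 1) div 2 < x * 2}"
    by (auto simp: E_def)
  also have "{x \<in> A. (int b - 1) div 2 < x * 2} = {(int b - 1) div 4 <.. (int b - 1) div 2}"
    by (auto simp: A_def)
  finally have "card E = card {(int b - 1) div 4 <.. (int b - 1) div 2}"
    by (simp add: card_image inj_on_def)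
  also have "\<dots> = (b + 1) div 4"
  proof -
    have "b = 4 * (b div 4) + 1 \<or> b = 4 * (b div 4) + 3" using assms(2) by presburger
    then show ?thesis
    proof
      assume b: "b = 4 * (b div 4) + 1"
      show ?thesis by (subst (1 2 3) b) (simp add: nat_diff_distrib)
    next
      assume b: "b = 4 * (b div 4) + 3"
      show ?thesis by (subst (1 2 3) b) simp
    qed
  qed
  finally show ?thesis using gauss_lemma by simp
qed

section \<open>Character sums modulo an odd prime\<close>

locale odd_prime_modulus =
  fixes b :: nat
  assumes prime_b: "prime b" and odd_b: "odd b"
begin

abbreviation "B \<equiv> int b"
abbreviation "R \<equiv> {0..<int b}"
abbreviation "\<chi> a \<equiv> Legendre a (int b)"

text \<open>Functions on the residue field, kept as functions on the integers and summed over
  \<open>R\<close>.\<close>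

definition periodic :: "(int \<Rightarrow> int) \<Rightarrow> bool" where
  "periodic g \<longleftrightarrow> (\<forall>x y. [x = y] (mod B) \<longrightarrow> g x = g y)"

text \<open>The sum of the nontrivial additive characters modulo \<open>b\<close>, evaluated at
  \<open>c\<close>. It is the indicator that occurs in the constant.\<close>

definition \<nu> :: "int \<Rightarrow> int" where
  "\<nu> c = (if [c = 0] (mod B) then B - 1 else - 1)"

lemma b_gt_2: "2 < b"
  using prime_b odd_b prime_ge_2_nat[of b] by (cases "b = 2") auto

lemma prime_B: "prime B"
  using prime_b by simp

lemma B_not_dvd_2: "\<not> B dvd 2"
  using zdvd_imp_le[of B 2] b_gt_2 by auto

lemma B_dvd_mult: "B dvd x * y \<longleftrightarrow> B dvd x \<or> B dvd y"
  using prime_B by (rule prime_dvd_mult_iff)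

lemma mod_B_in_R [simp]: "x mod B \<in> R"
  using b_gt_2 by simp

lemma periodicD: "periodic g \<Longrightarrow> [x = y] (mod B) \<Longrightarrow> g x = g y"
  by (simp add: periodic_def)

lemma periodic_mod: "periodic g \<Longrightarrow> g (x mod B) = g x"
  by (rule periodicD) auto

lemma \<chi>_cong: "[x = y] (mod B) \<Longrightarrow> \<chi> x = \<chi> y"
  by (simp add: Legendre_def QuadRes_def unique_euclidean_semiring_class.cong_def)

lemma \<nu>_cong: "[x = y] (mod B) \<Longrightarrow> \<nu> x = \<nu> y"
  unfolding \<nu>_def by (meson cong_sym cong_trans)

text \<open>The values -1, 0, 1 are incongruent modulo \<open>b\<close>, as \<open>b\<close> exceeds
  2. This turns Euler's criterion into equations.\<close>

lemma \<chi>_eq_of_cong: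
  assumes "[x = y] (mod B)" "x \<in> {-1, 0, 1}" "y \<in> {-1, 0, 1}"
  shows "x = y"
proof -
  have "B dvd x - y" using assms(1) by (simp add: cong_iff_dvd_diff)
  moreover have "\<bar>x - y\<bar> < B" using assms(2,3) b_gt_2 by auto
  ultimately show ?thesis by (metis dvd_imp_le_int eq_iff_diff_eq_0 linorder_not_less abs_of_nat)
qed

lemma \<chi>_range: "\<chi> x \<in> {-1, 0, 1}"
  by (simp add: Legendre_def)

lemma \<chi>_mult: "\<chi> (x * y) = \<chi> x * \<chi> y"
proof (rule \<chi>_eq_of_cong)
  have "[\<chi> (x * y) = (x * y) ^ ((b - 1) div 2)] (mod B)"
    by (rule euler_criterion[OF prime_b b_gt_2])
  moreover have "[\<chi> x * \<chi> y = x ^ ((b - 1) div 2) * y ^ ((b - 1) div 2)] (mod B)"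
    by (intro cong_mult euler_criterion[OF prime_b b_gt_2])
  ultimately show "[\<chi> (x * y) = \<chi> x * \<chi> y] (mod B)"
    by (metis cong_sym cong_trans power_mult_distrib)
  show "\<chi> x * \<chi> y \<in> {-1, 0, 1}" using \<chi>_range[of x] \<chi>_range[of y] by auto
qed (rule \<chi>_range)

lemma \<chi>_square: "\<not> B dvd x \<Longrightarrow> \<chi> x * \<chi> x = 1"
  by (auto simp: Legendre_def cong_0_iff)

lemma \<chi>_minus_one: "\<chi> (-1) = (-1) ^ ((b - 1) div 2)"
proof (rule \<chi>_eq_of_cong)
  show "[\<chi> (- 1) = (- 1) ^ ((b - 1) div 2)] (mod B)"
    by (rule euler_criterion[OF prime_b b_gt_2])
  show "(- 1) ^ ((b - 1) div 2) \<in> {- 1, 0, 1 :: int}" by (simp add: minus_one_power_iff)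
qed (rule \<chi>_range)

lemma \<chi>_uminus: "\<chi> (- x) = \<chi> (-1) * \<chi> x"
  using \<chi>_mult[of "-1" x] by simp

lemma sum_affine:
  assumes g: "periodic g" and a: "\<not> B dvd a"
  shows "(\<Sum>x\<in>R. g (a * x + c)) = (\<Sum>x\<in>R. g x)"
proof -
  let ?f = "\<lambda>x. (a * x + c) mod B"
  have "inj_on ?f R"
  proof (rule inj_onI)
    fix x y assume xy: "x \<in> R" "y \<in> R" "?f x = ?f y"
    then have "B dvd (a * x + c) - (a * y + c)" by (simp add: mod_eq_dvd_iff)
    then have "B dvd a * (x - y)" by (simp add: algebra_simps)
    then have "[x = y] (mod B)" using a B_dvd_mult by (simp add: cong_iff_dvd_diff)
    then show "x = y" using xy by (simp add: unique_euclidean_semiring_class.cong_def)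
  qed
  moreover have "?f ` R \<subseteq> R" using mod_B_in_R by blast
  ultimately have "bij_betw ?f R R" by (simp add: bij_betw_def endo_inj_surj)
  then have "(\<Sum>x\<in>R. g (?f x)) = (\<Sum>x\<in>R. g x)" by (rule sum.reindex_bij_betw)
  then show ?thesis using periodic_mod[OF g] by simp
qed

lemma card_square_roots: "int (card {z \<in> R. [z\<^sup>2 = w] (mod B)}) = 1 + \<chi> w"
proof (cases "[w = 0] (mod B)")
  case True
  have "[z\<^sup>2 = w] (mod B) \<longleftrightarrow> z = 0" if "z \<in> R" for z
  proof -
    have "[z\<^sup>2 = w] (mod B) \<longleftrightarrow> [z\<^sup>2 = 0] (mod B)" using True by (meson cong_sym cong_trans)
    also have "\<dots> \<longleftrightarrow> B dvd z" using B_dvd_mult by (simp add: cong_0_iff power2_eq_square)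
    also have "\<dots> \<longleftrightarrow> z = 0" using that by (auto dest: zdvd_imp_le)
    finally show ?thesis .
  qed
  then have "{z \<in> R. [z\<^sup>2 = w] (mod B)} = {0}" using b_gt_2 True cong_sym by auto
  then show ?thesis using True by (simp add: Legendre_def)
next
  case w: False
  show ?thesis
  proof (cases "QuadRes B w")
    case True
    then obtain y where y: "[y\<^sup>2 = w] (mod B)" by (auto simp: QuadRes_def)
    have ny: "\<not> B dvd y"
      using w y by (metis cong_0_iff cong_sym cong_trans dvd_mult power2_eq_square)
    have "[z\<^sup>2 = w] (mod B) \<longleftrightarrow> z = y mod B \<or> z = (- y) mod B" if z: "z \<in> R" for z
    proof -
      have "[z\<^sup>2 = w] (mod B) \<longleftrightarrow> [z\<^sup>2 = y\<^sup>2] (mod B)" using y by (meson cong_sym cong_trans)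
      also have "\<dots> \<longleftrightarrow> B dvd (z - y) * (z + y)"
        by (simp add: cong_iff_dvd_diff power2_eq_square algebra_simps)
      also have "\<dots> \<longleftrightarrow> [z = y] (mod B) \<or> [z = - y] (mod B)"
        by (simp add: B_dvd_mult cong_iff_dvd_diff)
      also have "\<dots> \<longleftrightarrow> z = y mod B \<or> z = (- y) mod B" using z by (simp add: unique_euclidean_semiring_class.cong_def)
      finally show ?thesis .
    qed
    then have "{z \<in> R. [z\<^sup>2 = w] (mod B)} = {y mod B, (- y) mod B}"
      using mod_B_in_R by blast
    moreover have "y mod B \<noteq> (- y) mod B"
    proof
      assume "y mod B = (- y) mod B"
      then have "B dvd 2 * y" by (simp add: mod_eq_dvd_iff)
      then show False using ny B_not_dvd_2 B_dvd_mult by blast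
    qed
    ultimately show ?thesis using w True by (simp add: Legendre_def)
  next
    case False
    then have "{z \<in> R. [z\<^sup>2 = w] (mod B)} = {}" by (auto simp: QuadRes_def)
    then have "card {z \<in> R. [z\<^sup>2 = w] (mod B)} = 0" by (simp only: card.empty)
    then show ?thesis using w False by (simp only: Legendre_def if_False)
  qed
qed

text \<open>With \<open>u = s - h\<close> the argument is
  \<open>t * (2 * u * s - u\<^sup>2)\<close>: it vanishes for \<open>u = 0\<close>, and for every
  other residue \<open>u\<close> it runs through all residues as \<open>s\<close> does.\<close>

lemma sum_hyperbolic:
  assumes g: "periodic g" and t: "\<not> B dvd t"
  shows "(\<Sum>s\<in>R. \<Sum>h\<in>R. g (t * (s\<^sup>2 - h\<^sup>2))) = B * g 0 + (B - 1) * (\<Sum>w\<in>R. g w)"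
proof -
  have per: "periodic (\<lambda>h. g (t * (s\<^sup>2 - h\<^sup>2)))" for s
    unfolding periodic_def by (intro allI impI periodicD[OF g] cong_mult cong_diff cong_pow) auto
  have "(\<Sum>s\<in>R. \<Sum>h\<in>R. g (t * (s\<^sup>2 - h\<^sup>2))) = (\<Sum>s\<in>R. \<Sum>u\<in>R. g (t * (s\<^sup>2 - (- 1 * u + s)\<^sup>2)))"
    using b_gt_2 by (intro sum.cong refl sum_affine[OF per, symmetric]) auto
  also have "\<dots> = (\<Sum>u\<in>R. \<Sum>s\<in>R. g ((2 * t * u) * s + - t * u\<^sup>2))"
    by (subst sum.swap) (simp add: power2_eq_square algebra_simps)
  also have "\<dots> = (\<Sum>s\<in>R. g 0) + (\<Sum>u\<in>R - {0}. \<Sum>s\<in>R. g ((2 * t * u) * s + - t * u\<^sup>2))"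
    using b_gt_2 by (subst sum.remove[of _ 0]) auto
  also have "(\<Sum>u\<in>R - {0}. \<Sum>s\<in>R. g ((2 * t * u) * s + - t * u\<^sup>2)) = (\<Sum>u\<in>R - {0}. \<Sum>w\<in>R. g w)"
  proof (rule sum.cong[OF refl], rule sum_affine[OF g])
    fix u assume "u \<in> R - {0}"
    then have "\<not> B dvd u" by (auto dest: zdvd_imp_le)
    then show "\<not> B dvd 2 * t * u" using t B_not_dvd_2 by (simp add: B_dvd_mult)
  qed
  also have "\<dots> = (B - 1) * (\<Sum>w\<in>R. g w)"
    using b_gt_2 by simp
  finally show ?thesis by simp
qed

lemma sum_indicator: "(\<Sum>z\<in>R. if P z then 1 else 0 :: int) = int (card {z \<in> R. P z})"
proof -
  have "(\<Sum>z\<in>{z \<in> R. P z}. 1 :: int) = (\<Sum>z\<in>R. if P z then 1 else 0)"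
    by (rule sum.inter_filter) simp
  then show ?thesis by simp
qed

lemma \<nu>_altdef: "\<nu> c = B * (if [c = 0] (mod B) then 1 else 0) - 1"
  by (simp add: \<nu>_def)

lemma sum_\<nu>_minus_square: "(\<Sum>z\<in>R. \<nu> (c - z\<^sup>2)) = B * \<chi> c"
proof -
  have "[c - z\<^sup>2 = 0] (mod B) \<longleftrightarrow> [z\<^sup>2 = c] (mod B)" for z
    by (metis cong_diff_iff_cong_0 cong_sym)
  then have "(\<Sum>z\<in>R. \<nu> (c - z\<^sup>2)) = B * (\<Sum>z\<in>R. if [z\<^sup>2 = c] (mod B) then 1 else 0) - B"
    by (simp only: \<nu>_altdef sum_subtractf sum_distrib_left) simp
  then show ?thesis by (simp only: sum_indicator card_square_roots) (simp add: algebra_simps)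
qed

text \<open>Counts the solutions of \<open>z\<^sup>2 - y\<^sup>2 = d\<close> in two ways: for fixed
  \<open>z\<close> by \<open>card_square_roots\<close>, and all at once by
  \<open>sum_hyperbolic\<close>.\<close>

lemma sum_\<chi>_square_minus: "(\<Sum>z\<in>R. \<chi> (z\<^sup>2 - d)) = \<nu> d"
proof -
  let ?g = "\<lambda>w. if [w = d] (mod B) then 1 else 0 :: int"
  have per: "periodic ?g" unfolding periodic_def by (meson cong_sym cong_trans)
  have eq: "[1 * (z\<^sup>2 - y\<^sup>2) = d] (mod B) \<longleftrightarrow> [y\<^sup>2 = z\<^sup>2 - d] (mod B)" for z y
  proof -
    have "z\<^sup>2 - y\<^sup>2 - d = - (y\<^sup>2 - (z\<^sup>2 - d))" by simp
    then show ?thesis by (simp only: cong_iff_dvd_diff mult_1 dvd_minus_iff)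
  qed
  have "(\<Sum>z\<in>R. 1 + \<chi> (z\<^sup>2 - d)) = (\<Sum>z\<in>R. \<Sum>y\<in>R. ?g (1 * (z\<^sup>2 - y\<^sup>2)))"
    by (simp only: eq sum_indicator card_square_roots)
  also have "\<dots> = B * ?g 0 + (B - 1) * (\<Sum>w\<in>R. ?g w)"
    using b_gt_2 by (intro sum_hyperbolic[OF per]) auto
  also have "{w \<in> R. [w = d] (mod B)} = {d mod B}" using mod_B_in_R by (auto simp: unique_euclidean_semiring_class.cong_def)
  then have "(\<Sum>w\<in>R. ?g w) = 1" by (simp only: sum_indicator) simp
  finally have "B + (\<Sum>z\<in>R. \<chi> (z\<^sup>2 - d)) = B * ?g 0 + (B - 1)" by (simp add: sum.distrib)
  moreover have "[0 = d] (mod B) \<longleftrightarrow> [d = 0] (mod B)" by (rule cong_sym_eq)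
  ultimately show ?thesis by (simp add: \<nu>_def)
qed

lemma sum_\<chi>_minus_square: "(\<Sum>z\<in>R. \<chi> (c - z\<^sup>2)) = \<chi> (-1) * \<nu> c"
proof -
  have "\<chi> (c - z\<^sup>2) = \<chi> (-1) * \<chi> (z\<^sup>2 - c)" for z
    using \<chi>_uminus[of "z\<^sup>2 - c"] by simp
  then show ?thesis by (simp only: sum_distrib_left[symmetric] sum_\<chi>_square_minus)
qed

lemma \<nu>_mult: "\<not> B dvd t \<Longrightarrow> \<nu> (t * c) = \<nu> c"
  by (simp add: \<nu>_def cong_0_iff B_dvd_mult)

text \<open>Multiplication by the unit \<open>- t\<close> leaves \<open>\<nu>\<close> unchanged and
  turns the argument into \<open>- (t * c)\<close> minus the square of \<open>t * s\<close>.\<close>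

lemma sum_\<nu>_plus_square:
  assumes t: "\<not> B dvd t"
  shows "(\<Sum>s\<in>R. \<nu> (c + t * s\<^sup>2)) = B * \<chi> (- (t * c))"
proof -
  have per: "periodic (\<lambda>s. \<nu> (- (t * c) - s\<^sup>2))"
    unfolding periodic_def by (intro allI impI \<nu>_cong cong_diff cong_pow) auto
  have "\<nu> (c + t * s\<^sup>2) = \<nu> (- (t * c) - (t * s + 0)\<^sup>2)" for s
  proof -
    have "- (t * c) - (t * s + 0)\<^sup>2 = (- t) * (c + t * s\<^sup>2)" by (simp add: algebra_simps power2_eq_square)
    moreover have "\<nu> ((- t) * (c + t * s\<^sup>2)) = \<nu> (c + t * s\<^sup>2)" using t by (intro \<nu>_mult) simp
    ultimately show ?thesis by (simp only:)
  qed
  then have "(\<Sum>s\<in>R. \<nu> (c + t * s\<^sup>2)) = (\<Sum>s\<in>R. \<nu> (- (t * c) - s\<^sup>2))"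
    by (simp only: sum_affine[OF per t])
  then show ?thesis by (simp only: sum_\<nu>_minus_square)
qed

lemma sum_\<chi>_plus_square:
  assumes t: "\<not> B dvd t"
  shows "(\<Sum>s\<in>R. \<chi> (c + t * s\<^sup>2)) = \<chi> t * \<nu> c"
proof -
  have per: "periodic (\<lambda>s. \<chi> (s\<^sup>2 - - (t * c)))"
    unfolding periodic_def by (intro allI impI \<chi>_cong cong_diff cong_pow) auto
  have "\<chi> (c + t * s\<^sup>2) = \<chi> t * \<chi> ((t * s + 0)\<^sup>2 - - (t * c))" for s
  proof -
    have "(t * s + 0)\<^sup>2 - - (t * c) = t * (c + t * s\<^sup>2)" by (simp add: algebra_simps power2_eq_square)
    then show ?thesis using \<chi>_square[OF t] \<chi>_mult[of t "c + t * s\<^sup>2"]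
      by (simp add: mult.assoc[symmetric])
  qed
  then have "(\<Sum>s\<in>R. \<chi> (c + t * s\<^sup>2)) = \<chi> t * (\<Sum>s\<in>R. \<chi> (s\<^sup>2 - - (t * c)))"
    by (simp only: sum_distrib_left[symmetric] sum_affine[OF per t])
  also have "\<dots> = \<chi> t * \<nu> c"
    using \<nu>_mult[of "- t" c] t by (simp only: sum_\<chi>_square_minus) simp
  finally show ?thesis .
qed

definition square_count :: "nat \<Rightarrow> int \<Rightarrow> nat" where
  "square_count k c = card {z \<in> PiE {..<k} (\<lambda>_. R). [(\<Sum>i<k. (z i)\<^sup>2) = c] (mod B)}"

lemma finite_tuples [simp]: "finite {z \<in> PiE {..<k :: nat} (\<lambda>_. R). P z}"
proof -
  have "finite (PiE {..<k} (\<lambda>_. R))" by (intro finite_PiE) auto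
  then show ?thesis by (rule rev_finite_subset) auto
qed

lemma square_count_Suc: "square_count (Suc k) c = (\<Sum>y\<in>R. square_count k (c - y\<^sup>2))"
proof -
  let ?T = "\<lambda>k c. {z \<in> PiE {..<k} (\<lambda>_. R). [(\<Sum>i<k. (z i)\<^sup>2) = c] (mod B)}"
  let ?f = "\<lambda>(y, g). g(k := y)"
  let ?S = "SIGMA y:R. ?T k (c - y\<^sup>2)"
  have upd: "(\<Sum>i<Suc k. ((g(k := y)) i)\<^sup>2) = (\<Sum>i<k. (g i)\<^sup>2) + y\<^sup>2" for g and y :: int
    by simp
  have eq: "[x + y\<^sup>2 = c] (mod B) \<longleftrightarrow> [x = c - y\<^sup>2] (mod B)" for x y
    by (simp add: cong_iff_dvd_diff algebra_simps)
  have inj: "inj_on ?f ?S"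
    by (rule inj_on_subset[OF inj_combinator[of k "{..<k}" "\<lambda>_. R"]]) auto
  have "?f ` ?S = ?T (Suc k) c"
  proof (intro equalityI subsetI)
    fix z assume "z \<in> ?f ` ?S"
    then obtain y g where yg: "z = g(k := y)" "y \<in> R" "g \<in> PiE {..<k} (\<lambda>_. R)"
      "[(\<Sum>i<k. (g i)\<^sup>2) = c - y\<^sup>2] (mod B)" by auto
    have "z \<in> PiE {..<Suc k} (\<lambda>_. R)"
      unfolding yg(1) lessThan_Suc by (rule PiE_fun_upd[OF yg(2,3)])
    moreover have "[(\<Sum>i<Suc k. (z i)\<^sup>2) = c] (mod B)"
      unfolding yg(1) upd eq by (rule yg(4))
    ultimately show "z \<in> ?T (Suc k) c" by blast
  next
    fix z assume z: "z \<in> ?T (Suc k) c"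
    then obtain y g where yg: "z = g(k := y)" "y \<in> R" "g \<in> PiE {..<k} (\<lambda>_. R)"
      by (auto simp: lessThan_Suc PiE_insert_eq)
    then have "[(\<Sum>i<k. (g i)\<^sup>2) = c - y\<^sup>2] (mod B)" using z upd[of g y] eq by simp
    then show "z \<in> ?f ` ?S" using yg by (intro image_eqI[of _ _ "(y, g)"]) auto
  qed
  then have "card (?T (Suc k) c) = card ?S" using card_image[OF inj] by simp
  then show ?thesis by (simp add: square_count_def card_SigmaI)
qed

text \<open>Summing over one more square turns \<open>\<nu>\<close> into \<open>B * \<chi>\<close>,
  and \<open>\<chi>\<close> into \<open>\<chi> (-1) * \<nu>\<close>; hence the dependence on parity.
  The factor \<open>B\<close> on the left avoids fractions.\<close>

lemma square_count:
  "B * int (square_count k c) = B ^ k +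
     (if even k then (B * \<chi> (-1)) ^ (k div 2) * \<nu> c else B * (B * \<chi> (-1)) ^ (k div 2) * \<chi> c)"
proof (induction k arbitrary: c)
  case 0
  have "{z \<in> PiE {..<0 :: nat} (\<lambda>_. R). [(\<Sum>i<0. (z i)\<^sup>2) = c] (mod B)} = (if [c = 0] (mod B) then {\<lambda>_. undefined} else {})"
    by (auto simp: cong_sym_eq)
  then show ?case by (simp add: square_count_def \<nu>_def)
next
  case (Suc k)
  have "B * int (square_count (Suc k) c) = (\<Sum>y\<in>R. B * int (square_count k (c - y\<^sup>2)))"
    by (simp add: square_count_Suc sum_distrib_left)
  also have "\<dots> = (\<Sum>y\<in>R. B ^ k + (if even k then (B * \<chi> (-1)) ^ (k div 2) * \<nu> (c - y\<^sup>2) else B * (B * \<chi> (-1)) ^ (k div 2) * \<chi> (c - y\<^sup>2)))"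
    unfolding Suc.IH ..
  also have "\<dots> = B ^ Suc k + (if even k then (B * \<chi> (-1)) ^ (k div 2) * (\<Sum>y\<in>R. \<nu> (c - y\<^sup>2)) else B * (B * \<chi> (-1)) ^ (k div 2) * (\<Sum>y\<in>R. \<chi> (c - y\<^sup>2)))"
    by (cases "even k") (simp_all add: sum.distrib sum_distrib_left)
  also have "\<dots> = B ^ Suc k + (if even k then B * (B * \<chi> (-1)) ^ (k div 2) * \<chi> c else (B * \<chi> (-1)) ^ (Suc k div 2) * \<nu> c)"
    by (auto simp: sum_\<nu>_minus_square sum_\<chi>_minus_square elim!: oddE)
  finally show ?case by simp
qed

end

section \<open>Tuples with zero sum and prescribed sum of squares\<close>

context odd_prime_modulus begin

definition zero_sum_tuples :: "nat \<Rightarrow> (nat \<Rightarrow> int) set" where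
  "zero_sum_tuples t = {z \<in> PiE {..<t} (\<lambda>_. R). [(\<Sum>i<t. z i) = 0] (mod B)}"

definition tuple_count :: "nat \<Rightarrow> int \<Rightarrow> int \<Rightarrow> nat" where
  "tuple_count t s c = card {z \<in> PiE {..<t} (\<lambda>_. R). [(\<Sum>i<t. z i) = s] (mod B) \<and> [(\<Sum>i<t. (z i)\<^sup>2) = c] (mod B)}"

definition translate :: "nat \<Rightarrow> int \<Rightarrow> (nat \<Rightarrow> int) \<Rightarrow> nat \<Rightarrow> int" where
  "translate t h z = (\<lambda>i\<in>{..<t}. (z i + h) mod B)"

lemma bij_translate: "bij_betw (translate t h) (PiE {..<t} (\<lambda>_. R)) (PiE {..<t} (\<lambda>_. R))"
proof (rule bij_betw_byWitness[where f' = "translate t (- h)"])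
  have inv: "translate t (- k) (translate t k z) = z" if "z \<in> PiE {..<t} (\<lambda>_. R)" for k z
  proof
    fix i show "translate t (- k) (translate t k z) i = z i"
    proof (cases "i < t")
      case True
      then have "z i mod B = z i" using that by (auto simp: PiE_iff)
      then show ?thesis using True by (simp add: translate_def mod_diff_left_eq)
    next
      case False
      then show ?thesis using that by (simp add: translate_def PiE_iff extensional_def)
    qed
  qed
  then show "\<forall>z\<in>PiE {..<t} (\<lambda>_. R). translate t (- h) (translate t h z) = z" by blast
  show "\<forall>z\<in>PiE {..<t} (\<lambda>_. R). translate t h (translate t (- h) z) = z"
    using inv[of _ "- h"] by simp
  have "translate t k z \<in> PiE {..<t} (\<lambda>_. R)" for k z
    unfolding translate_def restrict_PiE_iff using mod_B_in_R by blast
  then show "translate t h ` (PiE {..<t} (\<lambda>_. R)) \<subseteq> PiE {..<t} (\<lambda>_. R)"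
    "translate t (- h) ` (PiE {..<t} (\<lambda>_. R)) \<subseteq> PiE {..<t} (\<lambda>_. R)" by blast+
qed

lemma sum_translate: "[(\<Sum>i<t. translate t h z i) = (\<Sum>i<t. z i) + int t * h] (mod B)"
proof -
  have "[(\<Sum>i<t. translate t h z i) = (\<Sum>i<t. z i + h)] (mod B)"
    by (rule cong_sum) (simp add: translate_def)
  then show ?thesis by (simp add: sum.distrib)
qed

lemma sum_squares_translate:
  "[(\<Sum>i<t. (translate t h z i)\<^sup>2) = (\<Sum>i<t. (z i)\<^sup>2) + 2 * h * (\<Sum>i<t. z i) + int t * h\<^sup>2] (mod B)"
proof -
  have "[(\<Sum>i<t. (translate t h z i)\<^sup>2) = (\<Sum>i<t. (z i + h)\<^sup>2)] (mod B)"
    by (rule cong_sum, rule cong_pow) (simp add: translate_def)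
  also have "(\<Sum>i<t. (z i + h)\<^sup>2) = (\<Sum>i<t. (z i)\<^sup>2 + 2 * h * z i + h\<^sup>2)"
    by (intro sum.cong) (auto simp: power2_eq_square algebra_simps)
  finally show ?thesis by (simp add: sum.distrib sum_distrib_left)
qed

lemma sum_translate_cong_iff:
  "[(\<Sum>i<t. translate t h z i) = int t * h] (mod B) \<longleftrightarrow> [(\<Sum>i<t. z i) = 0] (mod B)"
proof -
  have "[(\<Sum>i<t. translate t h z i) = int t * h] (mod B) \<longleftrightarrow> [(\<Sum>i<t. z i) + int t * h = int t * h] (mod B)"
    using sum_translate[of t h z] by (simp only: unique_euclidean_semiring_class.cong_def)
  also have "\<dots> \<longleftrightarrow> [(\<Sum>i<t. z i) = 0] (mod B)" by (simp add: cong_iff_dvd_diff)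
  finally show ?thesis .
qed

lemma card_sum_translate:
  "card {z \<in> PiE {..<t} (\<lambda>_. R). [(\<Sum>i<t. z i) = int t * h] (mod B)} = card (zero_sum_tuples t)"
  unfolding zero_sum_tuples_def
  by (rule bij_betw_same_card[symmetric], rule bij_betw_Collect[OF bij_translate[of t h]])
    (rule sum_translate_cong_iff)

text \<open>Modulo \<open>b\<close> the cross term \<open>2 * h * (\<Sum>i<t. z i)\<close> vanishes
  on zero-sum tuples, so adding \<open>h\<close> to all entries changes the sum of squares by
  \<open>t * h\<^sup>2\<close>.\<close>

lemma tuple_count_translate: "tuple_count t (int t * h) (c + int t * h\<^sup>2) = tuple_count t 0 c"
  unfolding tuple_count_def
proof (rule bij_betw_same_card[symmetric], rule bij_betw_Collect[OF bij_translate[of t h]])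
  fix z
  show "([(\<Sum>i<t. translate t h z i) = int t * h] (mod B) \<and> [(\<Sum>i<t. (translate t h z i)\<^sup>2) = c + int t * h\<^sup>2] (mod B)) =
    ([(\<Sum>i<t. z i) = 0] (mod B) \<and> [(\<Sum>i<t. (z i)\<^sup>2) = c] (mod B))"
    unfolding sum_translate_cong_iff
  proof (rule conj_cong[OF refl])
    assume s: "[(\<Sum>i<t. z i) = 0] (mod B)"
    have "[(\<Sum>i<t. (translate t h z i)\<^sup>2) = (\<Sum>i<t. (z i)\<^sup>2) + 2 * h * 0 + int t * h\<^sup>2] (mod B)"
      by (rule cong_trans[OF sum_squares_translate]) (intro cong_add cong_mult cong_refl s)
    then have "[(\<Sum>i<t. (translate t h z i)\<^sup>2) = c + int t * h\<^sup>2] (mod B) \<longleftrightarrow>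
        [(\<Sum>i<t. (z i)\<^sup>2) + 2 * h * 0 + int t * h\<^sup>2 = c + int t * h\<^sup>2] (mod B)"
      by (simp only: unique_euclidean_semiring_class.cong_def)
    then show "[(\<Sum>i<t. (translate t h z i)\<^sup>2) = c + int t * h\<^sup>2] (mod B) = [(\<Sum>i<t. (z i)\<^sup>2) = c] (mod B)"
      by (simp add: cong_iff_dvd_diff)
  qed
qed

lemma sum_card_residue_classes:
  assumes "finite A"
  shows "(\<Sum>s\<in>R. card {z \<in> A. [F z = s] (mod B)}) = card A"
proof -
  have "{z \<in> A. [F z = s] (mod B)} = {z \<in> A. F z mod B = s}" if "s \<in> R" for s
    using that by (auto simp: unique_euclidean_semiring_class.cong_def)
  then have "(\<Sum>s\<in>R. card {z \<in> A. [F z = s] (mod B)}) = (\<Sum>s\<in>R. \<Sum>z\<in>{z \<in> A. F z mod B = s}. 1)"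
    by (intro sum.cong refl) (simp only: card_eq_sum)
  also have "\<dots> = (\<Sum>z\<in>A. 1)"
    using assms mod_B_in_R by (intro sum.group) auto
  finally show ?thesis by simp
qed

text \<open>Adding \<open>h\<close> to all entries changes the sum by \<open>t * h\<close>, which
  reaches every residue since \<open>t\<close> is a unit. So all sums are equally frequent.\<close>

lemma card_zero_sum_tuples:
  assumes t: "\<not> b dvd t"
  shows "b * card (zero_sum_tuples t) = b ^ t"
proof -
  have t': "\<not> B dvd int t" using t by (simp add: int_dvd_int_iff)
  let ?P = "PiE {..<t} (\<lambda>_. R)"
  let ?g = "\<lambda>s. int (card {z \<in> ?P. [(\<Sum>i<t. z i) = s] (mod B)})"
  have per: "periodic ?g"
    unfolding periodic_def by (auto simp: unique_euclidean_semiring_class.cong_def)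
  have fin: "finite ?P" by (intro finite_PiE) auto
  have "B * int (card (zero_sum_tuples t)) = (\<Sum>h\<in>R. ?g (int t * h + 0))"
    by (simp add: card_sum_translate)
  also have "\<dots> = (\<Sum>s\<in>R. ?g s)" by (rule sum_affine[OF per t'])
  also have "\<dots> = int (card ?P)" using sum_card_residue_classes[OF fin, of "\<lambda>z. \<Sum>i<t. z i"]
    by (simp only: of_nat_sum[symmetric])
  also have "card ?P = b ^ t" by (simp add: card_PiE)
  finally show ?thesis by (metis of_nat_eq_iff of_nat_mult)
qed

lemma tuple_count_cong:
  "[s = s'] (mod B) \<Longrightarrow> [c = c'] (mod B) \<Longrightarrow> tuple_count t s c = tuple_count t s' c'"
  by (simp add: tuple_count_def unique_euclidean_semiring_class.cong_def)

text \<open>As \<open>t\<close> is a unit, every sum has the form \<open>t * h\<close>, and the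
  tuple is then a zero-sum tuple translated by \<open>h\<close>. This is the orthogonal splitting
  along \<open>(1, ..., 1)\<close>.\<close>

lemma square_count_eq_sum_tuple_count:
  assumes t: "\<not> b dvd t"
  shows "int (square_count t c) = (\<Sum>h\<in>R. int (tuple_count t 0 (c - int t * h\<^sup>2)))"
proof -
  have t': "\<not> B dvd int t" using t by (simp add: int_dvd_int_iff)
  let ?A = "{z \<in> PiE {..<t} (\<lambda>_. R). [(\<Sum>i<t. (z i)\<^sup>2) = c] (mod B)}"
  have per: "periodic (\<lambda>s. int (tuple_count t s c))"
    unfolding periodic_def by (auto intro: tuple_count_cong)
  have "(\<Sum>h\<in>R. int (tuple_count t 0 (c - int t * h\<^sup>2))) = (\<Sum>h\<in>R. int (tuple_count t (int t * h + 0) c))"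
  proof (intro sum.cong refl)
    fix h show "int (tuple_count t 0 (c - int t * h\<^sup>2)) = int (tuple_count t (int t * h + 0) c)"
      using tuple_count_translate[of t h "c - int t * h\<^sup>2"] by simp
  qed
  also have "\<dots> = (\<Sum>s\<in>R. int (tuple_count t s c))" by (rule sum_affine[OF per t'])
  also have "\<dots> = int (\<Sum>s\<in>R. card {z \<in> ?A. [(\<Sum>i<t. z i) = s] (mod B)})"
    unfolding of_nat_sum tuple_count_def by (intro sum.cong refl arg_cong[of _ _ int] arg_cong[of _ _ card]) auto
  also have "\<dots> = int (square_count t c)"
    using sum_card_residue_classes[of ?A] by (simp add: square_count_def)
  finally show ?thesis by simp
qed

(* The zero-sum tuples carry the form x_1^2 + ... + x_t^2 without the direction (1, ..., 1).
   Adding both this direction and the negative of its form amounts to adding a hyperbolic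
   plane, which changes the counts in a way that can be undone. *)
lemma tuple_count_zero_sum:
  assumes t: "\<not> b dvd t"
  shows "B\<^sup>2 * int (tuple_count t 0 c) = B ^ t +
    (if even t then B * (B * \<chi> (-1)) ^ (t div 2) * \<chi> (- (int t * c))
     else B * (B * \<chi> (-1)) ^ (t div 2) * \<chi> (int t) * \<nu> c)"
proof -
  have t': "\<not> B dvd int t" using t by (simp add: int_dvd_int_iff)
  let ?N = "\<lambda>w. int (tuple_count t 0 (c + w))"
  have per: "periodic ?N"
    unfolding periodic_def by (auto intro!: tuple_count_cong cong_add)
  have per': "periodic (\<lambda>w. int (tuple_count t 0 w))"
    unfolding periodic_def by (auto intro!: tuple_count_cong)
  have "(\<Sum>w\<in>R. ?N w) = (\<Sum>w\<in>R. int (tuple_count t 0 w))"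
    using sum_affine[OF per', of 1 c] b_gt_2 by (simp add: add.commute)
  also have "\<dots> = int (\<Sum>w\<in>R. card {z \<in> zero_sum_tuples t. [(\<Sum>i<t. (z i)\<^sup>2) = w] (mod B)})"
    unfolding of_nat_sum tuple_count_def zero_sum_tuples_def
    by (intro sum.cong refl arg_cong[of _ _ int] arg_cong[of _ _ card]) auto
  also have "\<dots> = int (card (zero_sum_tuples t))"
    using sum_card_residue_classes[of "zero_sum_tuples t"] by (simp add: zero_sum_tuples_def)
  finally have total: "B * (\<Sum>w\<in>R. ?N w) = B ^ t"
    using card_zero_sum_tuples[OF t] by (metis of_nat_mult of_nat_power)
  \<comment> \<open>\<open>square_count\<close> supplies the variable \<open>h\<close> in the
    direction \<open>(1, ..., 1)\<close>, and the sum over \<open>s\<close> supplies the opposite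
    form.\<close>
  have "(\<Sum>s\<in>R. int (square_count t (c + int t * s\<^sup>2))) = (\<Sum>s\<in>R. \<Sum>h\<in>R. ?N (int t * (s\<^sup>2 - h\<^sup>2)))"
    by (simp add: square_count_eq_sum_tuple_count[OF t] algebra_simps)
  also have "\<dots> = B * ?N 0 + (B - 1) * (\<Sum>w\<in>R. ?N w)" by (rule sum_hyperbolic[OF per t'])
  finally have "B * (\<Sum>s\<in>R. int (square_count t (c + int t * s\<^sup>2))) = B * (B * ?N 0 + (B - 1) * (\<Sum>w\<in>R. ?N w))"
    by (simp only:)
  also have "\<dots> = B\<^sup>2 * int (tuple_count t 0 c) + (B - 1) * (B * (\<Sum>w\<in>R. ?N w))"
    by (simp add: power2_eq_square algebra_simps)
  finally have "B * (\<Sum>s\<in>R. int (square_count t (c + int t * s\<^sup>2))) = B\<^sup>2 * int (tuple_count t 0 c) + (B - 1) * B ^ t"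
    by (simp only: total)
  \<comment> \<open>The main terms, \<open>B * B ^ t\<close> here and \<open>(B - 1) * B ^ t\<close>
    above, leave the expected \<open>B ^ t\<close>.\<close>
  moreover have "B * (\<Sum>s\<in>R. int (square_count t (c + int t * s\<^sup>2))) =
    B * B ^ t + (if even t then B * (B * \<chi> (-1)) ^ (t div 2) * \<chi> (- (int t * c))
     else B * (B * \<chi> (-1)) ^ (t div 2) * \<chi> (int t) * \<nu> c)"
  proof -
    have "B * (\<Sum>s\<in>R. int (square_count t (c + int t * s\<^sup>2))) = (\<Sum>s\<in>R. B ^ t +
     (if even t then (B * \<chi> (-1)) ^ (t div 2) * \<nu> (c + int t * s\<^sup>2) else B * (B * \<chi> (-1)) ^ (t div 2) * \<chi> (c + int t * s\<^sup>2)))"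
      by (simp only: sum_distrib_left square_count)
    also have "\<dots> = B * B ^ t + (if even t then (B * \<chi> (-1)) ^ (t div 2) * (\<Sum>s\<in>R. \<nu> (c + int t * s\<^sup>2)) else B * (B * \<chi> (-1)) ^ (t div 2) * (\<Sum>s\<in>R. \<chi> (c + int t * s\<^sup>2)))"
      by (cases "even t") (simp_all add: sum.distrib sum_distrib_left)
    finally show ?thesis by (simp add: sum_\<nu>_plus_square[OF t'] sum_\<chi>_plus_square[OF t'])
  qed
  ultimately show ?thesis by (simp add: algebra_simps)
qed

end

section \<open>Equidistribution of the cores\<close>

lemma core_weight_shift_diff:
  assumes j: "0 < j" "j < t" and C: "\<And>n. C n \<subseteq> core_set t n"
  shows "(\<lambda>n. core_weight t n (C n) / real (num_partitions n) -
    core_weight t n (core_shift t j ` C n) / real (num_partitions n)) \<longlonglongrightarrow> 0"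
proof (rule tendstoI)
  fix e :: real assume e: "0 < e"
  then have "0 < e / 2" by simp
  from core_weight_shift_small[OF this, of t]
  show "\<forall>\<^sub>F n in sequentially. dist (core_weight t n (C n) / real (num_partitions n) -
    core_weight t n (core_shift t j ` C n) / real (num_partitions n)) 0 < e"
  proof eventually_elim
    case (elim n)
    then have "\<bar>core_weight t n (C n) - core_weight t n (core_shift t j ` C n)\<bar> \<le> e / 2 * real (num_partitions n)"
      using j C by blast
    also have "\<dots> < e * real (num_partitions n)" using e num_partitions_pos by simp
    finally show ?case
      using num_partitions_pos[of n] by (simp add: dist_real_def diff_divide_distrib[symmetric] pos_divide_less_eq)
  qed
qed

lemma core_shift_image_Collect:
  assumes "0 < j" "j < t" "\<And>x. x \<in> core_set t n \<Longrightarrow> P x \<longleftrightarrow> Q (core_shift t j x)"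
  shows "core_shift t j ` {x \<in> core_set t n. P x} = {x \<in> core_set t n. Q x}"
  using bij_betw_Collect[OF bij_core_shift[OF assms(1,2), of n], of Q P] assms(3)
  by (simp add: bij_betw_def)

lemma core_weight_Union:
  assumes "0 < t" "finite Z"
  shows "core_weight t n {x \<in> core_set t n. F x \<in> Z} = (\<Sum>z\<in>Z. core_weight t n {x \<in> core_set t n. F x = z})"
proof -
  let ?S = "{x \<in> core_set t n. F x \<in> Z \<and> 0 \<le> core_level t n x}"
  have "finite {x \<in> core_set t n. 0 \<le> core_level t n x}"
    using finite_subset[OF core_set_nonneg_level[OF assms(1)] finite_core_lattice_bounded] .
  then have fin: "finite ?S" by (rule rev_finite_subset) auto
  have "core_weight t n {x \<in> core_set t n. F x \<in> Z} = (\<Sum>x\<in>?S. real (multipartitions t (nat (core_level t n x))))"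
    unfolding core_weight_def by (intro sum.cong) auto
  also have "\<dots> = (\<Sum>z\<in>Z. \<Sum>x\<in>{x \<in> ?S. F x = z}. real (multipartitions t (nat (core_level t n x))))"
    using fin assms(2) by (intro sum.group[symmetric]) auto
  also have "\<dots> = (\<Sum>z\<in>Z. core_weight t n {x \<in> core_set t n. F x = z})"
    unfolding core_weight_def by (intro sum.cong refl) auto
  finally show ?thesis .
qed

text \<open>The differences sum to \<open>1 - card Z * w z0 n\<close>, which therefore tends to
  0.\<close>

lemma tendsto_inverse_card:
  fixes w :: "'z \<Rightarrow> nat \<Rightarrow> real"
  assumes Z: "finite Z" "z0 \<in> Z" "z \<in> Z"
    and diff: "\<And>z. z \<in> Z \<Longrightarrow> (\<lambda>n. w z n - w z0 n) \<longlonglongrightarrow> 0"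
    and total: "\<And>n. (\<Sum>z\<in>Z. w z n) = 1"
  shows "w z \<longlonglongrightarrow> 1 / real (card Z)"
proof -
  have c: "0 < real (card Z)" using Z by (auto simp: card_gt_0_iff)
  have "(\<lambda>n. \<Sum>z\<in>Z. w z n - w z0 n) \<longlonglongrightarrow> (\<Sum>z\<in>Z. 0)"
    by (intro tendsto_sum diff)
  then have "(\<lambda>n. 1 - real (card Z) * w z0 n) \<longlonglongrightarrow> 0"
    by (simp add: sum_subtractf total)
  then have "(\<lambda>n. (1 - (1 - real (card Z) * w z0 n)) / real (card Z)) \<longlonglongrightarrow> (1 - 0) / real (card Z)"
    using c by (intro tendsto_intros) auto
  then have "w z0 \<longlonglongrightarrow> 1 / real (card Z)" using c by simp
  from tendsto_add[OF diff[OF Z(3)] this] show ?thesis by simp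
qed

context odd_prime_modulus begin

text \<open>As \<open>b\<close> divides \<open>t\<close>, the slope in direction \<open>j\<close> is
  congruent to \<open>j\<close>. So the direction 1, available since \<open>1 < t\<close>, lowers
  the level by 1 modulo \<open>b\<close>.\<close>

lemma equidistributed_levels:
  assumes t: "1 < t" "b dvd t"
  shows "(\<lambda>n. core_weight t n {x \<in> core_set t n. [core_level t n x = a] (mod B)} / real (num_partitions n)) \<longlonglongrightarrow> 1 / real b"
proof -
  let ?C = "\<lambda>a n. {x \<in> core_set t n. [core_level t n x = a] (mod B)}"
  define w where "w = (\<lambda>a n. core_weight t n (?C a n) / real (num_partitions n))"
  have Bt: "B dvd int t" using t by (simp add: int_dvd_int_iff)
  have image: "core_shift t 1 ` ?C a n = ?C (a - 1) n" for a n
  proof (rule core_shift_image_Collect)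
    fix x
    have "slope t 1 x - 1 = int t * (x 1 - x 0 + int t)"
      by (simp add: slope_def algebra_simps power2_eq_square)
    then have "B dvd slope t 1 x - 1" using Bt by simp
    moreover have "core_level t n (core_shift t 1 x) - (a - 1) = core_level t n x - a - (slope t 1 x - 1)"
      using t core_level_shift[of 1 t n x] by simp
    ultimately show "[core_level t n x = a] (mod B) \<longleftrightarrow> [core_level t n (core_shift t 1 x) = a - 1] (mod B)"
      by (simp only: cong_iff_dvd_diff dvd_diff_left_iff)
  qed (use t in auto)
  have "(\<lambda>n. w a n - w (a - 1) n) \<longlonglongrightarrow> 0" for a
    unfolding w_def image[symmetric] using t by (intro core_weight_shift_diff) auto
  then have step: "(\<lambda>n. w (a + 1) n - w a n) \<longlonglongrightarrow> 0" for a
    by (metis add_diff_cancel_right')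
  have nat: "(\<lambda>n. w (int k) n - w 0 n) \<longlonglongrightarrow> 0" for k
  proof (induction k)
    case (Suc k)
    from tendsto_add[OF step[of "int k"] Suc] show ?case by (simp add: add.commute)
  qed simp
  have "w (a mod B) \<longlonglongrightarrow> 1 / real (card R)"
  proof (rule tendsto_inverse_card[where ?z0.0 = 0])
    show "(\<lambda>n. w z n - w 0 n) \<longlonglongrightarrow> 0" if "z \<in> R" for z
      using nat[of "nat z"] that by simp
    show "(\<Sum>z\<in>R. w z n) = 1" for n
    proof -
      have "?C z n = {x \<in> core_set t n. core_level t n x mod B = z}" if "z \<in> R" for z
        using that by (auto simp: unique_euclidean_semiring_class.cong_def)
      then have "(\<Sum>z\<in>R. w z n) = (\<Sum>z\<in>R. core_weight t n {x \<in> core_set t n. core_level t n x mod B = z}) / real (num_partitions n)"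
        unfolding w_def sum_divide_distrib by (intro sum.cong refl) (simp only:)
      also have "(\<Sum>z\<in>R. core_weight t n {x \<in> core_set t n. core_level t n x mod B = z}) = core_weight t n {x \<in> core_set t n. core_level t n x mod B \<in> R}"
        using t by (intro core_weight_Union[symmetric]) auto
      also have "{x \<in> core_set t n. core_level t n x mod B \<in> R} = core_set t n"
        using mod_B_in_R by blast
      finally show ?thesis using core_weight_core_set[of t n] t num_partitions_pos[of n] by simp
    qed
  qed (use b_gt_2 in auto)
  moreover have "w (a mod B) = w a" unfolding w_def by (simp add: unique_euclidean_semiring_class.cong_def)
  ultimately show ?thesis by (simp add: w_def)
qed

definition reduce :: "nat \<Rightarrow> (nat \<Rightarrow> int) \<Rightarrow> nat \<Rightarrow> int" where
  "reduce t v = (\<lambda>i\<in>{..<t}. v i mod B)"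

lemma reduce_eq_iff: "reduce t v = reduce t w \<longleftrightarrow> (\<forall>i<t. [v i = w i] (mod B))"
  by (auto simp: reduce_def unique_euclidean_semiring_class.cong_def fun_eq_iff restrict_def)

lemma reduce_in_zero_sum_tuples: "(\<Sum>i<t. v i) = 0 \<Longrightarrow> reduce t v \<in> zero_sum_tuples t"
proof -
  assume "(\<Sum>i<t. v i) = 0"
  moreover have "[(\<Sum>i<t. reduce t v i) = (\<Sum>i<t. v i)] (mod B)"
    by (rule cong_sum) (simp add: reduce_def)
  moreover have "reduce t v \<in> PiE {..<t} (\<lambda>_. R)"
    unfolding reduce_def restrict_PiE_iff using mod_B_in_R by blast
  ultimately show ?thesis by (simp add: zero_sum_tuples_def)
qed

(* Completes the square in core_form. *)
definition centered :: "nat \<Rightarrow> (nat \<Rightarrow> int) \<Rightarrow> nat \<Rightarrow> int" where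
  "centered t x i = 2 * int t * x i + 2 * int i - (int t - 1)"

lemma sum_centered: "x \<in> core_lattice t \<Longrightarrow> (\<Sum>i<t. centered t x i) = 0"
  using sum_int_lessThan[of t]
  by (simp add: centered_def core_lattice_def sum.distrib sum_subtractf sum_distrib_left[symmetric])

lemma centered_shift:
  assumes "0 < j"
  shows "centered t (core_shift t j x) = (centered t x)(j := centered t x j + 2 * (int t)\<^sup>2, 0 := centered t x 0 - 2 * (int t)\<^sup>2)"
  using assms by (auto simp: centered_def core_shift_def fun_eq_iff algebra_simps power2_eq_square)

definition class_ratio :: "nat \<Rightarrow> (nat \<Rightarrow> int) \<Rightarrow> nat \<Rightarrow> real" where
  "class_ratio t z n = core_weight t n {x \<in> core_set t n. reduce t (centered t x) = z} / real (num_partitions n)"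

lemma class_ratio_step:
  assumes j: "0 < j" "j < t"
  shows "(\<lambda>n. class_ratio t (reduce t v) n -
    class_ratio t (reduce t (v(j := v j + 2 * (int t)\<^sup>2, 0 := v 0 - 2 * (int t)\<^sup>2))) n) \<longlonglongrightarrow> 0"
proof -
  let ?v = "v(j := v j + 2 * (int t)\<^sup>2, 0 := v 0 - 2 * (int t)\<^sup>2)"
  have "core_shift t j ` {x \<in> core_set t n. reduce t (centered t x) = reduce t v} =
      {x \<in> core_set t n. reduce t (centered t x) = reduce t ?v}" for n
  proof (rule core_shift_image_Collect[OF j])
    fix x
    have "[centered t x i = v i] (mod B) \<longleftrightarrow> [centered t (core_shift t j x) i = ?v i] (mod B)" for i
      unfolding centered_shift[OF j(1)] by (simp add: cong_iff_dvd_diff)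
    then show "reduce t (centered t x) = reduce t v \<longleftrightarrow> reduce t (centered t (core_shift t j x)) = reduce t ?v"
      by (simp only: reduce_eq_iff)
  qed
  then have "class_ratio t (reduce t ?v) = (\<lambda>n. core_weight t n (core_shift t j ` {x \<in> core_set t n. reduce t (centered t x) = reduce t v}) / real (num_partitions n))"
    by (simp add: class_ratio_def fun_eq_iff)
  then show ?thesis
    unfolding class_ratio_def[of t "reduce t v"] by (simp only:) (intro core_weight_shift_diff[OF j], auto)
qed

lemma class_ratio_steps:
  assumes j: "0 < j" "j < t"
  shows "(\<lambda>n. class_ratio t (reduce t v) n -
    class_ratio t (reduce t (v(j := v j + int k * (2 * (int t)\<^sup>2), 0 := v 0 - int k * (2 * (int t)\<^sup>2)))) n) \<longlonglongrightarrow> 0"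
proof -
  define V where "V = (\<lambda>k. v(j := v j + int k * (2 * (int t)\<^sup>2), 0 := v 0 - int k * (2 * (int t)\<^sup>2)))"
  have V0: "V 0 = v" by (auto simp: V_def)
  have VS: "(V k)(j := V k j + 2 * (int t)\<^sup>2, 0 := V k 0 - 2 * (int t)\<^sup>2) = V (Suc k)" for k
    using j by (auto simp: V_def fun_eq_iff algebra_simps)
  have "(\<lambda>n. class_ratio t (reduce t v) n - class_ratio t (reduce t (V k)) n) \<longlonglongrightarrow> 0"
  proof (induction k)
    case (Suc k)
    from tendsto_add[OF Suc class_ratio_step[OF j, of "V k"]] show ?case by (simp add: VS)
  qed (simp add: V0)
  then show ?thesis by (simp only: V_def)
qed

text \<open>The step \<open>2 * t\<^sup>2\<close> of the centered coordinates is a unit modulo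
  \<open>b\<close>, so a suitable number of steps makes coordinate \<open>j\<close> vanish, and
  coordinate 0 absorbs its value.\<close>

lemma class_ratio_clear:
  assumes t: "\<not> b dvd t" and j: "0 < j" "j < t"
  shows "(\<lambda>n. class_ratio t (reduce t v) n - class_ratio t (reduce t (v(j := 0, 0 := v 0 + v j))) n) \<longlonglongrightarrow> 0"
proof -
  have "coprime (2 * (int t)\<^sup>2) B"
    using prime_B t B_not_dvd_2
    by (intro prime_imp_coprime[THEN coprime_commute[THEN iffD1]])
      (auto simp: B_dvd_mult power2_eq_square int_dvd_int_iff)
  then obtain y where y: "[2 * (int t)\<^sup>2 * y = 1] (mod B)" using cong_solve_coprime_int by blast
  define k where "k = nat ((- (v j) * y) mod B)"
  have "int k = (- (v j) * y) mod B" unfolding k_def using b_gt_2 by simp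
  then have "[int k = - (v j) * y] (mod B)" by simp
  then have "[int k * (2 * (int t)\<^sup>2) = - (v j) * y * (2 * (int t)\<^sup>2)] (mod B)" by (intro cong_mult cong_refl)
  also have "- (v j) * y * (2 * (int t)\<^sup>2) = - (v j) * (2 * (int t)\<^sup>2 * y)" by simp
  also have "[- (v j) * (2 * (int t)\<^sup>2 * y) = - (v j) * 1] (mod B)" using y by (intro cong_mult cong_refl)
  finally have k: "B dvd int k * (2 * (int t)\<^sup>2) + v j" by (simp add: cong_iff_dvd_diff)
  let ?v = "v(j := v j + int k * (2 * (int t)\<^sup>2), 0 := v 0 - int k * (2 * (int t)\<^sup>2))"
  have "reduce t ?v = reduce t (v(j := 0, 0 := v 0 + v j))"
    unfolding reduce_eq_iff
  proof (intro allI impI)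
    fix i
    have "v 0 - int k * (2 * (int t)\<^sup>2) - (v 0 + v j) = - (int k * (2 * (int t)\<^sup>2) + v j)" by simp
    then have "B dvd v 0 - int k * (2 * (int t)\<^sup>2) - (v 0 + v j)" using k by (simp only: dvd_minus_iff)
    then show "[?v i = (v(j := 0, 0 := v 0 + v j)) i] (mod B)"
      using k j by (auto simp: cong_iff_dvd_diff add.commute)
  qed
  then show ?thesis using class_ratio_steps[OF j, of v k] by simp
qed

text \<open>The coordinates 1, ..., \<open>t - 1\<close> are cleared one at a time. Coordinate 0
  ends up with the whole sum, which is zero.\<close>

lemma class_ratio_zero:
  assumes t: "\<not> b dvd t" "0 < t" and v: "(\<Sum>i<t. v i) = 0"
  shows "(\<lambda>n. class_ratio t (reduce t v) n - class_ratio t (reduce t (\<lambda>_. 0)) n) \<longlonglongrightarrow> 0"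
proof -
  have *: "(\<lambda>n. class_ratio t (reduce t v) n -
      class_ratio t (reduce t (\<lambda>i. if i = 0 then v 0 + (\<Sum>l\<in>S. v l) else if i \<in> S then 0 else v i)) n) \<longlonglongrightarrow> 0"
    if "finite S" "S \<subseteq> {1..<t}" for S
    using that
  proof (induction S rule: finite_induct)
    case empty
    have "(\<lambda>i. if i = 0 then v 0 + (\<Sum>l\<in>{}. v l) else if i \<in> {} then 0 else v i) = v" by auto
    then show ?case by simp
  next
    case (insert j S)
    let ?v = "\<lambda>S i. if i = 0 then v 0 + (\<Sum>l\<in>S. v l) else if i \<in> S then 0 else v i"
    have j: "0 < j" "j < t" using insert by auto
    have "(?v S)(j := 0, 0 := ?v S 0 + ?v S j) = ?v (insert j S)"
      using j insert by (auto simp: fun_eq_iff)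
    then have "(\<lambda>n. class_ratio t (reduce t (?v S)) n - class_ratio t (reduce t (?v (insert j S))) n) \<longlonglongrightarrow> 0"
      using class_ratio_clear[OF t(1) j, of "?v S"] by (simp only:)
    from tendsto_add[OF insert.IH this] show ?case using insert by simp
  qed
  have "{..<t} = insert 0 {1..<t}" using t by auto
  then have "v 0 + (\<Sum>l\<in>{1..<t}. v l) = 0" using v by simp
  then have "reduce t (\<lambda>i. if i = 0 then v 0 + (\<Sum>l\<in>{1..<t}. v l) else if i \<in> {1..<t} then 0 else v i) = reduce t (\<lambda>_. 0)"
    unfolding reduce_eq_iff by auto
  then show ?thesis using *[of "{1..<t}"] by simp
qed

lemma finite_zero_sum_tuples [simp]: "finite (zero_sum_tuples t)"
  unfolding zero_sum_tuples_def by (rule finite_tuples)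

lemma class_ratio_limit:
  assumes t: "\<not> b dvd t" "0 < t" and z: "z \<in> zero_sum_tuples t"
  shows "class_ratio t z \<longlonglongrightarrow> 1 / real (card (zero_sum_tuples t))"
proof (rule tendsto_inverse_card[where ?z0.0 = "reduce t (\<lambda>_. 0)"])
  show "reduce t (\<lambda>_. 0) \<in> zero_sum_tuples t" by (intro reduce_in_zero_sum_tuples) simp
next
  fix z assume z: "z \<in> zero_sum_tuples t"
  let ?q = "(\<Sum>i<t. z i)"
  \<comment> \<open>The sum of \<open>z\<close> is zero only modulo \<open>b\<close>. Correcting
    coordinate 0 makes it zero without changing the residues, as \<open>class_ratio_zero\<close>
    requires.\<close>
  let ?v = "z(0 := z 0 - ?q)"
  have "{..<t} = insert 0 {1..<t}" using t by auto
  then have s: "(\<Sum>i<t. ?v i) = 0"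
    by (simp add: sum.insert)
  have "reduce t ?v = reduce t z"
    unfolding reduce_eq_iff using z by (auto simp: zero_sum_tuples_def cong_iff_dvd_diff)
  moreover have "reduce t z = z"
    using z by (auto simp: zero_sum_tuples_def reduce_def PiE_iff extensional_def fun_eq_iff)
  ultimately show "(\<lambda>n. class_ratio t z n - class_ratio t (reduce t (\<lambda>_. 0)) n) \<longlonglongrightarrow> 0"
    using class_ratio_zero[OF t s] by (simp only:)
next
  fix n
  have "(\<Sum>z\<in>zero_sum_tuples t. class_ratio t z n) =
      core_weight t n {x \<in> core_set t n. reduce t (centered t x) \<in> zero_sum_tuples t} / real (num_partitions n)"
    unfolding class_ratio_def sum_divide_distrib[symmetric]
    using t by (subst core_weight_Union) auto
  also have "{x \<in> core_set t n. reduce t (centered t x) \<in> zero_sum_tuples t} = core_set t n"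
    using reduce_in_zero_sum_tuples[OF sum_centered] by (auto simp: core_set_def)
  finally show "(\<Sum>z\<in>zero_sum_tuples t. class_ratio t z n) = 1"
    using core_weight_core_set[of t n] t num_partitions_pos[of n] by simp
qed (use z in auto)

end

section \<open>From the density of solutions to the constant\<close>

lemma sum_squares_int_lessThan: "6 * (\<Sum>i<t. (int i)\<^sup>2) = int t * (int t - 1) * (2 * int t - 1)"
  by (induction t) (auto simp: algebra_simps power2_eq_square)

context odd_prime_modulus begin

text \<open>The factor 3 clears the denominator of \<open>t * (t\<^sup>2 - 1) / 3\<close>, the sum
  of the squares of the numbers \<open>2 * i - (t - 1)\<close>.\<close>

lemma sum_squares_centered:
  assumes x: "x \<in> core_lattice t"
  shows "3 * (\<Sum>i<t. (centered t x i)\<^sup>2) = 12 * int t * core_form t x + int t * ((int t)\<^sup>2 - 1)"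
proof -
  let ?y = "\<lambda>i. int t * x i + int i"
  have "centered t x i = 2 * ?y i - (int t - 1)" for i by (simp add: centered_def)
  then have "(\<Sum>i<t. (centered t x i)\<^sup>2) = (\<Sum>i<t. (2 * ?y i - (int t - 1))\<^sup>2)"
    by (simp only:)
  also have "\<dots> = (\<Sum>i<t. 4 * (?y i)\<^sup>2 - 4 * (int t - 1) * ?y i + (int t - 1)\<^sup>2)"
    by (intro sum.cong) (simp_all add: power2_eq_square algebra_simps)
  also have "\<dots> = 4 * (\<Sum>i<t. (?y i)\<^sup>2) - 4 * (int t - 1) * (\<Sum>i<t. ?y i) + int t * (int t - 1)\<^sup>2"
    by (simp only: sum.distrib sum_subtractf sum_distrib_left[symmetric]) simp
  also have "(\<Sum>i<t. ?y i) = (\<Sum>i<t. int i)"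
    using x by (simp add: sum.distrib sum_distrib_left[symmetric] core_lattice_def)
  finally have "3 * (\<Sum>i<t. (centered t x i)\<^sup>2) = 12 * int t * core_form t x + 2 * (6 * (\<Sum>i<t. (int i)\<^sup>2))
      - 6 * (int t - 1) * (2 * (\<Sum>i<t. int i)) + 3 * int t * (int t - 1)\<^sup>2"
    unfolding mult_core_form[symmetric] by (simp add: algebra_simps)
  also have "\<dots> = 12 * int t * core_form t x + int t * ((int t)\<^sup>2 - 1)"
    unfolding sum_squares_int_lessThan sum_int_lessThan by (simp add: power2_eq_square algebra_simps)
  finally show ?thesis .
qed

text \<open>The divisor 8 comes from the odd number \<open>b\<close>. The divisor 3 comes from
  \<open>b\<close> unless \<open>b = 3\<close>, and in that case from \<open>t\<close>, which is not
  divisible by \<open>b\<close>.\<close>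

lemma dvd_24:
  assumes "\<not> b dvd t"
  shows "24 dvd (1 - (int t)\<^sup>2) * (1 - (int b)\<^sup>2)"
proof -
  have three: "3 dvd 1 - (int m)\<^sup>2" if "\<not> 3 dvd m" for m
  proof -
    have "m mod 3 = 1 \<or> m mod 3 = 2" using that by presburger
    then obtain q where "m = 3 * q + 1 \<or> m = 3 * q + 2" by (metis mult_div_mod_eq)
    then have "\<exists>r. 1 - (int m)\<^sup>2 = 3 * r"
    proof
      assume "m = 3 * q + 1"
      then have "1 - (int m)\<^sup>2 = 3 * (- int q * (3 * int q + 2))" by (simp add: power2_eq_square algebra_simps)
      then show ?thesis by blast
    next
      assume "m = 3 * q + 2"
      then have "1 - (int m)\<^sup>2 = 3 * (- (int q + 1) * (3 * int q + 1))" by (simp add: power2_eq_square algebra_simps)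
      then show ?thesis by blast
    qed
    then show ?thesis by (auto simp: dvd_def)
  qed
  have "8 dvd 1 - (int b)\<^sup>2"
  proof -
    obtain k where k: "b = 2 * k + 1" using odd_b by (rule oddE)
    have "even (int k * (int k + 1))" by simp
    then obtain r where "int k * (int k + 1) = 2 * r" by (rule evenE)
    then have "1 - (int b)\<^sup>2 = 8 * (- r)" unfolding k by (simp add: power2_eq_square algebra_simps)
    then show ?thesis by (metis dvd_triv_left)
  qed
  then have "8 dvd (1 - (int t)\<^sup>2) * (1 - (int b)\<^sup>2)" by (rule dvd_mult)
  moreover have "3 dvd (1 - (int t)\<^sup>2) * (1 - (int b)\<^sup>2)"
  proof (cases "3 dvd b")
    case True
    then have "b = 3" using prime_b by (metis prime_nat_iff numeral_eq_one_iff semiring_norm(86))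
    then show ?thesis using three[of t] assms by (intro dvd_mult2) simp
  next
    case False
    then show ?thesis using three[of b] by (intro dvd_mult)
  qed
  moreover have "8 dvd z \<Longrightarrow> 3 dvd z \<Longrightarrow> 24 dvd z" for z :: int by presburger
  ultimately show ?thesis by blast
qed

text \<open>Origin of \<open>hook_arg\<close>. With \<open>T = t * (t\<^sup>2 - 1) / 3\<close> the
  sum of squares is \<open>8 * t * n - 8 * t\<^sup>2 * m + T\<close>, where \<open>m\<close> is the
  level. Modulo \<open>b\<close>, \<open>T\<close> is \<open>- 8 * t * H\<close> for the integer
  \<open>H = (1 - t\<^sup>2) * (1 - b\<^sup>2) / 24\<close>. This exhibits the common factor
  \<open>- 8 * t\<close> also for \<open>b = 3\<close>, where 24 has no inverse.\<close>

lemma level_cong_iff_centered: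
  assumes t: "\<not> b dvd t" "0 < t" and n: "[int n = int a2] (mod B)" and x: "x \<in> core_set t n"
  shows "[core_level t n x = int a1] (mod B) \<longleftrightarrow>
    [(\<Sum>i<t. (reduce t (centered t x) i)\<^sup>2) = - (8 * int t * hook_arg a1 b t a2)] (mod B)"
proof -
  let ?H = "((1 - (int t)\<^sup>2) * (1 - B\<^sup>2)) div 24" and ?m = "core_level t n x"
  let ?S = "\<Sum>i<t. (centered t x i)\<^sup>2"
  have H: "24 * ?H = (1 - (int t)\<^sup>2) * (1 - B\<^sup>2)" using dvd_24[OF t(1)] by (rule dvd_mult_div_cancel)
  have lattice: "x \<in> core_lattice t" using x by (simp add: core_set_def)
  have "2 * int n - core_form t x = 2 * int t * ?m"
    using x dvd_mult_div_cancel[of "2 * int t" "2 * int n - core_form t x"]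
    by (simp only: core_set_def core_level_def mem_Collect_eq)
  then have cf: "core_form t x = 2 * int n - 2 * int t * ?m" by simp
  have "3 dvd int t * ((int t)\<^sup>2 - 1)"
  proof -
    have "int t * ((int t)\<^sup>2 - 1) = 3 * (?S - 4 * int t * core_form t x)"
      using sum_squares_centered[OF lattice] by simp
    then show ?thesis by (metis dvd_triv_left)
  qed
  then obtain T where T: "int t * ((int t)\<^sup>2 - 1) = 3 * T" by (rule dvdE)
  have S: "?S = 8 * int t * int n - 8 * (int t)\<^sup>2 * ?m + T"
    using sum_squares_centered[OF lattice] unfolding T cf by (simp add: power2_eq_square algebra_simps)
  \<comment> \<open>Exact form of the congruence between \<open>T\<close> and
    \<open>- 8 * t * ?H\<close>, tripled to clear both denominators.\<close>
  have "3 * (T + 8 * int t * ?H) = 3 * T + int t * (24 * ?H)" by simp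
  also have "\<dots> = int t * ((int t)\<^sup>2 - 1) * B\<^sup>2"
    unfolding H T[symmetric] by (simp add: algebra_simps)
  also have "\<dots> = 3 * (T * B\<^sup>2)" by (simp add: T)
  finally have TH: "T + 8 * int t * ?H = T * B\<^sup>2" by simp
  have "?S - - (8 * int t * hook_arg a1 b t a2) = 8 * int t * (int n - int a2) - 8 * (int t)\<^sup>2 * (?m - int a1) + (T + 8 * int t * ?H)"
    unfolding S hook_arg_def by (simp add: power2_eq_square algebra_simps)
  also have "\<dots> = (8 * int t * (int n - int a2) + T * B\<^sup>2) - 8 * (int t)\<^sup>2 * (?m - int a1)"
    unfolding TH by simp
  finally have eq: "?S - - (8 * int t * hook_arg a1 b t a2) =
      (8 * int t * (int n - int a2) + T * B\<^sup>2) - 8 * (int t)\<^sup>2 * (?m - int a1)" .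
  have "B dvd 8 * int t * (int n - int a2) + T * B\<^sup>2"
    using n by (intro dvd_add dvd_mult) (simp_all add: cong_iff_dvd_diff)
  then have "B dvd ?S - - (8 * int t * hook_arg a1 b t a2) \<longleftrightarrow> B dvd 8 * (int t)\<^sup>2 * (?m - int a1)"
    unfolding eq by (rule dvd_diff_right_iff)
  also have "\<dots> \<longleftrightarrow> B dvd ?m - int a1"
  proof -
    have "(8 :: int) = 2 * (2 * 2)" by simp
    then have "\<not> B dvd 8" using B_not_dvd_2 B_dvd_mult by metis
    then show ?thesis using t by (simp add: B_dvd_mult power2_eq_square int_dvd_int_iff)
  qed
  finally have "[?S = - (8 * int t * hook_arg a1 b t a2)] (mod B) \<longleftrightarrow> [?m = int a1] (mod B)"
    by (simp only: cong_iff_dvd_diff)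
  moreover have "[(\<Sum>i<t. (reduce t (centered t x) i)\<^sup>2) = ?S] (mod B)"
    by (rule cong_sum, rule cong_pow) (simp add: reduce_def)
  ultimately show ?thesis by (simp only: unique_euclidean_semiring_class.cong_def)
qed

lemma num_partitions_hooks_eq_core_weight:
  "0 < t \<Longrightarrow> real (num_partitions_hooks t a b n) = core_weight t n {x \<in> core_set t n. [core_level t n x = int a] (mod B)}"
  using core_weight_level[of t n "\<lambda>m. [m = int a] (mod B)"]
  by (simp add: num_partitions_hooks_def cong_int_iff)

lemma filterlim_progression: "filterlim (\<lambda>n. b * n + a) sequentially sequentially"
  using b_gt_2 by (intro filterlim_subseq) (simp add: strict_mono_def)

lemma hook_ratio_limit_dvd:
  assumes "1 < t" "b dvd t"
  shows "(\<lambda>n. real (num_partitions_hooks t a1 b (b * n + a2)) / real (num_partitions (b * n + a2))) \<longlonglongrightarrow> 1 / real b"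
  using filterlim_compose[OF equidistributed_levels[OF assms, of "int a1"] filterlim_progression[of a2]] assms
  by (simp add: num_partitions_hooks_eq_core_weight)

text \<open>Along the progression \<open>n\<close> keeps the residue \<open>a2\<close>, so the
  condition on the level selects a fixed set of classes \<open>z\<close>, each with the same
  limiting share.\<close>

lemma hook_ratio_limit_not_dvd:
  assumes t: "\<not> b dvd t" "0 < t"
  shows "(\<lambda>n. real (num_partitions_hooks t a1 b (b * n + a2)) / real (num_partitions (b * n + a2))) \<longlonglongrightarrow>
    real (tuple_count t 0 (- (8 * int t * hook_arg a1 b t a2))) / real (card (zero_sum_tuples t))"
proof -
  let ?c = "- (8 * int t * hook_arg a1 b t a2)"
  let ?Z = "{z \<in> zero_sum_tuples t. [(\<Sum>i<t. (z i)\<^sup>2) = ?c] (mod B)}"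
  have cZ: "card ?Z = tuple_count t 0 ?c"
    unfolding tuple_count_def zero_sum_tuples_def by (intro arg_cong[of _ _ card]) auto
  have eq: "real (num_partitions_hooks t a1 b N) / real (num_partitions N) = (\<Sum>z\<in>?Z. class_ratio t z N)"
    if N: "N = b * n + a2" for n N
  proof -
    have cong: "[int N = int a2] (mod B)" unfolding N by (simp add: cong_iff_dvd_diff)
    have "real (num_partitions_hooks t a1 b N) = core_weight t N {x \<in> core_set t N. [core_level t N x = int a1] (mod B)}"
      by (rule num_partitions_hooks_eq_core_weight[OF t(2)])
    also have "{x \<in> core_set t N. [core_level t N x = int a1] (mod B)} = {x \<in> core_set t N. reduce t (centered t x) \<in> ?Z}"
      using level_cong_iff_centered[OF t cong] reduce_in_zero_sum_tuples[OF sum_centered]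
      by (auto simp: core_set_def)
    also have "core_weight t N \<dots> = (\<Sum>z\<in>?Z. core_weight t N {x \<in> core_set t N. reduce t (centered t x) = z})"
      using t by (intro core_weight_Union) auto
    finally show ?thesis by (simp add: class_ratio_def sum_divide_distrib)
  qed
  have "(\<lambda>n. \<Sum>z\<in>?Z. class_ratio t z (b * n + a2)) \<longlonglongrightarrow> (\<Sum>z\<in>?Z. 1 / real (card (zero_sum_tuples t)))"
    by (intro tendsto_sum filterlim_compose[OF class_ratio_limit[OF t] filterlim_progression]) auto
  moreover have "(\<lambda>n. real (num_partitions_hooks t a1 b (b * n + a2)) / real (num_partitions (b * n + a2))) =
      (\<lambda>n. \<Sum>z\<in>?Z. class_ratio t z (b * n + a2))"
    by (intro ext eq[OF refl])
  ultimately show ?thesis by (simp only: sum_constant cZ) simp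
qed

lemma hook_const_dvd: "b dvd t \<Longrightarrow> hook_const t a1 b a2 = 1 / of_nat b"
  by (simp add: hook_const_def)

text \<open>There are \<open>b ^ (t - 1)\<close> zero-sum tuples, so the main term of
  \<open>tuple_count_zero_sum\<close> becomes \<open>1 / b\<close>, and the quotient
  \<open>b ^ (t div 2) / b ^ t\<close> gives the exponent of the second term.\<close>

lemma tuple_count_ratio:
  assumes t: "\<not> b dvd t" "0 < t"
  shows "real (tuple_count t 0 c) / real (card (zero_sum_tuples t)) = 1 / real b +
    (if even t then of_int (\<chi> (-1) ^ (t div 2) * \<chi> (- (int t * c))) / real b ^ (t div 2)
     else of_int (\<chi> (-1) ^ (t div 2) * \<chi> (int t) * \<nu> c) / real b ^ (t div 2 + 1))"
proof -
  have b: "real b > 0" using b_gt_2 by simp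
  have "real b * real (card (zero_sum_tuples t)) = real b ^ t"
    using card_zero_sum_tuples[OF t(1)] by (metis of_nat_mult of_nat_power)
  then have Z: "real (card (zero_sum_tuples t)) = real b ^ t / real b" using b by (simp add: field_simps)
  have "real_of_int (B\<^sup>2 * int (tuple_count t 0 c)) = real_of_int (B ^ t +
    (if even t then B * (B * \<chi> (-1)) ^ (t div 2) * \<chi> (- (int t * c))
     else B * (B * \<chi> (-1)) ^ (t div 2) * \<chi> (int t) * \<nu> c))"
    unfolding tuple_count_zero_sum[OF t(1)] ..
  then have N: "real b ^ 2 * real (tuple_count t 0 c) = real b ^ t + real b * real b ^ (t div 2) *
    (if even t then of_int (\<chi> (-1) ^ (t div 2) * \<chi> (- (int t * c))) else of_int (\<chi> (-1) ^ (t div 2) * \<chi> (int t) * \<nu> c))"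
    by (auto simp: power_mult_distrib mult_ac)
  have "real (tuple_count t 0 c) / real (card (zero_sum_tuples t)) = (real b ^ 2 * real (tuple_count t 0 c)) / (real b * real b ^ t)"
    using b unfolding Z by (simp add: field_simps power2_eq_square)
  also have "\<dots> = 1 / real b + real b ^ (t div 2) / real b ^ t *
    (if even t then of_int (\<chi> (-1) ^ (t div 2) * \<chi> (- (int t * c))) else of_int (\<chi> (-1) ^ (t div 2) * \<chi> (int t) * \<nu> c))"
    unfolding N using b by (simp add: field_simps)
  also have "real b ^ (t div 2) / real b ^ t = 1 / real b ^ (t - t div 2)"
    using b by (simp add: power_diff)
  also have "t - t div 2 = (if even t then t div 2 else t div 2 + 1)" by (auto elim!: evenE oddE)
  finally show ?thesis by auto
qed

text \<open>Up to a power of \<open>\<chi> (-1)\<close>, this is how the power of the imaginary unit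
  and \<open>eps b\<close> in the constant for even \<open>t\<close> combine to a sign. The symbol
  of 2 on the other side arises from the factor 8 in the quadratic congruence.\<close>

lemma \<chi>_two_mult_eps:
  "complex_of_int (\<chi> 2) = \<i> ^ ((b - 1) div 2) * eps b"
proof -
  have "b = 4 * (b div 4) + 1 \<or> b = 4 * (b div 4) + 3" using odd_b by presburger
  then obtain m where "b = 4 * m + 1 \<or> b = 4 * m + 3" by blast
  then show ?thesis
  proof
    assume b: "b = 4 * m + 1"
    have "eps b = 1" unfolding eps_def b by (simp add: unique_euclidean_semiring_class.cong_def)
    moreover have "(b - 1) div 2 = 2 * m" "(b + 1) div 4 = m" unfolding b by simp_all
    ultimately show ?thesis using Legendre_two[OF prime_b odd_b] by (simp add: power_mult)
  next
    assume b: "b = 4 * m + 3"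
    have "\<not> [b = 1] (mod 4)" unfolding b unique_euclidean_semiring_class.cong_def by presburger
    then have "eps b = \<i>" by (simp add: eps_def)
    moreover have "(b - 1) div 2 = 2 * m + 1" "(b + 1) div 4 = m + 1" unfolding b by simp_all
    ultimately show ?thesis using Legendre_two[OF prime_b odd_b]
      by (cases "even m") (simp_all add: power_mult power_add)
  qed
qed

lemma hook_const_not_dvd:
  assumes t: "\<not> b dvd t" "0 < t"
  shows "hook_const t a1 b a2 =
    complex_of_real (real (tuple_count t 0 (- (8 * int t * hook_arg a1 b t a2))) / real (card (zero_sum_tuples t)))"
proof -
  let ?h = "hook_arg a1 b t a2"
  define q where "q = (b - 1) div 2"
  have q: "int b - 1 = 2 * int q" unfolding q_def using odd_b b_gt_2 by (auto elim!: oddE)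
  have \<epsilon>: "\<chi> (-1) = (-1) ^ q" by (simp add: \<chi>_minus_one q_def)
  have bpos: "0 < real b" using b_gt_2 by simp
  have t': "\<not> B dvd int t" using t by (simp add: int_dvd_int_iff)
  show ?thesis
  proof (cases "even t")
    case True
    then obtain j where j: "t = 2 * j" by (rule evenE)
    \<comment> \<open>Up to a square the argument is \<open>2 * ?h\<close>, which brings in the
      symbol of 2.\<close>
    have "- (int t * - (8 * int t * ?h)) = 2 * ((2 * int t) * (2 * int t) * ?h)" by simp
    then have "\<chi> (- (int t * - (8 * int t * ?h))) = \<chi> 2 * ((\<chi> (2 * int t) * \<chi> (2 * int t)) * \<chi> ?h)"
      by (simp only: \<chi>_mult)
    moreover have "\<chi> (2 * int t) * \<chi> (2 * int t) = 1"
      using t' B_not_dvd_2 by (intro \<chi>_square) (simp add: B_dvd_mult)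
    ultimately have \<chi>: "\<chi> (- (int t * - (8 * int t * ?h))) = \<chi> 2 * \<chi> ?h" by (simp only: mult_1)
    \<comment> \<open>With \<open>t = 2 * j\<close> the halved exponent is
      \<open>q - 2 * j * q\<close>: the part \<open>q\<close> goes with \<open>eps b\<close>, and
      the rest yields \<open>\<chi> (-1) ^ j\<close>.\<close>
    have "(1 - int t) * (int b - 1) = 2 * (int q + -2 * int (j * q))" unfolding q j by (simp add: algebra_simps)
    then have "((1 - int t) * (int b - 1)) div 2 = int q + -2 * int (j * q)" by simp
    then have "\<i> powi (((1 - int t) * (int b - 1)) div 2) = \<i> powi (int q + -2 * int (j * q))" by simp
    also have "\<dots> = \<i> powi int q * \<i> powi (-2 * int (j * q))"
      by (rule power_int_add) simp
    also have "\<dots> = \<i> ^ q * (\<i> powi -2) ^ (j * q)"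
      by (simp only: power_int_mult power_int_of_nat)
    also have "\<i> powi -2 = -1" by (simp add: power_int_minus)
    also have "(-1 :: complex) ^ (j * q) = ((-1) ^ q) ^ j" by (simp add: power_mult mult.commute[of j])
    finally have i: "\<i> powi (((1 - int t) * (int b - 1)) div 2) * eps b = complex_of_int (\<chi> 2) * ((-1) ^ q) ^ j"
      using \<chi>_two_mult_eps by (simp add: q_def)
    have "- real t / 2 = - real j" unfolding j by simp
    then have powr: "real b powr (- real t / 2) = 1 / real b ^ j"
      using bpos by (simp only: powr_minus powr_realpow divide_inverse mult_1)
    have tj: "t div 2 = j" using j by simp
    have "hook_const t a1 b a2 = 1 / of_nat b + \<i> powi (((1 - int t) * (int b - 1)) div 2) * eps b *
        of_real (real b powr (- real t / 2)) * of_int (\<chi> ?h)"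
      using t True unfolding hook_const_def by (simp only: if_False simp_thms)
    also have "\<dots> = complex_of_real (1 / real b + of_int (((-1) ^ q) ^ j * (\<chi> 2 * \<chi> ?h)) / real b ^ j)"
      unfolding i powr by (simp add: mult_ac)
    finally show ?thesis
      by (simp only: tuple_count_ratio[OF t] True if_True \<chi> \<epsilon> tj)
  next
    case False
    then obtain j where j: "t = 2 * j + 1" by (rule oddE)
    \<comment> \<open>The factor \<open>- 8 * t\<close> is a unit, so it does not affect
      \<open>\<nu>\<close>.\<close>
    have "- (8 * int t * ?h) = (- (2 * (2 * (2 * int t)))) * ?h" by simp
    moreover have "\<nu> ((- (2 * (2 * (2 * int t)))) * ?h) = \<nu> ?h"
      using t' B_not_dvd_2 by (intro \<nu>_mult) (simp only: dvd_minus_iff B_dvd_mult simp_thms)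
    ultimately have \<nu>: "\<nu> (- (8 * int t * ?h)) = hook_indicator a1 b t a2"
      by (simp add: \<nu>_def hook_indicator_def)
    have "(1 - int t) * (int b - 1) = 4 * - int (j * q)" unfolding q j by (simp add: algebra_simps)
    then have "((1 - int t) * (int b - 1)) div 4 = - int (j * q)" by simp
    then have "(-1 :: complex) powi (((1 - int t) * (int b - 1)) div 4) = (-1) powi (- int (j * q))" by simp
    also have "\<dots> = (-1) ^ (j * q)"
      by (simp only: power_int_minus power_int_of_nat power_inverse[symmetric]) simp
    also have "\<dots> = ((-1) ^ q) ^ j" by (simp add: power_mult mult.commute[of j])
    finally have i: "(-1 :: complex) powi (((1 - int t) * (int b - 1)) div 4) = ((-1) ^ q) ^ j" .
    have "- (real t + 1) / 2 = - real (j + 1)" unfolding j by simp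
    then have powr: "real b powr (- (real t + 1) / 2) = 1 / real b ^ (j + 1)"
      using bpos by (simp only: powr_minus powr_realpow divide_inverse mult_1)
    have tj: "t div 2 = j" using j by simp
    have "hook_const t a1 b a2 = 1 / of_nat b + (- 1) powi (((1 - int t) * (int b - 1)) div 4) *
        of_int (hook_indicator a1 b t a2) * of_real (real b powr (- (real t + 1) / 2)) * of_int (\<chi> (int t))"
      using t False unfolding hook_const_def by (simp only: if_False if_True simp_thms)
    also have "\<dots> = complex_of_real (1 / real b + of_int (((-1) ^ q) ^ j * \<chi> (int t) * hook_indicator a1 b t a2) / real b ^ (j + 1))"
      unfolding i powr by (simp add: mult_ac)
    finally show ?thesis
      by (simp only: tuple_count_ratio[OF t] False if_False \<nu> \<epsilon> tj)
  qed
qed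

end

theorem corollary1p15:
  fixes t b a1 a2 :: nat
  assumes "t > 1" and "prime b" and "odd b" and "a1 < b" and "a2 < b"
  shows "(\<lambda>n. complex_of_real
             (real (num_partitions_hooks t a1 b (b * n + a2)) / real (num_partitions (b * n + a2))))
         \<longlonglongrightarrow> hook_const t a1 b a2"
proof -
  interpret odd_prime_modulus b by unfold_locales (use assms in auto)
  show ?thesis
  proof (cases "b dvd t")
    case True
    have "(\<lambda>n. complex_of_real (real (num_partitions_hooks t a1 b (b * n + a2)) / real (num_partitions (b * n + a2))))
        \<longlonglongrightarrow> complex_of_real (1 / real b)"
      by (intro tendsto_of_real hook_ratio_limit_dvd assms True)
    then show ?thesis by (simp add: hook_const_dvd[OF True])
  next
    case False
    have "0 < t" using assms by simp
    then show ?thesis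
      unfolding hook_const_not_dvd[OF False \<open>0 < t\<close>]
      by (intro tendsto_of_real hook_ratio_limit_not_dvd False)
  qed
qed

end
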